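(* Let $\tilde{\mathfrak g}$ be a Lie algebra of dimension $7$ with a $\mathfrak z$-standard Sasaki structure whose Kähler reduction $\check{\mathfrak g}$ is an abelian pseudo-Kähler Lie algebra. Then, up to isometry and $\mathcal D$-homothety, the metric Lie algebra $(\tilde{\mathfrak g},\tilde g)$ is one of the following (with $\tau=\pm1$, $\lambda\in\mathbb R$). With metric $\tilde g=\pm(e^1\otimes e^1+e^2\otimes e^2+e^3\otimes e^3+e^4\otimes e^4)+\tau e^5\otimes e^5+e^6\otimes e^6+\tau e^7\otimes e^7$: 1. $(0,0,0,0,0,-2e^{12}-2e^{34}-2\tau e^{57},0)$; 2. $(0,0,0,0,2e^{57},-2e^{12}-2e^{34}-2\tau e^{57},0)$; 3. $(0,0,e^{37},e^{47},2\tau e^{34}+2e^{57},-2e^{12}-2e^{34}-2\tau e^{57},0)$; 4. $(e^{17},e^{27},e^{37},e^{47},2\tau e^{12}+2\tau e^{34}+2e^{57},-2e^{12}-2e^{34}-2\tau e^{57},0)$. With metric $\tilde g=\pm(e^1\otimes e^1+e^2\otimes e^2-e^3\otimes e^3-e^4\otimes e^4)+\tau e^5\otimes e^5+e^6\otimes e^6+\tau e^7\otimes e^7$: 5. $(0,0,0,0,0,-2e^{12}+2e^{34}-2\tau e^{57},0)$; 6. $(0,0,0,0,2e^{57},-2e^{12}+2e^{34}-2\tau e^{57},0)$; 7. $(0,0,e^{37},e^{47},-2\tau e^{34}+2e^{57},-2e^{12}+2e^{34}-2\tau e^{57},0)$; 8. $(e^{17},e^{27},e^{37},e^{47},2\tau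 e^{12}-2\tau e^{34}+2e^{57},-2e^{12}+2e^{34}-2\tau e^{57},0)$; 9. $(\frac12e^{17}+2\lambda e^{27}-\frac12e^{37}-\lambda e^{47},\ -2\lambda e^{17}+\frac12e^{27}+\lambda e^{37}-\frac12e^{47},\ \frac12e^{17}+\lambda e^{27}-\frac12e^{37},\ -\lambda e^{17}+\frac12e^{27}-\frac12e^{47},\ \tau e^{12}-\tau e^{14}+\tau e^{23}+\tau e^{34},\ -2e^{12}+2e^{34}-2\tau e^{57},\ 0)$; 10. $(\frac12e^{17}+2\lambda e^{27}-\frac32e^{37}-\lambda e^{47},\ -2\lambda e^{17}+\frac12e^{27}+\lambda e^{37}-\frac32e^{47},\ -\frac12e^{17}+\lambda e^{27}-\frac12e^{37},\ -\lambda e^{17}-\frac12e^{27}-\frac12e^{47},\ \tau e^{12}-\tau e^{14}+\tau e^{23}+\tau e^{34}+2e^{57},\ -2e^{12}+2e^{34}-2\tau e^{57},\ 0)$; 11. $(\frac32e^{17}+2\lambda e^{27}+\frac12e^{37}-\lambda e^{47},\ -2\lambda e^{17}+\frac32e^{27}+\lambda e^{37}+\frac12e^{47},\ \frac32e^{17}+\lambda e^{27}+\frac12e^{37},\ -\lambda e^{17}+\frac32e^{27}+\frac12e^{47},\ 3\tau e^{12}-\tau e^{14}+\tau e^{23}-\tau e^{34}+2e^{57},\ -2e^{12}+2e^{34}-2\tau e^{57},\ 0)$. In each case the Sasaki structure is given by $\xi=e_6$, $\eta=e^6$, $2\Phi=d\eta=de^6$.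
   Context: All structures are left-invariant and are described on a real finite-dimensional Lie algebra; metrics are nondegenerate symmetric bilinear forms of arbitrary signature. Notation: a tuple $(\beta_1,\dots,\beta_n)$ of $2$-forms denotes the Lie algebra with basis $e_1,\dots,e_n$ whose dual basis satisfies $de^i=\beta_i$, where $d\alpha(x,y)=-\alpha([x,y])$; $e^{ij}=e^i\wedge e^j=e^i\otimes e^j-e^j\otimes e^i$. An almost contact metric structure on a Lie algebra of dimension $2n+1$ is $(\phi,\xi,\eta,\tilde g)$ with $\phi$ an endomorphism, $\xi$ a vector, $\eta$ a $1$-form and $\tilde g$ a metric such that $\eta(\xi)=1$, $\eta\circ\phi=0$, $\phi^2=-\mathrm{Id}+\eta\otimes\xi$, $\tilde g(\xi,\xi)=1$, $\eta=\tilde g(\xi,\cdot)$, $\tilde g(\phi x,\phi y)=\tilde g(x,y)-\eta(x)\eta(y)$. Its fundamental form is $\Phi=\tilde g(\cdot,\phi\,\cdot)$. It is Sasaki if $d\eta=2\Phi$ and $N_\phi+d\eta\otimes\xi=0$, where $N_\phi(x,y)=\phi^2[x,y]+[\phi x,\phi y]-\phi[\phi x,y]-\phi[x,\phi y]$. A Sasaki structure on $\tilde{\mathfrak g}$ is $\mathfrak z$-standard if there is an orthogonal decomposition $\tilde{\mathfrak g}=\mathfrak g\rtimes\mathrm{Span}\{e_0\}$ with $\mathfrak g$ a nilpotent ideal, $\tilde g=g+\tau e^0\otimes e^0$ with $g$ a metric on $\mathfrak g$ and $\tau=\pm1$ ($e^0$ dual to $e_0$ and vanishing on $\mathfrak g$),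 and $b=-\phi(e_0)$ in the center of $\mathfrak g$. In this case $b$ and $\xi$ are central in $\mathfrak g$, and the quotient $\check{\mathfrak g}=\mathfrak g/\mathrm{Span}\{b,\xi\}\cong\mathrm{Span}\{b,\xi\}^\perp\subset\mathfrak g$, with the induced metric $\check g$, the form $\omega=\frac12d\eta$ and the complex structure $J$ with $\omega=\check g(\cdot,J\,\cdot)$, is a pseudo-Kähler Lie algebra, called the Kähler reduction of $\tilde{\mathfrak g}$. Two metric Lie algebras are isometric if the corresponding connected, simply connected Lie groups with left-invariant metrics are isometric as pseudo-Riemannian manifolds. A $\mathcal D$-homothety replaces a Sasaki structure $(\phi,\xi,\eta,g)$ by $(\phi,a^{-1}\xi,a\eta,ag+(a^2-a)\eta\otimes\eta)$ for a constant $a>0$. The theorem says that after a $\mathcal D$-homothety and passing to an isometric metric Lie algebra, $\tilde{\mathfrak g}$ with its Sasaki structure is one of those listed, for some choice of $\tau$, of the sign $\pm$, and (in 9–11) of $\lambda$. *)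

theory Defs
  imports "HOL-Analysis.Analysis" "HOL-Algebra.Group"
begin

section \<open>Lie algebras and Sasaki structures\<close>

text \<open>A Lie algebra is a finite-dimensional real vector space together with a bracket
  \<open>br\<close>. The type class \<open>euclidean_space\<close> is only used to express
  finite-dimensionality and to do calculus; its inner product plays no role.\<close>

definition lie_algebra :: "('a::real_vector \<Rightarrow> 'a \<Rightarrow> 'a) \<Rightarrow> bool" where
  "lie_algebra br \<longleftrightarrow> bilinear br \<and> (\<forall>x. br x x = 0) \<and>
     (\<forall>x y z. br x (br y z) + br y (br z x) + br z (br x y) = 0)"

definition lie_d :: "('a \<Rightarrow> 'a \<Rightarrow> 'a) \<Rightarrow> ('a \<Rightarrow> real) \<Rightarrow> 'a \<Rightarrow> 'a \<Rightarrow> real" where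
  "lie_d br \<alpha> x y = - \<alpha> (br x y)"

definition pseudo_metric :: "('a::real_vector \<Rightarrow> 'a \<Rightarrow> real) \<Rightarrow> bool" where
  "pseudo_metric g \<longleftrightarrow> bilinear g \<and> (\<forall>x y. g x y = g y x) \<and>
     (\<forall>x. (\<forall>y. g x y = 0) \<longrightarrow> x = 0)"

record 'a contact_structure =
  Phi :: "'a \<Rightarrow> 'a"
  Xi :: 'a
  Eta :: "'a \<Rightarrow> real"
  Met :: "'a \<Rightarrow> 'a \<Rightarrow> real"

definition almost_contact_metric :: "'a::real_vector contact_structure \<Rightarrow> bool" where
  "almost_contact_metric S \<longleftrightarrow>
     linear (Phi S) \<and> linear (Eta S) \<and> pseudo_metric (Met S) \<and>
     Eta S (Xi S) = 1 \<and>
     (\<forall>x. Eta S (Phi S x) = 0) \<and>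
     (\<forall>x. Phi S (Phi S x) = - x + Eta S x *\<^sub>R Xi S) \<and>
     Met S (Xi S) (Xi S) = 1 \<and>
     (\<forall>x. Eta S x = Met S (Xi S) x) \<and>
     (\<forall>x y. Met S (Phi S x) (Phi S y) = Met S x y - Eta S x * Eta S y)"

definition fundamental_form :: "'a contact_structure \<Rightarrow> 'a \<Rightarrow> 'a \<Rightarrow> real" where
  "fundamental_form S x y = Met S x (Phi S y)"

definition nijenhuis ::
    "('a::real_vector \<Rightarrow> 'a \<Rightarrow> 'a) \<Rightarrow> ('a \<Rightarrow> 'a) \<Rightarrow> 'a \<Rightarrow> 'a \<Rightarrow> 'a" where
  "nijenhuis br \<phi> x y =
     \<phi> (\<phi> (br x y)) + br (\<phi> x) (\<phi> y) - \<phi> (br (\<phi> x) y) - \<phi> (br x (\<phi> y))"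

definition sasaki ::
    "('a::real_vector \<Rightarrow> 'a \<Rightarrow> 'a) \<Rightarrow> 'a contact_structure \<Rightarrow> bool" where
  "sasaki br S \<longleftrightarrow> lie_algebra br \<and> almost_contact_metric S \<and>
     (\<forall>x y. lie_d br (Eta S) x y = 2 * fundamental_form S x y) \<and>
     (\<forall>x y. nijenhuis br (Phi S) x y + lie_d br (Eta S) x y *\<^sub>R Xi S = 0)"

definition D_homothety ::
    "real \<Rightarrow> 'a::real_vector contact_structure \<Rightarrow> 'a contact_structure" where
  "D_homothety a S = \<lparr> Phi = Phi S, Xi = inverse a *\<^sub>R Xi S, Eta = (\<lambda>x. a * Eta S x),
     Met = (\<lambda>x y. a * Met S x y + (a\<^sup>2 - a) * (Eta S x * Eta S y)) \<rparr>"


section \<open>z-standard Sasaki structures and their Kaehler reduction\<close>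

definition ideal_of :: "('a::real_vector \<Rightarrow> 'a \<Rightarrow> 'a) \<Rightarrow> 'a set \<Rightarrow> bool" where
  "ideal_of br \<gg> \<longleftrightarrow> subspace \<gg> \<and> (\<forall>x. \<forall>y\<in>\<gg>. br x y \<in> \<gg>)"

primrec lower_central ::
    "('a::real_vector \<Rightarrow> 'a \<Rightarrow> 'a) \<Rightarrow> 'a set \<Rightarrow> nat \<Rightarrow> 'a set" where
  "lower_central br \<gg> 0 = \<gg>"
| "lower_central br \<gg> (Suc k) = span {br x y | x y. x \<in> \<gg> \<and> y \<in> lower_central br \<gg> k}"

definition nilpotent_in :: "('a::real_vector \<Rightarrow> 'a \<Rightarrow> 'a) \<Rightarrow> 'a set \<Rightarrow> bool" where
  "nilpotent_in br \<gg> \<longleftrightarrow> (\<exists>k. lower_central br \<gg> k = {0})"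

definition center_of :: "('a::real_vector \<Rightarrow> 'a \<Rightarrow> 'a) \<Rightarrow> 'a set \<Rightarrow> 'a set" where
  "center_of br \<gg> = {z \<in> \<gg>. \<forall>x\<in>\<gg>. br z x = 0}"

text \<open>\<open>z_standard br S \<gg> e0 \<tau>\<close>: the whole space is the orthogonal semidirect product
  of the nilpotent ideal \<open>\<gg>\<close> and the line spanned by \<open>e0\<close>. Orthogonality,
  \<open>Met S e0 e0 = \<tau>\<close> and nondegeneracy of \<open>Met S\<close> on the whole space amount to
  \<open>Met S\<close> being \<open>g + \<tau> e\<^sup>0 \<otimes> e\<^sup>0\<close> with \<open>g\<close> a metric on \<open>\<gg>\<close>.\<close>

definition z_standard ::
    "('a::real_vector \<Rightarrow> 'a \<Rightarrow> 'a) \<Rightarrow> 'a contact_structure \<Rightarrow> 'a set \<Rightarrow> 'a \<Rightarrow> real \<Rightarrow> bool" where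
  "z_standard br S \<gg> e0 \<tau> \<longleftrightarrow>
     ideal_of br \<gg> \<and> nilpotent_in br \<gg> \<and>
     e0 \<notin> \<gg> \<and> (\<forall>v. \<exists>x\<in>\<gg>. \<exists>c. v = x + c *\<^sub>R e0) \<and>
     (\<forall>x\<in>\<gg>. Met S x e0 = 0) \<and> \<tau> \<in> {1, -1} \<and> Met S e0 e0 = \<tau> \<and>
     - Phi S e0 \<in> center_of br \<gg>"

text \<open>The Kaehler reduction is the quotient of \<open>\<gg>\<close> by the span of \<open>b = - \<phi> e0\<close> and
  \<open>\<xi>\<close>, with the induced pseudo-Kaehler structure. Its bracket sends the classes of
  \<open>x\<close> and \<open>y\<close> to the class of \<open>br x y\<close>, so it is abelian exactly when all these
  classes vanish.\<close>

definition coset_of :: "'a::real_vector set \<Rightarrow> 'a \<Rightarrow> 'a set" where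
  "coset_of I x = {x + z | z. z \<in> I}"

definition abelian_kahler_reduction ::
    "('a::real_vector \<Rightarrow> 'a \<Rightarrow> 'a) \<Rightarrow> 'a contact_structure \<Rightarrow> 'a set \<Rightarrow> 'a \<Rightarrow> bool" where
  "abelian_kahler_reduction br S \<gg> e0 \<longleftrightarrow>
     (let I = span {- Phi S e0, Xi S}
      in \<forall>x\<in>\<gg>. \<forall>y\<in>\<gg>. coset_of I (br x y) = coset_of I 0)"


section \<open>Smooth manifolds\<close>

primrec Ck_on :: "nat \<Rightarrow> ('a::real_normed_vector \<Rightarrow> 'b::real_normed_vector) \<Rightarrow> 'a set \<Rightarrow> bool"
where
  "Ck_on 0 f S = continuous_on S f"
| "Ck_on (Suc k) f S = ((\<forall>x\<in>S. f differentiable (at x)) \<and>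
     (\<forall>v. Ck_on k (\<lambda>x. frechet_derivative f (at x) v) S))"

text \<open>Intended for open \<open>S\<close> in a finite-dimensional space.\<close>

definition smooth_on :: "'a::real_normed_vector set \<Rightarrow> ('a \<Rightarrow> 'b::real_normed_vector) \<Rightarrow> bool"
  where "smooth_on S f \<longleftrightarrow> (\<forall>k. Ck_on k f S)"

text \<open>A chart is a pair of its domain and its coordinate map.\<close>

type_synonym ('p, 'a) chart = "'p set \<times> ('p \<Rightarrow> 'a)"

definition in_charts ::
    "('p, 'a) chart \<Rightarrow> ('q, 'b) chart \<Rightarrow> ('p \<Rightarrow> 'q) \<Rightarrow> 'a \<Rightarrow> 'b" where
  "in_charts C D f = (\<lambda>x. snd D (f (inv_into (fst C) (snd C) x)))"

definition differential ::
    "('p, 'a::real_normed_vector) chart \<Rightarrow> ('q, 'b::real_normed_vector) chart \<Rightarrow>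
     ('p \<Rightarrow> 'q) \<Rightarrow> 'p \<Rightarrow> 'a \<Rightarrow> 'b" where
  "differential C D f p = frechet_derivative (in_charts C D f) (at (snd C p))"

definition smooth_manifold ::
    "'p topology \<Rightarrow> ('p, 'a::euclidean_space) chart set \<Rightarrow> bool" where
  "smooth_manifold X A \<longleftrightarrow>
     Hausdorff_space X \<and> second_countable X \<and>
     (\<Union>C\<in>A. fst C) = topspace X \<and>
     (\<forall>C\<in>A. openin X (fst C) \<and> open (snd C ` fst C) \<and>
        homeomorphic_map (subtopology X (fst C)) (top_of_set (snd C ` fst C)) (snd C)) \<and>
     (\<forall>C\<in>A. \<forall>D\<in>A. smooth_on (snd C ` (fst C \<inter> fst D)) (in_charts C D (\<lambda>p. p)))"

definition smooth_map ::
    "'p topology \<Rightarrow> ('p, 'a::euclidean_space) chart set \<Rightarrow>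
     'q topology \<Rightarrow> ('q, 'b::euclidean_space) chart set \<Rightarrow> ('p \<Rightarrow> 'q) \<Rightarrow> bool" where
  "smooth_map X A Y B f \<longleftrightarrow> continuous_map X Y f \<and>
     (\<forall>C\<in>A. \<forall>D\<in>B. smooth_on (snd C ` {p \<in> fst C. f p \<in> fst D}) (in_charts C D f))"

definition prod_atlas ::
    "('p, 'a) chart set \<Rightarrow> ('q, 'b) chart set \<Rightarrow> ('p \<times> 'q, 'a \<times> 'b) chart set" where
  "prod_atlas A B = {(fst C \<times> fst D, map_prod (snd C) (snd D)) | C D. C \<in> A \<and> D \<in> B}"

definition simply_connected_space :: "'p topology \<Rightarrow> bool" where
  "simply_connected_space X \<longleftrightarrow> path_connected_space X \<and>
     (\<forall>p. pathin X p \<and> p 0 = p 1 \<longrightarrow>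
        (\<exists>a. homotopic_with (\<lambda>q. q 0 = q 1) (top_of_set {0..1}) X p (\<lambda>t. a)))"


section \<open>Lie groups with a given Lie algebra\<close>

text \<open>A Lie group (on top of the group record of HOL-Algebra) together with an assignment
  \<open>v \<mapsto> E\<^sub>v\<close> of vector fields to the elements of a vector space: \<open>frame G C p v\<close> is the
  tuple of components, in the chart \<open>C\<close>, of the tangent vector \<open>E\<^sub>v(p)\<close>.\<close>

record ('p, 'a) framed_group = "'p monoid" +
  topo :: "'p topology"
  atlas :: "('p, 'a) chart set"
  frame :: "('p, 'a) chart \<Rightarrow> 'p \<Rightarrow> 'a \<Rightarrow> 'a"

definition lie_group :: "('p, 'a::euclidean_space) framed_group \<Rightarrow> bool" where
  "lie_group G \<longleftrightarrow> group G \<and> topspace (topo G) = carrier G \<and>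
     smooth_manifold (topo G) (atlas G) \<and>
     smooth_map (prod_topology (topo G) (topo G)) (prod_atlas (atlas G) (atlas G))
       (topo G) (atlas G) (\<lambda>(p, q). p \<otimes>\<^bsub>G\<^esub> q) \<and>
     smooth_map (topo G) (atlas G) (topo G) (atlas G) (m_inv G)"

text \<open>The map \<open>v \<mapsto> E\<^sub>v\<close> is an isomorphism from the Lie algebra given by \<open>br\<close> onto the
  Lie algebra of left-invariant vector fields: each \<open>v \<mapsto> E\<^sub>v(p)\<close> is a linear
  isomorphism onto the tangent space at \<open>p\<close>; the differential of left translation by
  \<open>h\<close> sends \<open>E\<^sub>v(p)\<close> to \<open>E\<^sub>v(hp)\<close> (taking \<open>h\<close> to be the unit gives compatibility with
  changes of charts); and \<open>[E\<^sub>v, E\<^sub>w]\<close>, which in a chart reads \<open>dE\<^sub>w(E\<^sub>v) - dE\<^sub>v(E\<^sub>w)\<close>,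
  is the vector field of \<open>br v w\<close>.\<close>

definition lie_algebra_of ::
    "('a::euclidean_space \<Rightarrow> 'a \<Rightarrow> 'a) \<Rightarrow> ('p, 'a) framed_group \<Rightarrow> bool" where
  "lie_algebra_of br G \<longleftrightarrow>
     (\<forall>C\<in>atlas G. \<forall>p\<in>fst C. linear (frame G C p) \<and> bij (frame G C p)) \<and>
     (\<forall>C\<in>atlas G. \<forall>D\<in>atlas G. \<forall>h\<in>carrier G. \<forall>p\<in>fst C. h \<otimes>\<^bsub>G\<^esub> p \<in> fst D \<longrightarrow>
        (\<forall>v. differential C D (\<lambda>q. h \<otimes>\<^bsub>G\<^esub> q) p (frame G C p v) = frame G D (h \<otimes>\<^bsub>G\<^esub> p) v)) \<and>
     (\<forall>C\<in>atlas G. \<forall>p\<in>fst C. \<forall>v w.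
        (let E = (\<lambda>u x. frame G C (inv_into (fst C) (snd C) x) u); x = snd C p
         in frechet_derivative (E w) (at x) (E v x) - frechet_derivative (E v) (at x) (E w x)
              = E (br v w) x))"

definition simply_connected_lie_group ::
    "('a::euclidean_space \<Rightarrow> 'a \<Rightarrow> 'a) \<Rightarrow> ('p, 'a) framed_group \<Rightarrow> bool" where
  "simply_connected_lie_group br G \<longleftrightarrow>
     lie_group G \<and> lie_algebra_of br G \<and>
     connected_space (topo G) \<and> simply_connected_space (topo G)"


section \<open>Isometries\<close>

definition diffeomorphism ::
    "('p, 'a::euclidean_space) framed_group \<Rightarrow> ('q, 'b::euclidean_space) framed_group \<Rightarrow>
     ('p \<Rightarrow> 'q) \<Rightarrow> bool" where
  "diffeomorphism G H f \<longleftrightarrow> bij_betw f (carrier G) (carrier H) \<and>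
     smooth_map (topo G) (atlas G) (topo H) (atlas H) f \<and>
     smooth_map (topo H) (atlas H) (topo G) (atlas G) (inv_into (carrier G) f)"

text \<open>The left-invariant metric on tangent vectors at \<open>p\<close>, given by components in \<open>C\<close>.\<close>

definition left_invariant_metric ::
    "('p, 'a) framed_group \<Rightarrow> ('a \<Rightarrow> 'a \<Rightarrow> real) \<Rightarrow> ('p, 'a) chart \<Rightarrow> 'p \<Rightarrow> 'a \<Rightarrow> 'a \<Rightarrow> real" where
  "left_invariant_metric G g C p X Y =
     g (inv_into UNIV (frame G C p) X) (inv_into UNIV (frame G C p) Y)"

definition isometry ::
    "('p, 'a::euclidean_space) framed_group \<Rightarrow> ('a \<Rightarrow> 'a \<Rightarrow> real) \<Rightarrow>
     ('q, 'b::euclidean_space) framed_group \<Rightarrow> ('b \<Rightarrow> 'b \<Rightarrow> real) \<Rightarrow> ('p \<Rightarrow> 'q) \<Rightarrow> bool" where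
  "isometry G g H h f \<longleftrightarrow> diffeomorphism G H f \<and>
     (\<forall>C\<in>atlas G. \<forall>D\<in>atlas H. \<forall>p\<in>fst C. f p \<in> fst D \<longrightarrow>
        (\<forall>X Y. left_invariant_metric H h D (f p) (differential C D f p X) (differential C D f p Y)
                 = left_invariant_metric G g C p X Y))"

text \<open>The map \<open>f\<close> carries the left-invariant tensor fields \<open>\<xi>\<close>, \<open>\<eta>\<close>, \<open>\<phi>\<close> on \<open>G\<close>
  determined by \<open>S\<close> to those on \<open>H\<close> determined by \<open>T\<close>.\<close>

definition preserves_contact ::
    "('p, 'a::euclidean_space) framed_group \<Rightarrow> 'a contact_structure \<Rightarrow>
     ('q, 'b::euclidean_space) framed_group \<Rightarrow> 'b contact_structure \<Rightarrow> ('p \<Rightarrow> 'q) \<Rightarrow> bool" where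
  "preserves_contact G S H T f \<longleftrightarrow>
     (\<forall>C\<in>atlas G. \<forall>D\<in>atlas H. \<forall>p\<in>fst C. f p \<in> fst D \<longrightarrow>
        (let E = frame G C p; F = frame H D (f p); df = differential C D f p in
           df (E (Xi S)) = F (Xi T) \<and>
           (\<forall>X. Eta T (inv_into UNIV F (df X)) = Eta S (inv_into UNIV E X)) \<and>
           (\<forall>X. df (E (Phi S (inv_into UNIV E X))) = F (Phi T (inv_into UNIV F (df X))))))"

text \<open>The underlying metric Lie algebras are isometric, by an isometry of the connected,
  simply connected Lie groups which matches the contact structures. These groups are unique up
  to isomorphism, so it does not matter which ones are taken. Connected Lie groups have
  at most the cardinality of the continuum, so their points can be taken in the type of their
  (positive-dimensional) Lie algebra.\<close>

definition sasaki_isometric ::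
    "('a::euclidean_space \<Rightarrow> 'a \<Rightarrow> 'a) \<Rightarrow> 'a contact_structure \<Rightarrow>
     ('b::euclidean_space \<Rightarrow> 'b \<Rightarrow> 'b) \<Rightarrow> 'b contact_structure \<Rightarrow> bool" where
  "sasaki_isometric br S br' S' \<longleftrightarrow>
     (\<exists>(G :: ('a, 'a) framed_group) (H :: ('b, 'b) framed_group) f.
        simply_connected_lie_group br G \<and> simply_connected_lie_group br' H \<and>
        isometry G (Met S) H (Met S') f \<and> preserves_contact G S H S' f)"


section \<open>The list\<close>

text \<open>\<open>listed_d n \<tau> l x y\<close> is the vector of the numbers \<open>de\<^sup>1(x,y), \<dots>, de\<^sup>7(x,y)\<close> for the
  \<open>n\<close>-th Lie algebra, where \<open>e\<close> is the standard basis of \<open>\<real>\<^sup>7\<close> and the local \<open>e i j\<close>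
  stands for \<open>e\<^sup>i\<^sup>j(x,y)\<close>. The index \<open>7 :: 7\<close> is the same as \<open>0\<close>.\<close>

definition listed_d :: "nat \<Rightarrow> real \<Rightarrow> real \<Rightarrow> real^7 \<Rightarrow> real^7 \<Rightarrow> real^7" where
  "listed_d n \<tau> l x y =
    (let e = (\<lambda>i j :: 7. x $ i * y $ j - x $ j * y $ i) in
     [vector [0, 0, 0, 0,
        0,
        -2 * e 1 2 - 2 * e 3 4 - 2 * \<tau> * e 5 7, 0],
      vector [0, 0, 0, 0,
        2 * e 5 7,
        -2 * e 1 2 - 2 * e 3 4 - 2 * \<tau> * e 5 7, 0],
      vector [0, 0, e 3 7, e 4 7,
        2 * \<tau> * e 3 4 + 2 * e 5 7,
        -2 * e 1 2 - 2 * e 3 4 - 2 * \<tau> * e 5 7, 0],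
      vector [e 1 7, e 2 7, e 3 7, e 4 7,
        2 * \<tau> * e 1 2 + 2 * \<tau> * e 3 4 + 2 * e 5 7,
        -2 * e 1 2 - 2 * e 3 4 - 2 * \<tau> * e 5 7, 0],
      vector [0, 0, 0, 0,
        0,
        -2 * e 1 2 + 2 * e 3 4 - 2 * \<tau> * e 5 7, 0],
      vector [0, 0, 0, 0,
        2 * e 5 7,
        -2 * e 1 2 + 2 * e 3 4 - 2 * \<tau> * e 5 7, 0],
      vector [0, 0, e 3 7, e 4 7,
        -2 * \<tau> * e 3 4 + 2 * e 5 7,
        -2 * e 1 2 + 2 * e 3 4 - 2 * \<tau> * e 5 7, 0],
      vector [e 1 7, e 2 7, e 3 7, e 4 7,
        2 * \<tau> * e 1 2 - 2 * \<tau> * e 3 4 + 2 * e 5 7,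
        -2 * e 1 2 + 2 * e 3 4 - 2 * \<tau> * e 5 7, 0],
      vector [
        1/2 * e 1 7 + 2 * l * e 2 7 - 1/2 * e 3 7 - l * e 4 7,
        -2 * l * e 1 7 + 1/2 * e 2 7 + l * e 3 7 - 1/2 * e 4 7,
        1/2 * e 1 7 + l * e 2 7 - 1/2 * e 3 7,
        - l * e 1 7 + 1/2 * e 2 7 - 1/2 * e 4 7,
        \<tau> * e 1 2 - \<tau> * e 1 4 + \<tau> * e 2 3 + \<tau> * e 3 4,
        -2 * e 1 2 + 2 * e 3 4 - 2 * \<tau> * e 5 7, 0],
      vector [
        1/2 * e 1 7 + 2 * l * e 2 7 - 3/2 * e 3 7 - l * e 4 7,
        -2 * l * e 1 7 + 1/2 * e 2 7 + l * e 3 7 - 3/2 * e 4 7,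
        -1/2 * e 1 7 + l * e 2 7 - 1/2 * e 3 7,
        - l * e 1 7 - 1/2 * e 2 7 - 1/2 * e 4 7,
        \<tau> * e 1 2 - \<tau> * e 1 4 + \<tau> * e 2 3 + \<tau> * e 3 4 + 2 * e 5 7,
        -2 * e 1 2 + 2 * e 3 4 - 2 * \<tau> * e 5 7, 0],
      vector [
        3/2 * e 1 7 + 2 * l * e 2 7 + 1/2 * e 3 7 - l * e 4 7,
        -2 * l * e 1 7 + 3/2 * e 2 7 + l * e 3 7 + 1/2 * e 4 7,
        3/2 * e 1 7 + l * e 2 7 + 1/2 * e 3 7,
        - l * e 1 7 + 3/2 * e 2 7 + 1/2 * e 4 7,
        3 * \<tau> * e 1 2 - \<tau> * e 1 4 + \<tau> * e 2 3 - \<tau> * e 3 4 + 2 * e 5 7,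
        -2 * e 1 2 + 2 * e 3 4 - 2 * \<tau> * e 5 7, 0]] ! (n - 1))"

text \<open>From \<open>d\<alpha>(x,y) = -\<alpha>([x,y])\<close>, applied to the dual basis.\<close>

definition listed_bracket :: "nat \<Rightarrow> real \<Rightarrow> real \<Rightarrow> real^7 \<Rightarrow> real^7 \<Rightarrow> real^7" where
  "listed_bracket n \<tau> l x y = - listed_d n \<tau> l x y"

definition listed_metric :: "nat \<Rightarrow> real \<Rightarrow> real \<Rightarrow> real^7 \<Rightarrow> real^7 \<Rightarrow> real" where
  "listed_metric n s \<tau> x y =
     (if n \<le> 4
      then s * (x $ 1 * y $ 1 + x $ 2 * y $ 2 + x $ 3 * y $ 3 + x $ 4 * y $ 4)
      else s * (x $ 1 * y $ 1 + x $ 2 * y $ 2 - x $ 3 * y $ 3 - x $ 4 * y $ 4))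
     + \<tau> * x $ 5 * y $ 5 + x $ 6 * y $ 6 + \<tau> * x $ 7 * y $ 7"

text \<open>Here \<open>\<phi>\<close> is the endomorphism determined by \<open>2 g(x, \<phi> y) = de\<^sup>6(x,y)\<close>; it exists and
  is unique because the metric is nondegenerate.\<close>

definition listed_structure ::
    "nat \<Rightarrow> real \<Rightarrow> real \<Rightarrow> real \<Rightarrow> (real^7) contact_structure" where
  "listed_structure n s \<tau> l =
     \<lparr> Phi = (THE \<phi>. \<forall>x y. 2 * listed_metric n s \<tau> x (\<phi> y) = listed_d n \<tau> l x y $ 6),
       Xi = axis 6 1, Eta = (\<lambda>x. x $ 6), Met = listed_metric n s \<tau> \<rparr>"

end

theory Submission
  imports Defs
begin

text \<open>
  Put \<open>b = - \<phi> e\<^sub>0\<close> and let \<open>V\<close> be the orthogonal complement of \<open>b\<close>, \<open>\<xi>\<close>, \<open>e\<^sub>0\<close>. The Sasaki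
  identities and the commutativity of the Kaehler reduction force \<open>\<xi>\<close> to be central, \<open>V\<close> to be
  invariant under \<open>ad e\<^sub>0\<close>, and \<open>[e\<^sub>0, b] = h b - 2 \<tau> \<xi>\<close> for a number \<open>h\<close>. Split the restriction of
  \<open>ad e\<^sub>0\<close> to \<open>V\<close> into its symmetric part \<open>Q\<close> and its skew part \<open>K\<close>, which commute with \<open>\<phi>\<close>. Then
  \<open>[x, y] = 2 \<tau> g(Q x, \<phi> y) b - 2 g(x, \<phi> y) \<xi>\<close> on \<open>V\<close>, and all that is left of the Jacobi identity is
  the equation \<open>2 Q\<^sup>2 + [Q, K] = h Q\<close> (\<open>bracket_parts\<close>). A D-homothety together with a
  rescaling of \<open>e\<^sub>0\<close> multiplies \<open>h\<close> by an arbitrary nonzero number, so that \<open>h\<close> may be taken in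
  \<open>{0, 2}\<close>.

  A skew operator \<open>N\<close> on \<open>V\<close> that commutes with \<open>\<phi>\<close>, \<open>Q\<close> and \<open>K\<close> can be added to \<open>ad e\<^sub>0\<close> without
  changing the isometry class. To see this, both simply connected groups are realised on the
  Lie algebra itself, as semidirect products of a two-step nilpotent group with the line. The
  left-invariant frame at \<open>p\<close> then depends on \<open>ad e\<^sub>0\<close> only through \<open>exp (t ad e\<^sub>0)\<close>, where \<open>t\<close> is the
  coordinate of \<open>p\<close> along \<open>e\<^sub>0\<close>; adding \<open>N\<close> composes the frame with \<open>exp (t N)\<close>, which preserves all
  structure tensors. Hence the identity map is an isometry (\<open>sasaki_isometric_semidirect\<close>).

  It remains to find normal forms of \<open>Q\<close> and \<open>K\<close> on the complex plane \<open>V\<close> with its Hermitian form.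
  The Cayley--Hamilton theorem and the traces of the equation show that the eigenvalues of \<open>Q\<close> lie in
  \<open>{0, h/2}\<close> (\<open>quadratic_Q\<close>). If \<open>Q\<close> is zero, a projection or the identity, then \<open>K\<close> commutes with \<open>Q\<close>
  and is removed altogether; the rank of \<open>Q\<close>, the number \<open>h\<close> and the signature give the first eight
  cases. Otherwise
  \<open>F = Q - \<sigma>\<close> is nonzero and nilpotent, the Hermitian form is indefinite, and \<open>[F, K] = \<kappa> F\<close> with
  \<open>\<kappa> = \<plusminus> h\<close>. For \<open>\<kappa> = 0\<close> the part \<open>K\<close> is removed again. For \<open>\<kappa> \<noteq> 0\<close> a suitable null basis turns \<open>K\<close>
  into a fixed diagonal matrix plus a multiple of \<open>\<phi>\<close>, and this multiple is removed. These are the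
  cases 9 to 11, always reached with \<open>\<lambda> = 0\<close>.
\<close>

section \<open>One-parameter groups of linear maps\<close>

text \<open>A wrapper around the bounded linear endomorphisms: as a Banach algebra, it has the exponential
  function with its addition theorem and its derivative.\<close>

typedef (overloaded) ('a::euclidean_space) endo = "UNIV :: ('a \<Rightarrow>\<^sub>L 'a) set" ..

setup_lifting type_definition_endo

instantiation endo :: (euclidean_space) real_normed_algebra_1
begin

lift_definition zero_endo :: "'a endo" is 0 .
lift_definition one_endo :: "'a endo" is id_blinfun .
lift_definition plus_endo :: "'a endo \<Rightarrow> 'a endo \<Rightarrow> 'a endo" is "(+)" .
lift_definition minus_endo :: "'a endo \<Rightarrow> 'a endo \<Rightarrow> 'a endo" is "(-)" .
lift_definition uminus_endo :: "'a endo \<Rightarrow> 'a endo" is uminus .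
lift_definition times_endo :: "'a endo \<Rightarrow> 'a endo \<Rightarrow> 'a endo" is blinfun_compose .
lift_definition scaleR_endo :: "real \<Rightarrow> 'a endo \<Rightarrow> 'a endo" is scaleR .
lift_definition norm_endo :: "'a endo \<Rightarrow> real" is norm .
definition dist_endo :: "'a endo \<Rightarrow> 'a endo \<Rightarrow> real" where "dist_endo x y = norm (x - y)"
definition sgn_endo :: "'a endo \<Rightarrow> 'a endo" where "sgn_endo x = inverse (norm x) *\<^sub>R x"
definition uniformity_endo :: "('a endo \<times> 'a endo) filter"
  where "uniformity_endo = (INF e\<in>{0<..}. principal {(x, y). dist x y < e})"
definition open_endo :: "'a endo set \<Rightarrow> bool"
  where "open_endo U = (\<forall>x\<in>U. \<forall>\<^sub>F (x', y) in uniformity. x' = x \<longrightarrow> y \<in> U)"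

instance
proof
  fix x y z :: "'a endo" and a b :: real
  show "x + y + z = x + (y + z)" "x + y = y + x" "0 + x = x" "- x + x = 0" "x - y = x + - y"
    "a *\<^sub>R (x + y) = a *\<^sub>R x + a *\<^sub>R y" "(a + b) *\<^sub>R x = a *\<^sub>R x + b *\<^sub>R x"
    "a *\<^sub>R b *\<^sub>R x = (a * b) *\<^sub>R x" "1 *\<^sub>R x = x"
    by (transfer; simp add: algebra_simps)+
  show "x * y * z = x * (y * z)" "1 * x = x" "x * 1 = x"
    "(x + y) * z = x * z + y * z" "x * (y + z) = x * y + x * z"
    "a *\<^sub>R x * y = a *\<^sub>R (x * y)" "x * a *\<^sub>R y = a *\<^sub>R (x * y)"
    by (transfer; simp add: blinfun_eqI blinfun.bilinear_simps)+
  show "(0::'a endo) \<noteq> 1"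
    by transfer (metis norm_blinfun_id norm_zero zero_neq_one)
  show "dist x y = norm (x - y)" "sgn x = inverse (norm x) *\<^sub>R x" 
    by (simp_all add: dist_endo_def sgn_endo_def)
  show "(uniformity :: ('a endo \<times> 'a endo) filter)
      = (INF e\<in>{0<..}. principal {(x, y). dist x y < e})"
    by (rule uniformity_endo_def)
  show "open U = (\<forall>x\<in>U. \<forall>\<^sub>F (x', y) in uniformity. x' = x \<longrightarrow> y \<in> U)" for U :: "'a endo set"
    by (rule open_endo_def)
  show "norm x = 0 \<longleftrightarrow> x = 0" "norm (a *\<^sub>R x) = \<bar>a\<bar> * norm x" "norm (1::'a endo) = 1"
    by (transfer; simp)+
  show "norm (x + y) \<le> norm x + norm y" "norm (x * y) \<le> norm x * norm y"
    by (transfer; simp add: norm_triangle_ineq norm_blinfun_compose)+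
qed

end

lift_definition endo_apply :: "'a::euclidean_space endo \<Rightarrow> 'a \<Rightarrow> 'a" is blinfun_apply .

lift_definition endo_of :: "('a::euclidean_space \<Rightarrow> 'a) \<Rightarrow> 'a endo" is
  "\<lambda>A. Blinfun A" .

lemma endo_apply_times: "endo_apply (x * y) v = endo_apply x (endo_apply y v)"
  by transfer simp

lemma endo_apply_one: "endo_apply 1 v = v"
  by transfer simp

lemma endo_apply_of: "linear A \<Longrightarrow> endo_apply (endo_of A) v = A v"
  by transfer (simp add: bounded_linear_Blinfun_apply linear_conv_bounded_linear)

lemma endo_eqI: "(\<And>v. endo_apply x v = endo_apply y v) \<Longrightarrow> x = y"
  by transfer (simp add: blinfun_eqI)

lemma bounded_bilinear_endo_apply: "bounded_bilinear endo_apply"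
proof
  fix a a' :: "'a endo" and b b' :: 'a and r :: real
  show "endo_apply (a + a') b = endo_apply a b + endo_apply a' b"
    "endo_apply a (b + b') = endo_apply a b + endo_apply a b'"
    "endo_apply (r *\<^sub>R a) b = r *\<^sub>R endo_apply a b"
    "endo_apply a (r *\<^sub>R b) = r *\<^sub>R endo_apply a b"
    by (transfer; simp add: blinfun.bilinear_simps)+
  have "norm (endo_apply a b) \<le> norm a * norm b * 1" for a :: "'a endo" and b
    by transfer (simp add: norm_blinfun)
  then show "\<exists>K. \<forall>(a::'a endo) b. norm (endo_apply a b) \<le> norm a * norm b * K"
    by blast
qed

instance endo :: (euclidean_space) banach
proof
  fix X :: "nat \<Rightarrow> 'a endo" assume "Cauchy X"
  then have "Cauchy (\<lambda>n. Rep_endo (X n))"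
    unfolding Cauchy_def dist_norm norm_endo.rep_eq minus_endo.rep_eq .
  then obtain L where L: "(\<lambda>n. Rep_endo (X n)) \<longlonglongrightarrow> L"
    using Cauchy_convergent convergent_def by blast
  have "X \<longlonglongrightarrow> Abs_endo L"
    using L unfolding LIMSEQ_def dist_norm norm_endo.rep_eq minus_endo.rep_eq
    by (simp add: Abs_endo_inverse)
  then show "convergent X" unfolding convergent_def by blast
qed

definition flow :: "('a::euclidean_space \<Rightarrow> 'a) \<Rightarrow> real \<Rightarrow> 'a \<Rightarrow> 'a" where
  "flow A t = endo_apply (exp (t *\<^sub>R endo_of A))"

lemma linear_flow: "linear (flow A t)"
  unfolding flow_def by (rule bounded_linear.linear, rule bounded_bilinear.bounded_linear_right,
      rule bounded_bilinear_endo_apply)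

lemma flow_zero [simp]: "flow A 0 x = x"
  by (simp add: flow_def endo_apply_one)

lemma flow_id [simp]: "flow (\<lambda>_. 0) t x = x"
proof -
  have "endo_of (\<lambda>_::'a. 0) = 0"
    using bounded_bilinear.zero_left[OF bounded_bilinear_endo_apply]
    by (intro endo_eqI) (simp add: endo_apply_of linear_zero)
  then show ?thesis
    by (simp add: flow_def endo_apply_one)
qed

lemma flow_add: "flow A (s + t) x = flow A s (flow A t x)"
  unfolding flow_def scaleR_add_left
  by (subst exp_add_commuting) (simp_all add: endo_apply_times)

lemma flow_minus [simp]: "flow A (- t) (flow A t x) = x" "flow A t (flow A (- t) x) = x"
  using flow_add[of A "- t" t x] flow_add[of A t "- t" x] by simp_all

lemma flow_commute:
  assumes "linear A"
  shows "flow A t (A x) = A (flow A t x)"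
  using exp_times_scaleR_commute[of t "endo_of A"] assms
  unfolding flow_def by (metis endo_apply_of endo_apply_times)

lemma flow_has_vector_derivative:
  assumes "linear A"
  shows "((\<lambda>t. flow A t x) has_vector_derivative A (flow A t x)) (at t)"
proof -
  have "((\<lambda>t. exp (t *\<^sub>R endo_of A)) has_vector_derivative endo_of A * exp (t *\<^sub>R endo_of A))
      (at t)"
    by (rule exp_scaleR_has_vector_derivative_left)
  from bounded_linear.has_vector_derivative[OF
      bounded_bilinear.bounded_linear_left[OF bounded_bilinear_endo_apply] this, of x]
  show ?thesis
    unfolding flow_def by (simp add: endo_apply_times endo_apply_of assms)
qed

lemma flow_plus:
  assumes A: "linear A" and B: "linear B" and AB: "\<And>x. A (B x) = B (A x)"
  shows "flow (\<lambda>x. A x + B x) t x = flow A t (flow B t x)"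
proof -
  have lin: "linear (\<lambda>x. A x + B x)"
    by (rule linear_compose_add[OF A B])
  have "endo_of (\<lambda>x. A x + B x) = endo_of A + endo_of B"
    by (intro endo_eqI) (simp add: endo_apply_of A B lin
        bounded_bilinear.add_left[OF bounded_bilinear_endo_apply])
  moreover have "endo_of A * endo_of B = endo_of B * endo_of A"
    by (intro endo_eqI) (simp add: endo_apply_times endo_apply_of A B AB)
  ultimately show ?thesis
    unfolding flow_def by (simp add: scaleR_add_right exp_add_commuting endo_apply_times)
qed

text \<open>Both sides, as functions of \<open>t\<close>, solve \<open>y' = C y\<close> with the same initial value. Derivations of a
  bracket (all three maps equal), skew maps for a metric (\<open>C = 0\<close>) and intertwining maps (\<open>B = 0\<close> on
  the real line) are special cases.\<close>

lemma flow_bilinear: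
  fixes h :: "'a::euclidean_space \<Rightarrow> 'b::euclidean_space \<Rightarrow> 'c::euclidean_space"
  assumes h: "bilinear h" and A: "linear A" and B: "linear B" and C: "linear C"
    and der: "\<And>x y. C (h x y) = h (A x) y + h x (B y)"
  shows "flow C t (h x y) = h (flow A t x) (flow B t y)"
proof -
  have bh: "bounded_bilinear h"
    using h bilinear_conv_bounded_bilinear by blast
  define k where "k t = flow C (- t) (h (flow A t x) (flow B t y))" for t
  have 1: "((\<lambda>t. h (flow A t x) (flow B t y)) has_vector_derivative
      h (flow A t x) (B (flow B t y)) + h (A (flow A t x)) (flow B t y)) (at t)" for t
    by (intro bounded_bilinear.has_vector_derivative[OF bh] flow_has_vector_derivative A B)
  have 2: "((\<lambda>t. exp ((- t) *\<^sub>R endo_of C)) has_vector_derivative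
      - (exp ((- t) *\<^sub>R endo_of C) * endo_of C)) (at t)" for t
    using exp_scaleR_has_vector_derivative_right[of "- endo_of C" t] by simp
  have "(k has_vector_derivative 0) (at t)" for t
  proof -
    have "(k has_vector_derivative 
        endo_apply (exp ((- t) *\<^sub>R endo_of C)) 
          (h (flow A t x) (B (flow B t y)) + h (A (flow A t x)) (flow B t y))
        + endo_apply (- (exp ((- t) *\<^sub>R endo_of C) * endo_of C)) (h (flow A t x) (flow B t y))) (at t)"
      unfolding k_def flow_def[of C]
      by (rule bounded_bilinear.has_vector_derivative[OF bounded_bilinear_endo_apply 2 1])
    then show ?thesis
      by (simp add: endo_apply_times endo_apply_of C der add.commute
          bounded_bilinear.minus_left[OF bounded_bilinear_endo_apply])
  qed
  then have "k t = k 0"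
    using has_vector_derivative_zero_constant[of UNIV k] by (metis UNIV_I convex_UNIV)
  then have "flow C t (k t) = flow C t (h x y)"
    by (simp add: k_def)
  then show ?thesis
    by (simp add: k_def)
qed

lemma flow_intertwine:
  fixes F :: "'a::euclidean_space \<Rightarrow> 'b::euclidean_space"
  assumes F: "linear F" and A: "linear A" and B: "linear B" and FA: "\<And>x. F (A x) = B (F x)"
  shows "F (flow A t x) = flow B t (F x)"
proof -
  have b: "bilinear (\<lambda>x (r::real). r *\<^sub>R F x)"
    using F unfolding bilinear_def 
    by (auto intro!: linearI simp: linear_add linear_scale algebra_simps)
  show ?thesis
    using flow_bilinear[OF b A linear_zero B, where t = t and x = x and y = 1] FA
    by (simp add: linear_scale[OF B])
qed

section \<open>Smooth functions on a vector space\<close>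

text \<open>In a single global chart, smoothness is needed only on \<open>UNIV\<close> and only for functions built from
  linear maps, bilinear maps and exponentials. The characterisation of \<open>Ck_on\<close> by an arbitrary
  derivative, instead of the chosen Frechet derivative, makes these closure properties simple
  inductions.\<close>

lemma Ck_on_SucI:
  assumes "\<And>x. (f has_derivative f' x) (at x)" "\<And>v. Ck_on k (\<lambda>x. f' x v) UNIV"
  shows "Ck_on (Suc k) f UNIV"
proof -
  have "frechet_derivative f (at x) = f' x" for x
    using frechet_derivative_at[OF assms(1)] by simp
  then show ?thesis
    using assms by (auto simp: differentiable_def)
qed

lemma Ck_on_SucE:
  assumes "Ck_on (Suc k) f UNIV"
  obtains f' where "\<And>x. (f has_derivative f' x) (at x)" "\<And>v. Ck_on k (\<lambda>x. f' x v) UNIV"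
  using assms that[of "\<lambda>x. frechet_derivative f (at x)"] by (auto simp: frechet_derivative_works)

lemma Ck_on_Suc_imp: "Ck_on (Suc k) f UNIV \<Longrightarrow> Ck_on k f UNIV"
proof (induction k arbitrary: f)
  case 0
  then show ?case
    by (auto intro!: continuous_at_imp_continuous_on differentiable_imp_continuous_within)
next
  case (Suc k)
  then show ?case by (metis Ck_on.simps(2))
qed

lemma Ck_on_const: "Ck_on k (\<lambda>x. c) UNIV"
  by (induction k arbitrary: c) (auto intro: Ck_on_SucI[where f' = "\<lambda>x v. 0"] simp del: Ck_on.simps(2))

lemma Ck_on_bounded_linear: "bounded_linear f \<Longrightarrow> Ck_on k f UNIV"
  by (cases k) (auto intro: Ck_on_SucI[where f' = "\<lambda>x. f"] linear_continuous_on Ck_on_const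
      bounded_linear_imp_has_derivative simp del: Ck_on.simps(2))

lemma Ck_on_add:
  assumes "Ck_on k f UNIV" "Ck_on k g UNIV"
  shows "Ck_on k (\<lambda>x. f x + g x) UNIV"
  using assms
proof (induction k arbitrary: f g)
  case 0
  then show ?case by (simp add: continuous_on_add)
next
  case (Suc k)
  obtain f' g' where "\<And>x. (f has_derivative f' x) (at x)" "\<And>v. Ck_on k (\<lambda>x. f' x v) UNIV"
    "\<And>x. (g has_derivative g' x) (at x)" "\<And>v. Ck_on k (\<lambda>x. g' x v) UNIV"
    using Suc.prems by (metis Ck_on_SucE)
  then show ?case
    by (intro Ck_on_SucI[where f' = "\<lambda>x v. f' x v + g' x v"] has_derivative_add Suc.IH)
qed

text \<open>The product rule expresses the derivative by values of the same bilinear map, so the induction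
  closes as soon as the two factors vary.\<close>

lemma Ck_on_bilinear:
  assumes h: "bounded_bilinear h" and "Ck_on k f UNIV" "Ck_on k g UNIV"
  shows "Ck_on k (\<lambda>x. h (f x) (g x)) UNIV"
  using assms(2,3)
proof (induction k arbitrary: f g)
  case 0
  then show ?case by (simp add: bounded_bilinear.continuous_on[OF h])
next
  case (Suc k)
  obtain f' g' where "\<And>x. (f has_derivative f' x) (at x)" "\<And>v. Ck_on k (\<lambda>x. f' x v) UNIV"
    "\<And>x. (g has_derivative g' x) (at x)" "\<And>v. Ck_on k (\<lambda>x. g' x v) UNIV"
    using Suc.prems by (metis Ck_on_SucE)
  moreover have "Ck_on k f UNIV" "Ck_on k g UNIV"
    using Suc.prems by (simp_all only: Ck_on_Suc_imp)
  ultimately show ?case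
    by (intro Ck_on_SucI[where f' = "\<lambda>x v. h (f x) (g' x v) + h (f' x v) (g x)"] Ck_on_add
        Suc.IH bounded_bilinear.FDERIV[OF h])
qed

lemma has_derivative_exp_scaleR:
  fixes a :: "'b::{real_normed_algebra_1,banach}"
  assumes "bounded_linear l"
  shows "((\<lambda>x. exp (l x *\<^sub>R a)) has_derivative (\<lambda>v. l v *\<^sub>R (exp (l x *\<^sub>R a) * a))) (at x)"
proof -
  have "((\<lambda>t. exp (t *\<^sub>R a)) has_derivative (\<lambda>r. r *\<^sub>R (exp (l x *\<^sub>R a) * a))) (at (l x))"
    using exp_scaleR_has_vector_derivative_right[of a "l x"] by (simp add: has_vector_derivative_def)
  from has_derivative_compose[OF bounded_linear_imp_has_derivative[OF assms] this]
  show ?thesis .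
qed

text \<open>The derivative of the exponential contains the exponential itself, one order less.\<close>

lemma Ck_on_exp_scaleR:
  fixes a :: "'b::{real_normed_algebra_1,banach}"
  assumes "bounded_linear l"
  shows "Ck_on k (\<lambda>x. exp (l x *\<^sub>R a)) UNIV"
proof (induction k)
  case 0
  show ?case
    by (auto intro!: continuous_at_imp_continuous_on
        has_derivative_continuous[OF has_derivative_exp_scaleR[OF assms]])
next
  case (Suc k)
  show ?case
    by (intro Ck_on_SucI[where f' = "\<lambda>x v. l v *\<^sub>R (exp (l x *\<^sub>R a) * a)"]
        has_derivative_exp_scaleR assms Ck_on_bilinear[OF bounded_bilinear_scaleR] Ck_on_const
        Ck_on_bilinear[OF bounded_bilinear_mult] Suc.IH)
qed

lemma Ck_on_flow:
  assumes "bounded_linear l" "Ck_on k f UNIV"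
  shows "Ck_on k (\<lambda>x. flow A (l x) (f x)) UNIV"
  unfolding flow_def
  by (intro Ck_on_bilinear[OF bounded_bilinear_endo_apply] Ck_on_exp_scaleR assms)

section \<open>A simply connected Lie group on a vector space\<close>

text \<open>Here \<open>\<theta>\<close> is the coordinate along the acting line, \<open>B\<close> the bracket of the two-step nilpotent
  kernel of \<open>\<theta>\<close>, extended to the whole space, and \<open>D\<close> the derivation by which the line acts. The
  Baker--Campbell--Hausdorff product of the kernel is \<open>p + q + B(p, q)/2\<close>, and twisting the second
  factor by \<open>exp (\<theta>(p) D)\<close> gives the semidirect product; the additive structure along the line is
  contained in the sum because \<open>D\<close> and \<open>B\<close> take values in the kernel.\<close>

definition semidirect_bracket ::
    "('a::euclidean_space \<Rightarrow> real) \<Rightarrow> ('a \<Rightarrow> 'a \<Rightarrow> 'a) \<Rightarrow> ('a \<Rightarrow> 'a) \<Rightarrow> 'a \<Rightarrow> 'a \<Rightarrow> 'a" where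
  "semidirect_bracket \<theta> B D x y = B x y + \<theta> x *\<^sub>R D y - \<theta> y *\<^sub>R D x"

definition semidirect_mult ::
    "('a::euclidean_space \<Rightarrow> real) \<Rightarrow> ('a \<Rightarrow> 'a \<Rightarrow> 'a) \<Rightarrow> ('a \<Rightarrow> 'a) \<Rightarrow> 'a \<Rightarrow> 'a \<Rightarrow> 'a" where
  "semidirect_mult \<theta> B D p q = p + flow D (\<theta> p) q + (1/2) *\<^sub>R B p (flow D (\<theta> p) q)"

text \<open>The derivative at the unit of left translation by \<open>p\<close>.\<close>

definition semidirect_frame ::
    "('a::euclidean_space \<Rightarrow> real) \<Rightarrow> ('a \<Rightarrow> 'a \<Rightarrow> 'a) \<Rightarrow> ('a \<Rightarrow> 'a) \<Rightarrow> 'a \<Rightarrow> 'a \<Rightarrow> 'a" where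
  "semidirect_frame \<theta> B D p v = flow D (\<theta> p) v + (1/2) *\<^sub>R B p (flow D (\<theta> p) v)"

definition semidirect_group ::
    "('a::euclidean_space \<Rightarrow> real) \<Rightarrow> ('a \<Rightarrow> 'a \<Rightarrow> 'a) \<Rightarrow> ('a \<Rightarrow> 'a) \<Rightarrow> ('a, 'a) framed_group" where
  "semidirect_group \<theta> B D =
     \<lparr> carrier = UNIV, mult = semidirect_mult \<theta> B D, one = 0,
       topo = euclidean, atlas = {(UNIV, id)}, frame = (\<lambda>_. semidirect_frame \<theta> B D) \<rparr>"

lemma semidirect_group_simps [simp]:
  "carrier (semidirect_group \<theta> B D) = UNIV"
  "mult (semidirect_group \<theta> B D) = semidirect_mult \<theta> B D"
  "one (semidirect_group \<theta> B D) = 0"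
  "topo (semidirect_group \<theta> B D) = euclidean"
  "atlas (semidirect_group \<theta> B D) = {(UNIV, id)}"
  "frame (semidirect_group \<theta> B D) C = semidirect_frame \<theta> B D"
  by (simp_all add: semidirect_group_def)

lemma in_charts_global: "in_charts (UNIV, id) (UNIV, id) f = f"
  by (simp add: in_charts_def)

lemma differential_global: "differential (UNIV, id) (UNIV, id) f p = frechet_derivative f (at p)"
  by (simp add: differential_def in_charts_global)

lemma prod_atlas_global:
  "prod_atlas {(UNIV, id)} {(UNIV, id)} = {(UNIV :: ('a \<times> 'b) set, id)}"
  by (simp add: prod_atlas_def map_prod.id)

lemma smooth_map_global:
  assumes "smooth_on UNIV f"
  shows "smooth_map euclidean {(UNIV, id)} euclidean {(UNIV, id)} f"
proof -
  have "continuous_on UNIV f"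
    using assms Ck_on.simps(1) unfolding smooth_on_def by metis
  then show ?thesis
    using assms by (simp add: smooth_map_def in_charts_global)
qed

lemma smooth_manifold_euclidean: "smooth_manifold euclidean {(UNIV :: 'a::euclidean_space set, id)}"
  unfolding smooth_manifold_def
proof (intro conjI)
  show "Hausdorff_space (euclidean :: 'a topology)"
    by simp
  show "second_countable (euclidean :: 'a topology)"
  proof -
    obtain \<B> :: "'a set set" where "countable \<B>" "topological_basis \<B>"
      using ex_countable_basis by blast
    then show ?thesis
      unfolding second_countable_def
      by (metis open_openin topological_basisE topological_basis_open)
  qed
  show "\<forall>C\<in>{(UNIV, id)}. \<forall>D\<in>{(UNIV, id)}.
      smooth_on (snd C ` (fst C \<inter> fst D)) (in_charts C D (\<lambda>p. p :: 'a))"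
    by (simp add: in_charts_global smooth_on_def Ck_on_bounded_linear bounded_linear_ident)
qed auto

lemma path_connected_space_euclidean:
  "path_connected_space (euclidean :: 'a::real_normed_vector topology)"
  unfolding path_connected_space_def
proof (intro ballI)
  fix x y :: 'a
  show "\<exists>g. pathin euclidean g \<and> g 0 = x \<and> g 1 = y"
    by (rule exI[of _ "\<lambda>t. (1 - t) *\<^sub>R x + t *\<^sub>R y"]) (auto simp: pathin_def intro!: continuous_intros)
qed

lemma simply_connected_space_euclidean:
  "simply_connected_space (euclidean :: 'a::real_normed_vector topology)"
  unfolding simply_connected_space_def
proof (intro conjI allI impI)
  show "path_connected_space (euclidean :: 'a topology)"
    by (rule path_connected_space_euclidean)
  fix p :: "real \<Rightarrow> 'a" assume "pathin euclidean p \<and> p 0 = p 1"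
  then have p: "continuous_on {0..1} p" "p 0 = p 1"
    by (simp_all add: pathin_def)
  have "homotopic_with (\<lambda>q. q 0 = q 1) (top_of_set {0..1}) euclidean p (\<lambda>t. 0)"
    unfolding homotopic_with_def
  proof (intro exI[of _ "\<lambda>(s, t). (1 - s) *\<^sub>R p t"] conjI allI ballI)
    show "continuous_map (prod_topology (top_of_set {0..1}) (top_of_set {0..1})) euclidean
      (\<lambda>(s, t). (1 - s) *\<^sub>R p t)"
      using p(1) by (auto simp: case_prod_unfold simp flip: subtopology_Times
          intro!: continuous_intros continuous_on_compose2[OF p(1)])
  qed (use p(2) in auto)
  then show "\<exists>a. homotopic_with (\<lambda>q. q 0 = q 1) (top_of_set {0..1}) euclidean p (\<lambda>t. a)" ..
qed

locale semidirect =
  fixes \<theta> :: "'a::euclidean_space \<Rightarrow> real" and B :: "'a \<Rightarrow> 'a \<Rightarrow> 'a" and D :: "'a \<Rightarrow> 'a"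
  assumes linear_\<theta>: "linear \<theta>" and bilinear_B: "bilinear B" and linear_D: "linear D"
    and B_self: "B x x = 0"
    and \<theta>_B: "\<theta> (B x y) = 0"
    and B_B: "B (B x y) z = 0"
    and \<theta>_D: "\<theta> (D x) = 0"
    and D_B: "D (B x y) = B (D x) y + B x (D y)"
begin

lemma bounded_linear_\<theta>: "bounded_linear \<theta>"
  using linear_\<theta> linear_conv_bounded_linear by blast

lemma bounded_bilinear_B: "bounded_bilinear B"
  using bilinear_B bilinear_conv_bounded_bilinear by blast

lemmas B_simps = bounded_bilinear.add_left[OF bounded_bilinear_B]
  bounded_bilinear.add_right[OF bounded_bilinear_B]
  bounded_bilinear.scaleR_left[OF bounded_bilinear_B]
  bounded_bilinear.scaleR_right[OF bounded_bilinear_B]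
  bounded_bilinear.minus_left[OF bounded_bilinear_B]
  bounded_bilinear.minus_right[OF bounded_bilinear_B]
  bounded_bilinear.diff_left[OF bounded_bilinear_B]
  bounded_bilinear.diff_right[OF bounded_bilinear_B]
  bounded_bilinear.zero_left[OF bounded_bilinear_B]
  bounded_bilinear.zero_right[OF bounded_bilinear_B]

lemmas \<theta>_simps = linear_add[OF linear_\<theta>] linear_scale[OF linear_\<theta>] linear_0[OF linear_\<theta>]
  linear_neg[OF linear_\<theta>] linear_diff[OF linear_\<theta>]

lemmas flow_simps = linear_add[OF linear_flow] linear_scale[OF linear_flow] linear_0[OF linear_flow]
  linear_neg[OF linear_flow] linear_diff[OF linear_flow]

lemma B_skew: "B x y = - B y x"
proof -
  have "B x y + B y x = B (x + y) (x + y)"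
    by (simp only: B_simps) (simp add: B_self)
  then have "B x y + B y x = 0"
    by (simp add: B_self)
  then show ?thesis
    by (simp add: eq_neg_iff_add_eq_0)
qed

lemma B_B': "B x (B y z) = 0"
  using B_skew[of x] B_B by (simp add: B_simps)

lemma \<theta>_flow: "\<theta> (flow D t x) = \<theta> x"
  using flow_intertwine[OF linear_\<theta> linear_D linear_zero] by (simp add: \<theta>_D)

lemma flow_B: "flow D t (B x y) = B (flow D t x) (flow D t y)"
  by (rule flow_bilinear[OF bilinear_B linear_D linear_D linear_D D_B])

lemmas group_simps = semidirect_mult_def semidirect_frame_def B_simps \<theta>_simps flow_simps 
  flow_B \<theta>_flow \<theta>_B B_B B_B' flow_add B_self

lemma semidirect_mult_assoc:
  "semidirect_mult \<theta> B D (semidirect_mult \<theta> B D p q) r =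
   semidirect_mult \<theta> B D p (semidirect_mult \<theta> B D q r)"
  by (simp add: group_simps algebra_simps)

lemma group_semidirect: "group (semidirect_group \<theta> B D)"
proof (rule groupI)
  fix p
  have "semidirect_mult \<theta> B D (- flow D (- \<theta> p) p) p = 0"
    by (simp add: group_simps)
  then show "\<exists>q\<in>carrier (semidirect_group \<theta> B D).
      q \<otimes>\<^bsub>semidirect_group \<theta> B D\<^esub> p = \<one>\<^bsub>semidirect_group \<theta> B D\<^esub>"
    by auto
qed (simp_all add: semidirect_mult_assoc, simp add: group_simps)

lemma m_inv_semidirect:
  "m_inv (semidirect_group \<theta> B D) = (\<lambda>p. - flow D (- \<theta> p) p)"
proof
  fix p
  have "semidirect_mult \<theta> B D (- flow D (- \<theta> p) p) p = 0"
    by (simp add: group_simps)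
  then show "inv\<^bsub>semidirect_group \<theta> B D\<^esub> p = - flow D (- \<theta> p) p"
    by (intro group.inv_equality[OF group_semidirect]) simp_all
qed

lemma smooth_semidirect_mult: "smooth_on UNIV (\<lambda>(p, q). semidirect_mult \<theta> B D p q)"
  unfolding smooth_on_def semidirect_mult_def case_prod_unfold
  by (intro allI Ck_on_add Ck_on_bilinear[OF bounded_bilinear_scaleR]
      Ck_on_bilinear[OF bounded_bilinear_B] Ck_on_const Ck_on_flow Ck_on_bounded_linear
      bounded_linear_fst bounded_linear_snd bounded_linear_compose[OF bounded_linear_\<theta>])

lemma smooth_semidirect_inv: "smooth_on UNIV (\<lambda>p. - flow D (- \<theta> p) p)"
proof -
  have "Ck_on k (\<lambda>p. (- 1) *\<^sub>R flow D (- \<theta> p) p) UNIV" for k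
    by (intro Ck_on_bilinear[OF bounded_bilinear_scaleR] Ck_on_const Ck_on_flow
        Ck_on_bounded_linear bounded_linear_ident bounded_linear_minus bounded_linear_\<theta>)
  then show ?thesis
    by (simp add: smooth_on_def)
qed

lemma lie_group_semidirect: "lie_group (semidirect_group \<theta> B D)"
  unfolding lie_group_def
  using smooth_map_global[OF smooth_semidirect_mult] smooth_map_global[OF smooth_semidirect_inv]
  by (simp add: group_semidirect smooth_manifold_euclidean m_inv_semidirect prod_atlas_global
      case_prod_unfold)

lemma linear_semidirect_frame: "linear (semidirect_frame \<theta> B D p)"
  by (rule linearI) (simp_all add: group_simps algebra_simps)

text \<open>The frame is the composite of the flow with the unipotent map \<open>w \<mapsto> w + B(p, w)/2\<close>: a
  vector \<open>w\<close> in the kernel of the latter is a value of \<open>B p\<close>, and \<open>B p\<close> annihilates its own values.\<close>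

lemma bij_semidirect_frame: "bij (semidirect_frame \<theta> B D p)"
proof -
  have "v = 0" if "semidirect_frame \<theta> B D p v = 0" for v
  proof -
    let ?w = "flow D (\<theta> p) v"
    from that have w: "?w = - (1/2) *\<^sub>R B p ?w"
      by (simp add: semidirect_frame_def eq_neg_iff_add_eq_0)
    then have "B p ?w = - (1/2) *\<^sub>R B p (B p ?w)"
      by (metis bounded_bilinear.scaleR_right[OF bounded_bilinear_B])
    then have "?w = 0"
      using w by (simp add: B_B')
    then show "v = 0"
      by (metis flow_minus(1) linear_0 linear_flow)
  qed
  then have "inj (semidirect_frame \<theta> B D p)"
    using linear_injective_0 linear_semidirect_frame by blast
  then show ?thesis
    using linear_injective_imp_surjective[OF linear_semidirect_frame] by (simp add: bij_def)
qed

lemma has_derivative_left_translation: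
  "(semidirect_mult \<theta> B D h has_derivative
     (\<lambda>v. flow D (\<theta> h) v + (1/2) *\<^sub>R B h (flow D (\<theta> h) v))) (at p)"
proof -
  have b: "bounded_linear (\<lambda>v. flow D (\<theta> h) v + (1/2) *\<^sub>R B h (flow D (\<theta> h) v))"
    using linear_semidirect_frame[of h] linear_conv_bounded_linear
    unfolding semidirect_frame_def[abs_def] by blast
  have "semidirect_mult \<theta> B D h = (\<lambda>q. h + (flow D (\<theta> h) q + (1/2) *\<^sub>R B h (flow D (\<theta> h) q)))"
    by (simp add: semidirect_mult_def fun_eq_iff add.assoc)
  then show ?thesis
    using has_derivative_add[OF has_derivative_const bounded_linear_imp_has_derivative[OF b]]
    by simp
qed

lemma has_derivative_semidirect_frame:
  "((\<lambda>p. semidirect_frame \<theta> B D p v) has_derivative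
     (\<lambda>u. \<theta> u *\<^sub>R D (flow D (\<theta> p) v) + (1/2) *\<^sub>R (B p (\<theta> u *\<^sub>R D (flow D (\<theta> p) v))
          + B u (flow D (\<theta> p) v)))) (at p)"
proof -
  have "((\<lambda>t. flow D t v) has_derivative (\<lambda>r. r *\<^sub>R D (flow D (\<theta> p) v))) (at (\<theta> p))"
    using flow_has_vector_derivative[OF linear_D] by (simp add: has_vector_derivative_def)
  from has_derivative_compose[OF bounded_linear_imp_has_derivative[OF bounded_linear_\<theta>] this]
  have f: "((\<lambda>p. flow D (\<theta> p) v) has_derivative (\<lambda>u. \<theta> u *\<^sub>R D (flow D (\<theta> p) v))) (at p)" .
  show ?thesis
    unfolding semidirect_frame_def
    by (intro has_derivative_add f has_derivative_scaleR_right
        bounded_bilinear.FDERIV[OF bounded_bilinear_B has_derivative_ident f])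
qed

text \<open>The left translations are affine, so left invariance of the frame is associativity of the
  product to first order. In the commutator of two frame fields the terms with \<open>\<theta>\<close> come from
  differentiating the flow and give \<open>D\<close>; those from \<open>B(p, _)\<close> give \<open>B\<close>, twice one half.\<close>

lemma lie_algebra_of_semidirect:
  "lie_algebra_of (semidirect_bracket \<theta> B D) (semidirect_group \<theta> B D)"
proof -
  let ?F = "semidirect_frame \<theta> B D"
  have 1: "frechet_derivative (semidirect_mult \<theta> B D h) (at p) (?F p v)
      = ?F (semidirect_mult \<theta> B D h p) v" for h p v
    unfolding frechet_derivative_at[OF has_derivative_left_translation, symmetric]
    by (simp add: group_simps algebra_simps)
  have 2: "frechet_derivative (\<lambda>x. ?F x w) (at x) (?F x v) - frechet_derivative (\<lambda>x. ?F x v) (at x) (?F x w)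
      = ?F x (semidirect_bracket \<theta> B D v w)" for x v w
    unfolding frechet_derivative_at[OF has_derivative_semidirect_frame, symmetric]
    using B_skew[of "flow D (\<theta> x) w" "flow D (\<theta> x) v"]
    by (simp add: group_simps semidirect_bracket_def flow_commute[OF linear_D] algebra_simps
       flip: scaleR_add_left)
  show ?thesis
    unfolding lie_algebra_of_def
    using 1 2 by (simp add: linear_semidirect_frame bij_semidirect_frame differential_global Let_def)
qed

theorem simply_connected_lie_group_semidirect:
  "simply_connected_lie_group (semidirect_bracket \<theta> B D) (semidirect_group \<theta> B D)"
  unfolding simply_connected_lie_group_def
  by (simp add: lie_group_semidirect lie_algebra_of_semidirect simply_connected_space_euclidean
      path_connected_space_euclidean path_connected_imp_connected_space)

end

section \<open>An isometry criterion\<close>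

text \<open>The map \<open>T\<close> need not be a homomorphism of Lie algebras: it may intertwine the derivations up to the
  skew map \<open>K\<close>. Since \<open>K\<close> commutes with \<open>D\<close>, the flow of \<open>D + K\<close> is the flow of \<open>D\<close> composed with that of
  \<open>K\<close>, and the latter preserves the metric, \<open>\<phi>\<close>, \<open>\<xi>\<close> and \<open>\<eta>\<close>. Thus \<open>T\<close>, regarded as a map of groups, sends
  the left-invariant frame at \<open>p\<close> to the left-invariant frame at \<open>T p\<close> up to a symmetry of the
  structure.\<close>

theorem sasaki_isometric_semidirect:
  fixes T :: "'a::euclidean_space \<Rightarrow> 'b::euclidean_space" and S :: "'a contact_structure"
    and S' :: "'b contact_structure"
  assumes sd: "semidirect \<theta> B D" and sd': "semidirect \<theta>' B' D'"
    and T: "linear T" "bij T" and K: "linear K"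
    and T_\<theta>: "\<And>x. \<theta>' (T x) = \<theta> x"
    and T_B: "\<And>x y. T (B x y) = B' (T x) (T y)"
    and T_D: "\<And>x. D' (T x) = T (D x + K x)"
    and D_K: "\<And>x. D (K x) = K (D x)"
    and S: "linear (Phi S)" "linear (Eta S)" "bilinear (Met S)"
    and K_Met: "\<And>x y. Met S (K x) y + Met S x (K y) = 0"
    and K_Phi: "\<And>x. K (Phi S x) = Phi S (K x)"
    and K_Xi: "K (Xi S) = 0"
    and K_Eta: "\<And>x. Eta S (K x) = 0"
    and T_Met: "\<And>x y. Met S' (T x) (T y) = Met S x y"
    and T_Phi: "\<And>x. T (Phi S x) = Phi S' (T x)"
    and T_Xi: "T (Xi S) = Xi S'"
    and T_Eta: "\<And>x. Eta S' (T x) = Eta S x"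
  shows "sasaki_isometric (semidirect_bracket \<theta> B D) S (semidirect_bracket \<theta>' B' D') S'"
proof -
  interpret L: semidirect \<theta> B D by (rule sd)
  interpret L': semidirect \<theta>' B' D' by (rule sd')
  let ?G = "semidirect_group \<theta> B D" and ?H = "semidirect_group \<theta>' B' D'"
  let ?E = "semidirect_frame \<theta> B D" and ?F = "semidirect_frame \<theta>' B' D'"
  have DK: "linear (\<lambda>x. D x + K x)"
    by (rule linear_compose_add[OF L.linear_D K])
  have flow_T: "flow D' t (T x) = T (flow D t (flow K t x))" for t x
    using flow_intertwine[OF T(1) DK L'.linear_D, of t x] flow_plus[OF L.linear_D K D_K, of t x]
    by (simp add: T_D)
  have frame_T: "?F (T p) (T v) = T (?E p (flow K (\<theta> p) v))" for p v
    by (simp add: semidirect_frame_def T_\<theta> flow_T T_B linear_add[OF T(1)] linear_scale[OF T(1)])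
  have K_met_flow: "Met S (flow K t x) (flow K t y) = Met S x y" for t x y
    using flow_bilinear[OF S(3) K K linear_zero, of t x y] by (simp add: K_Met)
  have K_phi_flow: "flow K t (Phi S x) = Phi S (flow K t x)" for t x
    using flow_intertwine[OF S(1) K K, of t x] by (simp add: K_Phi)
  have K_eta_flow: "Eta S (flow K t x) = Eta S x" for t x
    using flow_intertwine[OF S(2) K linear_zero, of t x] by (simp add: K_Eta)
  have K_xi_flow: "flow K t (Xi S) = Xi S" for t
  proof -
    have "linear (\<lambda>r::real. r *\<^sub>R Xi S)"
      by (rule linearI) (simp_all add: algebra_simps)
    from flow_intertwine[OF this linear_zero K, of t 1] show ?thesis
      by (simp add: linear_scale[OF K] K_Xi)
  qed
  have inv_E: "inv_into UNIV (?E p) (?E p v) = v" for p v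
    using L.bij_semidirect_frame by (simp add: bij_def)
  have inv_F: "inv_into UNIV (?F p) (?F p v) = v" for p v
    using L'.bij_semidirect_frame by (simp add: bij_def)
  have E_inv: "?E p (inv_into UNIV (?E p) v) = v" for p v
    using L.bij_semidirect_frame by (simp add: bij_def surj_f_inv_f)
  have inv_T: "inv_into UNIV (?F (T p)) (T X) = T (flow K (- \<theta> p) (inv_into UNIV (?E p) X))" for p X
  proof -
    have "T X = ?F (T p) (T (flow K (- \<theta> p) (inv_into UNIV (?E p) X)))"
      by (simp add: frame_T E_inv)
    then show ?thesis
      by (simp add: inv_F)
  qed
  have bT: "bounded_linear T"
    using T(1) linear_conv_bounded_linear by blast
  then have dT: "frechet_derivative T (at p) = T" for p
    using frechet_derivative_at[OF bounded_linear_imp_has_derivative[OF bT]] by simp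
  have "linear (inv_into UNIV T)"
  proof (rule linearI)
    fix x y :: 'b and r :: real
    show "inv_into UNIV T (x + y) = inv_into UNIV T x + inv_into UNIV T y"
      "inv_into UNIV T (r *\<^sub>R x) = r *\<^sub>R inv_into UNIV T x"
      by (simp_all add: inv_into_f_eq bij_is_inj bij_is_surj surj_f_inv_f T linear_add[OF T(1)]
          linear_scale[OF T(1)])
  qed
  then have "smooth_on UNIV T" "smooth_on UNIV (inv_into UNIV T)"
    using bT Ck_on_bounded_linear linear_conv_bounded_linear unfolding smooth_on_def by blast+
  then have diffeo: "diffeomorphism ?G ?H T"
    by (simp add: diffeomorphism_def T(2) smooth_map_global)
  have "isometry ?G (Met S) ?H (Met S') T"
    by (simp add: isometry_def diffeo left_invariant_metric_def differential_global dT inv_T T_Met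
        K_met_flow)
  moreover have "preserves_contact ?G S ?H S' T"
  proof -
    have "T (?E p (Xi S)) = ?F (T p) (Xi S')" for p
      using frame_T[of p "Xi S"] by (simp add: K_xi_flow T_Xi)
    moreover have "T (?E p (Phi S v)) = ?F (T p) (Phi S' (T (flow K (- \<theta> p) v)))" for p v
      by (simp add: frame_T flip: T_Phi K_phi_flow)
    ultimately show ?thesis
      by (simp add: preserves_contact_def differential_global dT inv_T T_Eta K_eta_flow)
  qed
  ultimately show ?thesis
    unfolding sasaki_isometric_def
    using L.simply_connected_lie_group_semidirect L'.simply_connected_lie_group_semidirect by blast
qed

section \<open>The listed Lie algebras\<close>

lemma exhaust_7: "(i::7) = 1 \<or> i = 2 \<or> i = 3 \<or> i = 4 \<or> i = 5 \<or> i = 6 \<or> i = 7"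
proof (induct i)
  case (of_int z)
  then have "z = 0 \<or> z = 1 \<or> z = 2 \<or> z = 3 \<or> z = 4 \<or> z = 5 \<or> z = 6" by fastforce
  then show ?case by auto
qed

lemma forall_7: "(\<forall>i::7. P i) \<longleftrightarrow> P 1 \<and> P 2 \<and> P 3 \<and> P 4 \<and> P 5 \<and> P 6 \<and> P 7"
  by (metis exhaust_7)

lemma UNIV_7: "UNIV = {1, 2, 3, 4, 5, 6, 7 :: 7}"
  using exhaust_7 by auto

lemma sum_7: "sum f (UNIV :: 7 set) = f 1 + f 2 + f 3 + f 4 + f 5 + f 6 + f 7"
  unfolding UNIV_7 by (simp add: ac_simps)

lemma vector_7 [simp]:
  "(vector [a, b, c, d, e, f, g] :: 'a::zero^7) $ 1 = a"
  "(vector [a, b, c, d, e, f, g] :: 'a::zero^7) $ 2 = b"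
  "(vector [a, b, c, d, e, f, g] :: 'a::zero^7) $ 3 = c"
  "(vector [a, b, c, d, e, f, g] :: 'a::zero^7) $ 4 = d"
  "(vector [a, b, c, d, e, f, g] :: 'a::zero^7) $ 5 = e"
  "(vector [a, b, c, d, e, f, g] :: 'a::zero^7) $ 6 = f"
  "(vector [a, b, c, d, e, f, g] :: 'a::zero^7) $ 7 = g"
  unfolding vector_def by auto

lemma vec_eq_7: "(x :: 'a^7) = y \<longleftrightarrow> x $ 1 = y $ 1 \<and> x $ 2 = y $ 2 \<and> x $ 3 = y $ 3 \<and>
    x $ 4 = y $ 4 \<and> x $ 5 = y $ 5 \<and> x $ 6 = y $ 6 \<and> x $ 7 = y $ 7"
  by (simp add: vec_eq_iff forall_7)

text \<open>All listed algebras are semidirect products of one shape. The derivation acts on the coordinates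
  1 to 4, read as the complex plane with coordinates \<open>x\<^sub>1 + i x\<^sub>2\<close> and \<open>x\<^sub>3 + i x\<^sub>4\<close>, by the real matrix with
  rows \<open>(\<alpha>, \<beta>)\<close> and \<open>(\<gamma>, \<delta>)\<close> plus \<open>- i l\<close> times the matrix with rows \<open>(2, -1)\<close> and \<open>(1, 0)\<close>.\<close>

definition model_D :: "real \<Rightarrow> real \<Rightarrow> real \<Rightarrow> real \<Rightarrow> real \<Rightarrow> real \<Rightarrow> real \<Rightarrow> real^7 \<Rightarrow> real^7" where
  "model_D \<alpha> \<beta> \<gamma> \<delta> h l \<tau> x = vector [
     \<alpha> * x$1 + \<beta> * x$3 + l * (2 * x$2 - x$4),
     \<alpha> * x$2 + \<beta> * x$4 - l * (2 * x$1 - x$3),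
     \<gamma> * x$1 + \<delta> * x$3 + l * x$2,
     \<gamma> * x$2 + \<delta> * x$4 - l * x$1,
     h * x$5, - 2 * \<tau> * x$5, 0]"

text \<open>With \<open>\<omega> = - e\<^sup>1\<^sup>2 - \<epsilon> e\<^sup>3\<^sup>4\<close> and \<open>A\<close> the matrix above, the fifth component is
  \<open>\<tau> (\<omega>(A x, y) + \<omega>(x, A y))\<close> and the sixth is \<open>- 2 \<omega>(x, y)\<close>. The term with \<open>l\<close> does not contribute to
  the fifth component where it occurs (\<open>\<epsilon> = -1\<close>), because it is skew.\<close>

definition model_B ::
    "real \<Rightarrow> real \<Rightarrow> real \<Rightarrow> real \<Rightarrow> real \<Rightarrow> real \<Rightarrow> real^7 \<Rightarrow> real^7 \<Rightarrow> real^7" where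
  "model_B \<alpha> \<beta> \<gamma> \<delta> \<epsilon> \<tau> x y =
    (let e = (\<lambda>i j :: 7. x $ i * y $ j - x $ j * y $ i) in
     vector [0, 0, 0, 0,
       - \<tau> * (2 * \<alpha> * e 1 2 + 2 * \<epsilon> * \<delta> * e 3 4 + (\<beta> + \<epsilon> * \<gamma>) * (e 1 4 - e 2 3)),
       2 * (e 1 2 + \<epsilon> * e 3 4), 0])"

text \<open>The real matrix \<open>(\<alpha>, \<beta>, \<gamma>, \<delta>)\<close> of each listed algebra and the number \<open>h\<close> with
  \<open>[e\<^sub>7, e\<^sub>5] = h e\<^sub>5 - 2 \<tau> e\<^sub>6\<close>.\<close>

definition listed_matrix :: "nat \<Rightarrow> real \<times> real \<times> real \<times> real \<times> real" where
  "listed_matrix n =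
     [(0, 0, 0, 0, 0), (0, 0, 0, 0, 2), (0, 0, 0, 1, 2), (1, 0, 0, 1, 2),
      (0, 0, 0, 0, 0), (0, 0, 0, 0, 2), (0, 0, 0, 1, 2), (1, 0, 0, 1, 2),
      (1/2, -1/2, 1/2, -1/2, 0), (1/2, -3/2, -1/2, -1/2, 2), (3/2, 1/2, 3/2, 1/2, 2)] ! (n - 1)"

text \<open>The Hermitian form on the complex plane is \<open>diag(s, s \<epsilon>)\<close>, where \<open>\<epsilon>\<close> is this sign.\<close>

definition listed_sign :: "nat \<Rightarrow> real" where
  "listed_sign n = (if n \<le> 4 then 1 else - 1)"

lemma in_1_11: "n \<in> {1..11} \<longleftrightarrow> n = 1 \<or> n = 2 \<or> n = 3 \<or> n = 4 \<or> n = 5 \<or> n = 6 \<or> n = 7 \<or>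
    n = 8 \<or> n = 9 \<or> n = 10 \<or> n = (11::nat)"
  unfolding atLeastAtMost_iff by arith

lemma listed_cases:
  assumes "n \<in> {1..11}"
  obtains "n = 1" | "n = 2" | "n = 3" | "n = 4" | "n = 5" | "n = 6" | "n = 7" | "n = 8" | "n = 9"
    | "n = 10" | "n = (11::nat)"
  using assms in_1_11 by blast

lemma listed_bracket_semidirect:
  assumes "n \<in> {1..11}"
  shows "listed_bracket n \<tau> l = (case listed_matrix n of (\<alpha>, \<beta>, \<gamma>, \<delta>, h) \<Rightarrow>
    semidirect_bracket (\<lambda>x. x $ 7)
    (model_B \<alpha> \<beta> \<gamma> \<delta> (listed_sign n) \<tau>) (model_D \<alpha> \<beta> \<gamma> \<delta> h (if n \<le> 8 then 0 else l) \<tau>))"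
  using assms
  by (cases rule: listed_cases; simp add: listed_matrix_def fun_eq_iff
      listed_bracket_def listed_d_def vec_eq_7 listed_sign_def
      semidirect_bracket_def model_B_def model_D_def Let_def; simp add: field_simps)

text \<open>The only part of the Jacobi identity that depends on the entries: it expresses
  \<open>2 Q\<^sup>2 + [Q, K] = h Q\<close> for the symmetric part \<open>Q\<close> and the skew part \<open>K\<close> of the matrix.\<close>

lemma model_D_derivation:
  assumes n: "n \<in> {1..11}" and \<tau>: "\<tau> \<in> {1, -1}"
  shows "case listed_matrix n of (\<alpha>, \<beta>, \<gamma>, \<delta>, h) \<Rightarrow>
    model_D \<alpha> \<beta> \<gamma> \<delta> h (if n \<le> 8 then 0 else l) \<tau> (model_B \<alpha> \<beta> \<gamma> \<delta> (listed_sign n) \<tau> x y)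
    = model_B \<alpha> \<beta> \<gamma> \<delta> (listed_sign n) \<tau> (model_D \<alpha> \<beta> \<gamma> \<delta> h (if n \<le> 8 then 0 else l) \<tau> x) y
    + model_B \<alpha> \<beta> \<gamma> \<delta> (listed_sign n) \<tau> x (model_D \<alpha> \<beta> \<gamma> \<delta> h (if n \<le> 8 then 0 else l) \<tau> y)"
  using \<tau> by (cases rule: listed_cases[OF n]; elim insertE emptyE;
      simp add: listed_matrix_def vec_eq_7 model_B_def model_D_def Let_def listed_sign_def;
      simp add: field_simps)

lemma semidirect_model:
  assumes "n \<in> {1..11}" and M: "listed_matrix n = (\<alpha>, \<beta>, \<gamma>, \<delta>, h)" and \<tau>: "\<tau> \<in> {1, -1}"
  shows "semidirect (\<lambda>x. x $ 7)
    (model_B \<alpha> \<beta> \<gamma> \<delta> (listed_sign n) \<tau>) (model_D \<alpha> \<beta> \<gamma> \<delta> h (if n \<le> 8 then 0 else l) \<tau>)"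
proof (rule semidirect.intro)
  let ?B = "model_B \<alpha> \<beta> \<gamma> \<delta> (listed_sign n) \<tau>" and ?D = "model_D \<alpha> \<beta> \<gamma> \<delta> h (if n \<le> 8 then 0 else l) \<tau>"
  show "linear (\<lambda>x :: real^7. x $ 7)"
    by (rule linearI) simp_all
  show "bilinear ?B"
    unfolding bilinear_def
    by (intro conjI allI linearI; simp add: vec_eq_7 model_B_def Let_def; simp add: algebra_simps)
  show "linear ?D"
    by (rule linearI; simp add: vec_eq_7 model_D_def; simp add: algebra_simps)
  fix x y z :: "real^7"
  show "?B x x = 0" "?B x y $ 7 = 0" "?B (?B x y) z = 0" "?D x $ 7 = 0"
    by (simp_all add: vec_eq_7 model_B_def model_D_def Let_def)
  show "?D (?B x y) = ?B (?D x) y + ?B x (?D y)"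
    using model_D_derivation[OF assms(1) \<tau>, where l = l and x = x and y = y] by (simp add: M)
qed

lemma (in semidirect) lie_algebra_semidirect_bracket: "lie_algebra (semidirect_bracket \<theta> B D)"
proof -
  have D: "D (x + y) = D x + D y" "D (r *\<^sub>R x) = r *\<^sub>R D x" "D (x - y) = D x - D y" for x y r
    by (simp_all add: linear_D linear_add linear_scale linear_diff)
  have "bilinear (semidirect_bracket \<theta> B D)"
    unfolding bilinear_def semidirect_bracket_def
    by (auto intro!: linearI simp: B_simps D \<theta>_simps algebra_simps)
  moreover have "semidirect_bracket \<theta> B D x (semidirect_bracket \<theta> B D y z) +
     semidirect_bracket \<theta> B D y (semidirect_bracket \<theta> B D z x) +
     semidirect_bracket \<theta> B D z (semidirect_bracket \<theta> B D x y) = 0" for x y z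
    using B_skew[of z "D y"] B_skew[of x "D z"] B_skew[of y "D x"]
    by (simp add: semidirect_bracket_def B_simps D \<theta>_simps \<theta>_B \<theta>_D B_B' D_B algebra_simps)
  ultimately show ?thesis
    by (simp add: lie_algebra_def semidirect_bracket_def B_self)
qed

text \<open>Multiplication by \<open>s i\<close> on the complex plane, and \<open>\<phi> e\<^sub>5 = e\<^sub>7\<close>, \<open>\<phi> e\<^sub>7 = - e\<^sub>5\<close>.\<close>

definition model_phi :: "real \<Rightarrow> real^7 \<Rightarrow> real^7" where
  "model_phi s y = vector [- s * y$2, s * y$1, - s * y$4, s * y$3, - y$7, 0, y$5]"

lemma listed_d_6:
  assumes "n \<in> {1..11}"
  shows "listed_d n \<tau> l x y $ 6 = - 2 * (x$1 * y$2 - x$2 * y$1)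
    - 2 * listed_sign n * (x$3 * y$4 - x$4 * y$3) - 2 * \<tau> * (x$5 * y$7 - x$7 * y$5)"
  using assms
  by (cases rule: listed_cases; simp add: listed_d_def Let_def listed_sign_def)

lemma listed_metric_eq:
  "listed_metric n s \<tau> x y = s * (x$1 * y$1 + x$2 * y$2 + listed_sign n * (x$3 * y$3 + x$4 * y$4))
    + \<tau> * x$5 * y$5 + x$6 * y$6 + \<tau> * x$7 * y$7"
  by (simp add: listed_metric_def listed_sign_def algebra_simps)

lemma pseudo_metric_listed:
  assumes "s \<in> {1, -1}" "\<tau> \<in> {1, -1}"
  shows "pseudo_metric (listed_metric n s \<tau>)"
  unfolding pseudo_metric_def
proof (intro conjI allI impI)
  show "bilinear (listed_metric n s \<tau>)"
    unfolding bilinear_def listed_metric_eq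
    by (intro conjI allI linearI; simp add: algebra_simps)
  show "listed_metric n s \<tau> x y = listed_metric n s \<tau> y x" for x y
    by (simp add: listed_metric_eq mult.commute)
  fix x assume x: "\<forall>y. listed_metric n s \<tau> x y = 0"
  have sg: "listed_sign n \<noteq> 0"
    by (simp add: listed_sign_def)
  have "listed_metric n s \<tau> x (axis 1 1) = s * x$1" "listed_metric n s \<tau> x (axis 2 1) = s * x$2"
    "listed_metric n s \<tau> x (axis 3 1) = s * listed_sign n * x$3"
    "listed_metric n s \<tau> x (axis 4 1) = s * listed_sign n * x$4"
    "listed_metric n s \<tau> x (axis 5 1) = \<tau> * x$5" "listed_metric n s \<tau> x (axis 6 1) = x$6"
    "listed_metric n s \<tau> x (axis 7 1) = \<tau> * x$7"
    by (simp_all add: listed_metric_eq axis_def)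
  then have "s * x$1 = 0" "s * x$2 = 0" "s * listed_sign n * x$3 = 0" "s * listed_sign n * x$4 = 0"
    "\<tau> * x$5 = 0" "x$6 = 0" "\<tau> * x$7 = 0"
    using x by simp_all
  moreover have "s \<noteq> 0" "\<tau> \<noteq> 0"
    using assms by auto
  ultimately show "x = 0"
    using sg by (simp add: vec_eq_7)
qed

lemma listed_metric_model_phi:
  assumes "n \<in> {1..11}" "s \<in> {1, -1}"
  shows "2 * listed_metric n s \<tau> x (model_phi s y) = listed_d n \<tau> l x y $ 6"
  using assms(2) by (auto simp: listed_d_6[OF assms(1)] listed_metric_eq model_phi_def algebra_simps)

text \<open>Nondegeneracy of the metric makes the definite description meaningful.\<close>

lemma Phi_listed:
  assumes "n \<in> {1..11}" "s \<in> {1, -1}" "\<tau> \<in> {1, -1}"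
  shows "Phi (listed_structure n s \<tau> l) = model_phi s"
proof -
  have "\<phi> = model_phi s" if "\<forall>x y. 2 * listed_metric n s \<tau> x (\<phi> y) = listed_d n \<tau> l x y $ 6" for \<phi>
  proof
    fix y
    interpret g: bounded_bilinear "listed_metric n s \<tau>"
      using pseudo_metric_listed[OF assms(2,3)] bilinear_conv_bounded_bilinear
      unfolding pseudo_metric_def by blast
    have "listed_metric n s \<tau> x (\<phi> y) = listed_metric n s \<tau> x (model_phi s y)" for x
      using that listed_metric_model_phi[OF assms(1,2), of \<tau> x y l] by (metis mult_left_cancel zero_neq_numeral)
    then have "listed_metric n s \<tau> (\<phi> y - model_phi s y) x = 0" for x
      using pseudo_metric_listed[OF assms(2,3), of n] 
      unfolding pseudo_metric_def by (metis g.diff_right right_minus_eq)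
    then show "\<phi> y = model_phi s y"
      using pseudo_metric_listed[OF assms(2,3), of n] 
      unfolding pseudo_metric_def by (metis right_minus_eq)
  qed
  then show ?thesis
    unfolding listed_structure_def
    using listed_metric_model_phi[OF assms(1,2)] by (simp, intro the_equality) blast+
qed

lemma listed_structure_simps [simp]:
  "Xi (listed_structure n s \<tau> l) = axis 6 1" "Eta (listed_structure n s \<tau> l) = (\<lambda>x. x $ 6)"
  "Met (listed_structure n s \<tau> l) = listed_metric n s \<tau>"
  by (simp_all add: listed_structure_def)

text \<open>The Jacobi identity holds for every semidirect product; the vanishing of the Nijenhuis expression
  uses only that the matrix is complex linear and that the form in the fifth component is invariant
  under \<open>\<phi>\<close>, so it is checked once for all entries.\<close>

lemma sasaki_listed:
  assumes n: "n \<in> {1..11}" and s: "s \<in> {1, -1}" and \<tau>: "\<tau> \<in> {1, -1}"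
  shows "sasaki (listed_bracket n \<tau> l) (listed_structure n s \<tau> l)"
proof -
  obtain \<alpha> \<beta> \<gamma> \<delta> h where M: "listed_matrix n = (\<alpha>, \<beta>, \<gamma>, \<delta>, h)"
    by (metis prod_cases5)
  note br = listed_bracket_semidirect[OF n, of \<tau> l, unfolded M prod.case]
  note phi = Phi_listed[OF n s \<tau>]
  have sign: "listed_sign n \<in> {1, -1}"
    by (simp add: listed_sign_def)
  have lie: "lie_algebra (listed_bracket n \<tau> l)"
    unfolding br by (rule semidirect.lie_algebra_semidirect_bracket[OF semidirect_model[OF n M \<tau>]])
  have acm: "almost_contact_metric (listed_structure n s \<tau> l)"
    unfolding almost_contact_metric_def phi listed_structure_simps
  proof (intro conjI allI)
    show "linear (model_phi s)"
      by (rule linearI) (simp_all add: model_phi_def vec_eq_7 algebra_simps)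
    show "linear (\<lambda>x :: real^7. x $ 6)"
      by (rule linearI) simp_all
    show "pseudo_metric (listed_metric n s \<tau>)"
      by (rule pseudo_metric_listed[OF s \<tau>])
    show "listed_metric n s \<tau> (model_phi s x) (model_phi s y) = listed_metric n s \<tau> x y - x $ 6 * y $ 6"
      for x y
      using s \<tau> by (elim insertE emptyE; simp add: listed_metric_eq model_phi_def)
    show "model_phi s (model_phi s x) = - x + x $ 6 *\<^sub>R axis 6 1" for x
      using s by (elim insertE emptyE; simp add: vec_eq_7 model_phi_def axis_def)
  qed (simp_all add: model_phi_def listed_metric_eq axis_def)
  have eta: "lie_d (listed_bracket n \<tau> l) (\<lambda>x. x $ 6) x y = listed_d n \<tau> l x y $ 6" for x y
    by (simp add: lie_d_def listed_bracket_def)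
  have nij: "nijenhuis (listed_bracket n \<tau> l) (model_phi s) x y + listed_d n \<tau> l x y $ 6 *\<^sub>R axis 6 1 = 0" 
    for x y
    unfolding listed_d_6[OF n] br
    using s sign \<tau>
    by (elim insertE emptyE;
        simp add: nijenhuis_def semidirect_bracket_def model_B_def model_D_def model_phi_def
        Let_def vec_eq_7 axis_def; simp add: algebra_simps)
  show ?thesis
    unfolding sasaki_def phi listed_structure_simps
    by (simp add: lie acm eta nij fundamental_form_def phi
        listed_metric_model_phi[OF n s, where l = l])
qed

section \<open>The structure of the Lie algebra\<close>

text \<open>The metric may be indefinite, so the adjoint is the Euclidean one conjugated by the Gram operator of
  the metric.\<close>

lemma metric_adjoint:
  fixes g :: "'a::euclidean_space \<Rightarrow> 'a \<Rightarrow> real"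
  assumes g: "pseudo_metric g" and A: "linear A"
  obtains A' where "linear A'" "\<And>x y. g (A x) y = g x (A' y)"
proof -
  interpret g: bounded_bilinear g
    using g bilinear_conv_bounded_bilinear unfolding pseudo_metric_def by blast
  define G where "G y = (\<Sum>i\<in>Basis. g i y *\<^sub>R i)" for y
  have lin: "linear G"
    by (rule linearI) (simp_all add: G_def g.add_right g.scaleR_right sum.distrib
        scaleR_add_left scaleR_sum_right)
  have G: "g x y = x \<bullet> G y" for x y
  proof -
    have "g x y = g (\<Sum>i\<in>Basis. (x \<bullet> i) *\<^sub>R i) y"
      by (simp add: euclidean_representation)
    also have "\<dots> = x \<bullet> G y"
      by (simp add: G_def g.sum_left g.scaleR_left inner_sum_right mult.commute)
    finally show ?thesis .
  qed
  have inj: "y = 0" if "G y = 0" for y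
  proof -
    have "g y x = 0" for x
      using g G[of x y] that unfolding pseudo_metric_def by simp
    then show ?thesis
      using g unfolding pseudo_metric_def by blast
  qed
  then have "inj G"
    using linear_injective_0[OF lin] by blast
  then obtain G' where G': "linear G'" "\<And>x. G (G' x) = x"
    using linear_injective_isomorphism[OF lin] by blast
  show thesis
  proof (rule that)
    show "linear (\<lambda>y. G' (adjoint A (G y)))"
      using linear_compose[OF linear_compose[OF lin adjoint_linear[OF A]] G'(1)]
      by (simp add: o_def)
    show "g (A x) y = g x (G' (adjoint A (G y)))" for x y
      by (simp add: G G' adjoint_works[OF A])
  qed
qed

lemma half_sum_diff:
  fixes x y :: "'a::real_vector"
  shows "(1/2) *\<^sub>R (x + y) + (1/2) *\<^sub>R (x - y) = x" "(1/2) *\<^sub>R (x + y) - (1/2) *\<^sub>R (x - y) = y"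
  unfolding scaleR_add_right[symmetric] scaleR_diff_right[symmetric]
  by (simp_all add: scaleR_half_double flip: scaleR_2)

locale contact_metric =
  fixes S :: "'a::euclidean_space contact_structure"
  assumes acm: "almost_contact_metric S"
begin

abbreviation g where "g \<equiv> Met S"
abbreviation \<phi> where "\<phi> \<equiv> Phi S"
abbreviation \<xi> where "\<xi> \<equiv> Xi S"
abbreviation \<eta> where "\<eta> \<equiv> Eta S"

lemma
  shows linear_\<phi>: "linear \<phi>" and linear_\<eta>: "linear \<eta>" and pseudo_metric_g: "pseudo_metric g"
    and \<eta>_\<xi>: "\<eta> \<xi> = 1" and \<eta>_\<phi>: "\<eta> (\<phi> x) = 0" and \<phi>_\<phi>: "\<phi> (\<phi> x) = - x + \<eta> x *\<^sub>R \<xi>"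
    and g_\<xi>: "g \<xi> x = \<eta> x"
    and g_\<phi>_\<phi>: "g (\<phi> x) (\<phi> y) = g x y - \<eta> x * \<eta> y"
  using acm unfolding almost_contact_metric_def by metis+

lemma bilinear_g: "bilinear g" and g_sym: "g x y = g y x"
  and g_nondegenerate: "(\<And>y. g x y = 0) \<Longrightarrow> x = 0"
  using pseudo_metric_g unfolding pseudo_metric_def by blast+

sublocale g: bounded_bilinear g
  using bilinear_g bilinear_conv_bounded_bilinear by blast

lemmas g_simps = g.add_left g.add_right g.scaleR_left g.scaleR_right g.minus_left g.minus_right
  g.diff_left g.diff_right g.zero_left g.zero_right
lemmas \<phi>_simps = linear_add[OF linear_\<phi>] linear_scale[OF linear_\<phi>] linear_0[OF linear_\<phi>]
  linear_neg[OF linear_\<phi>] linear_diff[OF linear_\<phi>]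
lemmas \<eta>_simps = linear_add[OF linear_\<eta>] linear_scale[OF linear_\<eta>] linear_0[OF linear_\<eta>]
  linear_neg[OF linear_\<eta>] linear_diff[OF linear_\<eta>]

lemma g_\<xi>': "g x \<xi> = \<eta> x"
  using g_\<xi> g_sym by metis

lemma g_\<phi>: "g (\<phi> x) y = - g x (\<phi> y)"
  using g_\<phi>_\<phi>[of x "\<phi> y"] by (simp add: \<phi>_\<phi> g_simps g_\<xi>' \<eta>_\<phi>)

lemma g_\<phi>_self: "g x (\<phi> x) = 0"
  using g_\<phi>[of x x] g_sym[of x "\<phi> x"] by simp

lemma \<phi>_\<xi>: "\<phi> \<xi> = 0"
  by (rule g_nondegenerate) (simp add: g_\<phi> g_\<xi> \<eta>_\<phi>)

lemma g_eqI: "(\<And>z. g x z = g y z) \<Longrightarrow> x = y"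
  using g_nondegenerate[of "x - y"] by (simp add: g_simps)

end

text \<open>The dimension bound excludes the line: there \<open>\<gg>\<close> would be trivial and \<open>e\<^sub>0\<close> a multiple of \<open>\<xi>\<close>.\<close>

locale abelian_z_standard = contact_metric S
  for br :: "'a::euclidean_space \<Rightarrow> 'a \<Rightarrow> 'a" and S :: "'a contact_structure"
    and \<gg> :: "'a set" and e0 :: 'a and \<tau> :: real +
  assumes sas: "sasaki br S" and zst: "z_standard br S \<gg> e0 \<tau>"
    and abel: "abelian_kahler_reduction br S \<gg> e0" and dim2: "DIM('a) \<ge> 2"
begin

text \<open>The numbers \<open>\<theta> x\<close>, \<open>\<tau> g(x, b)\<close> and \<open>\<eta> x\<close> are the coordinates of \<open>x\<close> along \<open>e\<^sub>0\<close>, \<open>b\<close> and \<open>\<xi>\<close>, and \<open>P\<close> is the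
  orthogonal projection to their complement \<open>V\<close>, which represents the Kaehler reduction.\<close>

definition b :: 'a where "b = - \<phi> e0"
definition \<theta> :: "'a \<Rightarrow> real" where "\<theta> x = \<tau> * g x e0"
definition h :: real where "h = \<tau> * g (br e0 b) b"
definition P :: "'a \<Rightarrow> 'a" where "P x = x - \<theta> x *\<^sub>R e0 - (\<tau> * g x b) *\<^sub>R b - \<eta> x *\<^sub>R \<xi>"
definition V :: "'a set" where "V = {x. g x e0 = 0 \<and> g x b = 0 \<and> \<eta> x = 0}"

lemma \<tau>: "\<tau> = 1 \<or> \<tau> = -1" and \<tau>_\<tau> [simp]: "\<tau> * \<tau> = 1" and \<tau>_\<tau>' [simp]: "\<tau> * (\<tau> * r) = r"
  using zst unfolding z_standard_def by (auto simp flip: mult.assoc)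

lemma lie: "lie_algebra br"
  using sas by (simp add: sasaki_def)

sublocale br: bounded_bilinear br
  using lie bilinear_conv_bounded_bilinear unfolding lie_algebra_def by blast

lemmas br_simps = br.add_left br.add_right br.scaleR_left br.scaleR_right br.minus_left br.minus_right
  br.diff_left br.diff_right br.zero_left br.zero_right

lemma br_self [simp]: "br x x = 0"
  using lie by (simp add: lie_algebra_def)

lemma br_skew: "br x y = - br y x"
proof -
  have "br x y + br y x = br (x + y) (x + y)"
    by (simp only: br_simps) simp
  then show ?thesis
    by (simp add: eq_neg_iff_add_eq_0)
qed

lemma jacobi: "br x (br y z) = br (br x y) z + br y (br x z)"
proof -
  have "br x (br y z) + br y (br z x) + br z (br x y) = 0"
    using lie by (simp add: lie_algebra_def)
  then show ?thesis
    using br_skew[of z "br x y"] br_skew[of z x] by (simp add: br_simps algebra_simps)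
qed

lemma \<eta>_br: "\<eta> (br x y) = - 2 * g x (\<phi> y)"
proof -
  have "lie_d br \<eta> x y = 2 * g x (\<phi> y)"
    using sas by (simp add: sasaki_def fundamental_form_def)
  then show ?thesis
    by (simp add: lie_d_def)
qed

lemma nijenhuis_0: "\<phi> (\<phi> (br x y)) + br (\<phi> x) (\<phi> y) - \<phi> (br (\<phi> x) y) - \<phi> (br x (\<phi> y))
    = \<eta> (br x y) *\<^sub>R \<xi>"
proof -
  have "nijenhuis br \<phi> x y + lie_d br \<eta> x y *\<^sub>R \<xi> = 0"
    using sas unfolding sasaki_def by blast
  then show ?thesis
    by (simp add: nijenhuis_def lie_d_def)
qed

lemma g_e0_e0: "g e0 e0 = \<tau>"
  using zst unfolding z_standard_def by blast

lemma mem_gg: "x \<in> \<gg> \<longleftrightarrow> g x e0 = 0"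
proof
  show "x \<in> \<gg> \<Longrightarrow> g x e0 = 0"
    using zst unfolding z_standard_def by blast
  assume x: "g x e0 = 0"
  obtain y c where y: "y \<in> \<gg>" "x = y + c *\<^sub>R e0"
    using zst unfolding z_standard_def by metis
  moreover have "g y e0 = 0"
    using y(1) zst unfolding z_standard_def by blast
  ultimately have "c * \<tau> = 0"
    using x by (simp add: g_simps g_e0_e0)
  then show "x \<in> \<gg>"
    using y \<tau> by auto
qed

lemma br_gg: "g y e0 = 0 \<Longrightarrow> g (br x y) e0 = 0"
  using zst unfolding z_standard_def ideal_of_def by (metis mem_gg)

lemma br_gg': "g x e0 = 0 \<Longrightarrow> g (br x y) e0 = 0"
  using br_gg[of x y] br_skew[of x y] by (simp add: g_simps)

lemma linear_\<theta>: "linear \<theta>"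
  by (rule linearI) (simp_all add: \<theta>_def g_simps algebra_simps)

lemma \<theta>_eq_0: "\<theta> x = 0 \<longleftrightarrow> g x e0 = 0"
  using \<tau> by (auto simp: \<theta>_def)

lemma g_minus_\<theta>: "g (x - \<theta> x *\<^sub>R e0) e0 = 0"
  by (simp add: \<theta>_def g_simps g_e0_e0 mult.assoc mult.left_commute)

lemma br_b: "g x e0 = 0 \<Longrightarrow> br b x = 0"
  and g_b_e0: "g b e0 = 0"
  using zst unfolding z_standard_def center_of_def b_def by (auto simp: mem_gg)

text \<open>That is, \<open>\<xi>\<close> lies in \<open>\<gg>\<close>. Since \<open>b\<close> is central in \<open>\<gg>\<close>, the form \<open>d\<eta>\<close> vanishes on \<open>b\<close> and \<open>\<gg>\<close>, which says
  \<open>\<eta>(e\<^sub>0) \<eta>(x) = 0\<close> for \<open>x\<close> in \<open>\<gg>\<close>. If \<open>\<eta>(e\<^sub>0)\<close> were not zero, then \<open>\<gg>\<close> would be the kernel of \<open>\<eta>\<close>; being an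
  ideal, it would make \<open>d\<eta>\<close>, and with it the metric, vanish on \<open>\<gg>\<close>, so that \<open>\<gg> = 0\<close>.\<close>

lemma \<eta>_e0: "\<eta> e0 = 0"
proof (rule ccontr)
  assume ne: "\<eta> e0 \<noteq> 0"
  have \<eta>_0: "\<eta> x = 0" if "g x e0 = 0" for x
  proof -
    have "g b (\<phi> x) = 0"
      using \<eta>_br[of b x] by (simp add: br_b that \<eta>_simps)
    then have "\<eta> e0 * \<eta> x = 0"
      using that by (simp add: b_def g_simps g_\<phi>_\<phi> g_sym[of e0 x])
    with ne show ?thesis by simp
  qed
  have "g x e0 = 0" if "\<eta> x = 0" for x
  proof -
    have "\<eta> x = \<theta> x * \<eta> e0"
      using \<eta>_0[OF g_minus_\<theta>[of x]] by (simp add: \<eta>_simps)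
    with ne that show ?thesis by (simp add: \<theta>_eq_0)
  qed
  note gg_iff = this \<eta>_0
  have "x = 0" if x: "g x e0 = 0" for x
  proof (rule g_nondegenerate)
    fix z
    have "g (\<phi> z) e0 = 0"
      by (rule gg_iff(1)) (rule \<eta>_\<phi>)
    then have "g x (\<phi> (\<phi> z)) = 0"
      using \<eta>_br[of x "\<phi> z"] \<eta>_0[OF br_gg[of "\<phi> z" x]] by simp
    then show "g x z = 0"
      using \<eta>_0[OF x] by (simp add: \<phi>_\<phi> g_simps g_\<xi>')
  qed
  then have "x - \<theta> x *\<^sub>R e0 = 0" for x
    using g_minus_\<theta> by blast
  then have "x \<in> span {e0}" for x
    by (metis eq_iff_diff_eq_0 insertI1 span_base span_scale)
  then have "dim (UNIV :: 'a set) \<le> card {e0}"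
    by (intro span_card_ge_dim) auto
  then show False
    using dim2 by simp
qed

lemma \<eta>_b: "\<eta> b = 0" and \<phi>_e0: "\<phi> e0 = - b" and \<phi>_b: "\<phi> b = e0" and g_b_b: "g b b = \<tau>"
  by (simp_all add: b_def \<eta>_simps \<phi>_simps \<eta>_\<phi> \<phi>_\<phi> \<eta>_e0 g_simps g_\<phi>_\<phi> g_e0_e0)

lemma g_\<xi>_e0: "g \<xi> e0 = 0"
  by (simp add: g_\<xi> \<eta>_e0)

lemma br_span:
  assumes "g x e0 = 0" "g y e0 = 0"
  shows "br x y = (\<tau> * g (br x y) b) *\<^sub>R b + \<eta> (br x y) *\<^sub>R \<xi>"
proof -
  have "coset_of (span {b, \<xi>}) (br x y) = coset_of (span {b, \<xi>}) 0"
    using abel assms unfolding abelian_kahler_reduction_def Let_def mem_gg[symmetric] b_def by blast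
  moreover have "br x y \<in> coset_of (span {b, \<xi>}) (br x y)"
    unfolding coset_of_def using span_zero by force
  ultimately have "br x y \<in> span {b, \<xi>}"
    unfolding coset_of_def by auto
  then obtain p q where pq: "br x y = p *\<^sub>R b + q *\<^sub>R \<xi>"
    unfolding span_insert span_empty by (auto simp: algebra_simps)
  then show ?thesis
    by (simp add: g_simps \<eta>_simps g_b_b g_\<xi> \<eta>_b \<eta>_\<xi> mult.left_commute)
qed

lemma br_\<xi>_\<phi>: "\<phi> (br \<xi> x) = br \<xi> (\<phi> x)"
proof -
  have eta: "\<eta> (br \<xi> x) = 0" for x
    by (simp add: \<eta>_br g_\<xi> \<eta>_\<phi>)
  have "- br \<xi> x = \<phi> (br \<xi> (\<phi> x))"
    using nijenhuis_0[of \<xi> x] by (simp add: eta \<phi>_\<xi> br_simps \<phi>_simps \<phi>_\<phi>)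
  then have "\<phi> (- br \<xi> x) = \<phi> (\<phi> (br \<xi> (\<phi> x)))"
    by simp
  then show ?thesis
    by (simp add: \<phi>_\<phi> \<phi>_simps eta)
qed

text \<open>By the commutativity of the reduction, \<open>[\<xi>, x]\<close> is a multiple \<open>c b\<close> for \<open>x\<close> in \<open>\<gg>\<close>. Because \<open>ad \<xi>\<close>
  commutes with \<open>\<phi>\<close>, the vector \<open>\<phi> (c b) = c e\<^sub>0\<close> is a bracket with \<open>\<xi>\<close> and so lies in the ideal \<open>\<gg>\<close>, whence
  \<open>c = 0\<close>. Finally \<open>[\<xi>, e\<^sub>0] = [\<xi>, \<phi> b] = \<phi> [\<xi>, b] = 0\<close>.\<close>

lemma br_\<xi>: "br \<xi> x = 0"
proof -
  have gg: "br \<xi> x = 0" if x: "g x e0 = 0" for x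
  proof -
    define c where "c = \<tau> * g (br \<xi> x) b"
    have c: "br \<xi> x = c *\<^sub>R b"
      using br_span[OF g_\<xi>_e0 x] by (simp add: c_def \<eta>_br g_\<xi> \<eta>_\<phi>)
    then have "g (c *\<^sub>R e0) e0 = g (br \<xi> (\<phi> x)) e0"
      by (simp flip: br_\<xi>_\<phi> add: \<phi>_simps \<phi>_b)
    then have "c * \<tau> = 0"
      by (simp add: br_gg' g_\<xi>_e0 g_simps g_e0_e0)
    then show ?thesis
      using c \<tau> by auto
  qed
  have "br \<xi> e0 = 0"
    using br_\<xi>_\<phi>[of b] by (simp add: gg g_b_e0 \<phi>_b \<phi>_simps)
  moreover have "br \<xi> (x - \<theta> x *\<^sub>R e0) = 0"
    by (rule gg[OF g_minus_\<theta>])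
  ultimately show ?thesis
    by (simp add: br_simps)
qed

lemma br_\<xi>': "br x \<xi> = 0"
  using br_skew[of x \<xi>] by (simp add: br_\<xi>)

lemma linear_P: "linear P"
  by (rule linearI) (simp_all add: P_def \<theta>_def g_simps \<eta>_simps algebra_simps)

lemma P_V: "P x \<in> V"
  by (simp add: P_def V_def \<theta>_def g_simps \<eta>_simps g_e0_e0 g_b_e0 g_\<xi>_e0 g_b_b g_sym[of e0 b]
      g_\<xi> \<eta>_b \<eta>_e0 \<eta>_\<xi>)

lemma P_id: "x \<in> V \<Longrightarrow> P x = x"
  by (simp add: P_def V_def \<theta>_def)

lemma P_basis: "P e0 = 0" "P b = 0" "P \<xi> = 0"
  by (simp_all add: P_def \<theta>_def g_e0_e0 g_b_e0 g_\<xi>_e0 g_b_b g_sym[of e0 b] g_\<xi> \<eta>_b \<eta>_e0 \<eta>_\<xi>)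

lemma decompose: "x = P x + \<theta> x *\<^sub>R e0 + (\<tau> * g x b) *\<^sub>R b + \<eta> x *\<^sub>R \<xi>"
  by (simp add: P_def)

lemma g_V: "x \<in> V \<Longrightarrow> g x y = g x (P y)"
  by (subst (1) decompose[of y]) (simp add: g_simps V_def g_\<xi>')

lemma V_eqI:
  assumes "x \<in> V" "y \<in> V" "\<And>z. z \<in> V \<Longrightarrow> g x z = g y z"
  shows "x = y"
  by (rule g_eqI) (metis assms P_V g_V)

lemma \<phi>_V: "x \<in> V \<Longrightarrow> \<phi> x \<in> V"
  by (simp add: V_def g_\<phi> g_simps \<phi>_e0 \<phi>_b \<eta>_\<phi>)

lemma \<phi>_P: "\<phi> (P x) = P (\<phi> x)"
  by (simp add: P_def \<theta>_def \<phi>_simps \<phi>_e0 \<phi>_b \<phi>_\<xi> g_\<phi> g_simps \<eta>_\<phi>)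

text \<open>The derivation \<open>ad e\<^sub>0\<close> preserves the center of \<open>\<gg>\<close>, and a central element is orthogonal to \<open>V\<close>
  because \<open>d\<eta>\<close> is nondegenerate there.\<close>

lemma br_e0_b: "br e0 b = h *\<^sub>R b - (2 * \<tau>) *\<^sub>R \<xi>"
proof -
  have eta: "\<eta> (br e0 b) = - 2 * \<tau>"
    by (simp add: \<eta>_br \<phi>_b g_e0_e0)
  have e: "g (br e0 b) e0 = 0"
    by (rule br_gg) (rule g_b_e0)
  have central: "g (br e0 b) (\<phi> x) = 0" if "g x e0 = 0" for x
  proof -
    have "br (br e0 b) x = 0"
      using jacobi[of e0 b x] that by (simp add: br_b br_gg br_simps)
    then show ?thesis
      using \<eta>_br[of "br e0 b" x] by (simp add: \<eta>_simps)
  qed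
  have "g (br e0 b) z = 0" if z: "z \<in> V" for z
  proof -
    have "g (br e0 b) (\<phi> (\<phi> z)) = 0"
      using \<phi>_V[OF z] by (intro central) (simp add: V_def)
    then show ?thesis
      using z by (simp add: \<phi>_\<phi> V_def g_simps)
  qed
  then have "P (br e0 b) = 0"
    using P_V by (intro V_eqI) (auto simp: V_def g_simps g_sym[of "P _"] g_V[of _ "br e0 b", symmetric] g_sym[of _ "br e0 b"] \<eta>_simps)
  then show ?thesis
    using decompose[of "br e0 b"] eta e by (simp add: \<theta>_def h_def)
qed

lemma br_e0_V:
  assumes "x \<in> V"
  shows "br e0 x \<in> V" "\<phi> (br e0 x) = br e0 (\<phi> x)"
proof -
  have e: "g (br e0 x) e0 = 0" if "x \<in> V" for x
    using that by (intro br_gg) (simp add: V_def)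
  have eta: "\<eta> (br e0 x) = 0" if "x \<in> V" for x
    using \<phi>_V[OF that] by (simp add: \<eta>_br V_def g_sym[of e0])
  have N: "br e0 x = - \<phi> (br e0 (\<phi> x))"
  proof -
    have "br b x = 0" "br b (\<phi> x) = 0"
      using assms \<phi>_V[OF assms] by (simp_all add: br_b V_def)
    then have "- br e0 x = \<phi> (br e0 (\<phi> x))"
      using nijenhuis_0[of e0 x] eta[OF assms]
      by (simp add: \<phi>_e0 br_simps \<phi>_simps \<phi>_\<phi> algebra_simps)
    then show ?thesis
      by (metis minus_minus)
  qed
  have "g (br e0 x) b = 0"
    by (subst N) (simp add: g_simps g_\<phi> \<phi>_b e \<phi>_V[OF assms])
  then show "br e0 x \<in> V"
    using e[OF assms] eta[OF assms] by (simp add: V_def)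
  have "\<phi> (br e0 x) = - \<phi> (\<phi> (br e0 (\<phi> x)))"
    by (subst N) (simp add: \<phi>_simps)
  then show "\<phi> (br e0 x) = br e0 (\<phi> x)"
    by (simp add: \<phi>_\<phi> eta \<phi>_V[OF assms])
qed

lemma br_V:
  assumes "x \<in> V" "y \<in> V"
  shows "br x y = (\<tau> * g (br x y) b) *\<^sub>R b - (2 * g x (\<phi> y)) *\<^sub>R \<xi>"
  using br_span[of x y] assms by (simp add: V_def \<eta>_br)

text \<open>The components along \<open>\<xi>\<close> and \<open>b\<close> of the Jacobi identity for \<open>e\<^sub>0\<close> and two vectors of \<open>V\<close>: the first
  determines the component of \<open>[x, y]\<close> along \<open>b\<close>, the second is a constraint.\<close>

lemma br_V_derivation:
  assumes "x \<in> V" "y \<in> V"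
  shows "g (br x y) b = g (br e0 x) (\<phi> y) + g x (\<phi> (br e0 y))"
    and "h * g (br x y) b = g (br (br e0 x) y) b + g (br x (br e0 y)) b"
proof -
  let ?f = "\<tau> * g (br x y) b"
  have eq: "?f *\<^sub>R (h *\<^sub>R b - (2 * \<tau>) *\<^sub>R \<xi>) = br (br e0 x) y + br x (br e0 y)"
    using jacobi[of e0 x y] 
    by (subst (asm) br_V[OF assms]) (simp add: br_simps br_\<xi>' br_e0_b)
  from arg_cong[OF eq, of \<eta>] show "g (br x y) b = g (br e0 x) (\<phi> y) + g x (\<phi> (br e0 y))"
    using \<tau> by (auto simp: \<eta>_simps \<eta>_b \<eta>_\<xi> \<eta>_br)
  from arg_cong[OF eq, of "\<lambda>z. g z b"]
  show "h * g (br x y) b = g (br (br e0 x) y) b + g (br x (br e0 y)) b"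
    using \<tau> by (auto simp: g_simps g_b_b g_\<xi> \<eta>_b mult.commute)
qed

lemma bracket_semidirect:
  "br = semidirect_bracket \<theta> (\<lambda>x y. br (x - \<theta> x *\<^sub>R e0) (y - \<theta> y *\<^sub>R e0)) (br e0)"
  by (simp add: fun_eq_iff semidirect_bracket_def br_simps br_skew[of _ e0])

lemma br_horizontal:
  "br (x - \<theta> x *\<^sub>R e0) (y - \<theta> y *\<^sub>R e0) = br (P x) (P y)"
proof -
  have "br (x - \<theta> x *\<^sub>R e0) z = br (P x) z" if "g z e0 = 0" for x z
    using that by (simp add: P_def br_simps br_\<xi> br_b)
  moreover have "br z (y - \<theta> y *\<^sub>R e0) = br z (P y)" if "g z e0 = 0" for y z
    using that br_skew[of z b] by (simp add: P_def br_simps br_\<xi>' br_b)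
  ultimately show ?thesis
    using g_minus_\<theta> P_V by (simp add: V_def)
qed

text \<open>The splitting of \<open>ad e\<^sub>0\<close> on \<open>V\<close>, with both parts extended by zero to the whole space. The first part
  of \<open>br_V_derivation\<close> becomes the formula for the bracket, the second one the equation for \<open>Q\<close>
  and \<open>K\<close>.\<close>

lemma bracket_parts:
  obtains Q K where "linear Q" "linear K" "\<And>x. Q x \<in> V" "\<And>x. K x \<in> V"
    "\<And>x. Q (P x) = Q x" "\<And>x. K (P x) = K x"
    "\<And>x y. g (Q x) y = g x (Q y)" "\<And>x y. g (K x) y = - g x (K y)"
    "\<And>x. Q (\<phi> x) = \<phi> (Q x)" "\<And>x. K (\<phi> x) = \<phi> (K x)"
    "\<And>x. x \<in> V \<Longrightarrow> br e0 x = Q x + K x"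
    "\<And>x. 2 *\<^sub>R Q (Q x) + Q (K x) - K (Q x) = h *\<^sub>R Q x"
    "\<And>x y. x \<in> V \<Longrightarrow> y \<in> V \<Longrightarrow> br x y = (2 * \<tau> * g (Q x) (\<phi> y)) *\<^sub>R b - (2 * g x (\<phi> y)) *\<^sub>R \<xi>"
proof -
  define A where "A x = br e0 (P x)" for x
  have A: "linear A"
    by (rule linearI) (simp_all add: A_def br_simps linear_add[OF linear_P] linear_scale[OF linear_P])
  obtain A' where A': "linear A'" and adj: "\<And>x y. g (A x) y = g x (A' y)"
    using metric_adjoint[OF pseudo_metric_g A] by blast
  have A_V: "A x \<in> V" for x
    by (simp add: A_def br_e0_V P_V)
  have A_P: "A (P x) = A x" for x
    by (simp add: A_def P_id P_V)
  have A_\<phi>: "A (\<phi> x) = \<phi> (A x)" for x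
    by (simp add: A_def br_e0_V P_V flip: \<phi>_P)
  have A_V_id: "x \<in> V \<Longrightarrow> A x = br e0 x" for x
    by (simp add: A_def P_id)
  have A_basis: "A e0 = 0" "A b = 0" "A \<xi> = 0"
    by (simp_all add: A_def P_basis br_simps)
  have A'_V: "A' x \<in> V" for x
    using adj[of e0 x] adj[of b x] adj[of \<xi> x]
    by (simp add: V_def A_basis g_\<xi> g_sym[of "A' x"] g_simps)
  have adj': "g (A' x) y = g x (A y)" for x y
    by (metis adj g_sym)
  have A'_P: "A' (P x) = A' x" for x
    by (rule g_eqI) (metis adj g_sym g_V A_V)
  have A'_\<phi>: "A' (\<phi> x) = \<phi> (A' x)" for x
  proof (rule g_eqI)
    fix z
    have "g z (A' (\<phi> x)) = - g (\<phi> (A z)) x"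
      by (simp add: g_\<phi> flip: adj)
    also have "\<dots> = g z (\<phi> (A' x))"
      by (simp add: g_\<phi> adj flip: A_\<phi>)
    finally show "g (A' (\<phi> x)) z = g (\<phi> (A' x)) z"
      by (simp add: g_sym)
  qed
  define Q where "Q x = (1/2) *\<^sub>R (A x + A' x)" for x
  define K where "K x = (1/2) *\<^sub>R (A x - A' x)" for x
  note A_simps = linear_add[OF A] linear_diff[OF A] linear_scale[OF A]
    linear_add[OF A'] linear_diff[OF A'] linear_scale[OF A']
  have Q_V: "Q x \<in> V" and K_V: "K x \<in> V" for x
    using A_V[of x] A'_V[of x] by (simp_all add: Q_def K_def V_def g_simps \<eta>_simps)
  have QK: "Q x + K x = A x" for x
    by (simp add: Q_def K_def half_sum_diff)
  have f: "g (br x y) b = 2 * g (Q x) (\<phi> y)" if "x \<in> V" "y \<in> V" for x y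
  proof -
    have "g x (\<phi> (A y)) = g (A' x) (\<phi> y)"
      by (simp add: adj' A_\<phi>)
    then show ?thesis
      using br_V_derivation(1)[OF that] that by (simp add: A_V_id Q_def g_simps)
  qed
  have main: "2 *\<^sub>R Q (Q x) + Q (K x) - K (Q x) = h *\<^sub>R Q x" if x: "x \<in> V" for x
  proof (rule V_eqI)
    show "2 *\<^sub>R Q (Q x) + Q (K x) - K (Q x) \<in> V" "h *\<^sub>R Q x \<in> V"
      using Q_V[of x] Q_V[of "Q x"] Q_V[of "K x"] K_V[of "Q x"]
      by (simp_all add: V_def g_simps \<eta>_simps)
    fix z assume z: "z \<in> V"
    define y where "y = - \<phi> z"
    have y: "y \<in> V" "\<phi> y = z"
      using z \<phi>_V[OF z] by (simp_all add: y_def V_def \<phi>_simps \<phi>_\<phi> g_simps \<eta>_simps)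
    have "h * (2 * g (Q x) (\<phi> y)) = 2 * g (Q (A x)) (\<phi> y) + 2 * g (Q x) (\<phi> (A y))"
      using br_V_derivation(2)[OF x y(1)] by (simp add: f x y br_e0_V A_V_id)
    moreover have "g (Q x) (\<phi> (A y)) = g (A' (Q x)) (\<phi> y)"
      by (simp add: adj' A_\<phi>)
    moreover have "A' w = Q w - K w" "A w = Q w + K w" for w
      by (simp_all add: Q_def K_def half_sum_diff)
    moreover have "Q (v + w) = Q v + Q w" for v w
      by (simp add: Q_def A_simps algebra_simps)
    ultimately show "g (2 *\<^sub>R Q (Q x) + Q (K x) - K (Q x)) z = g (h *\<^sub>R Q x) z"
      by (simp add: y g_simps)
  qed
  have Q_P: "Q (P x) = Q x" and K_P: "K (P x) = K x" for x
    by (simp_all add: Q_def K_def A_P A'_P)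
  show thesis
  proof (rule that)
    show "linear Q" "linear K"
      by (rule linearI; simp add: Q_def K_def A_simps algebra_simps)+
    show "Q (P x) = Q x" "K (P x) = K x" for x
      by (fact Q_P K_P)+
    show "Q x \<in> V" "K x \<in> V" for x by (fact Q_V K_V)+
    show "g (Q x) y = g x (Q y)" "g (K x) y = - g x (K y)" for x y
      using adj[of x y] adj'[of x y] by (simp_all add: Q_def K_def g_simps field_simps)
    show "Q (\<phi> x) = \<phi> (Q x)" "K (\<phi> x) = \<phi> (K x)" for x
      by (simp_all add: Q_def K_def A_\<phi> A'_\<phi> \<phi>_simps)
    show "br e0 x = Q x + K x" if "x \<in> V" for x
      using that by (simp add: QK A_V_id)
    show "2 *\<^sub>R Q (Q x) + Q (K x) - K (Q x) = h *\<^sub>R Q x" for x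
      using main[OF P_V[of x]] by (simp add: Q_P K_P)
    show "br x y = (2 * \<tau> * g (Q x) (\<phi> y)) *\<^sub>R b - (2 * g x (\<phi> y)) *\<^sub>R \<xi>" 
      if "x \<in> V" "y \<in> V" for x y
      using br_V[OF that] f[OF that] by simp
  qed
qed

end

section \<open>Normal forms\<close>

context contact_metric
begin

text \<open>If the metric were null on the complement of \<open>F\<close>, it would vanish there by polarisation; the
  complement would be zero by nondegeneracy, and \<open>F\<close> would span the space.\<close>

lemma orthogonal_complement:
  fixes F :: "'a set"
  assumes F: "finite F" "card F < DIM('a)"
    and orth: "\<And>x y. x \<in> F \<Longrightarrow> y \<in> F \<Longrightarrow> x \<noteq> y \<Longrightarrow> g x y = 0" "\<And>x. x \<in> F \<Longrightarrow> g x x \<noteq> 0"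
  obtains v where "\<And>x. x \<in> F \<Longrightarrow> g v x = 0" "g v v \<noteq> 0"
proof (rule ccontr)
  assume "\<not> thesis"
  then have null: "g v v = 0" if "\<And>x. x \<in> F \<Longrightarrow> g v x = 0" for v
    using \<open>\<And>v. \<lbrakk>\<And>x. x \<in> F \<Longrightarrow> g v x = 0; g v v \<noteq> 0\<rbrakk> \<Longrightarrow> thesis\<close> that by blast
  have polar: "g v w = 0" if v: "\<And>x. x \<in> F \<Longrightarrow> g v x = 0" and w: "\<And>x. x \<in> F \<Longrightarrow> g w x = 0" for v w
  proof -
    have "g (v + w) (v + w) = 0"
      by (rule null) (simp add: g_simps v w)
    then show ?thesis
      using null[of v] null[of w] v w g_sym[of v w] by (simp add: g_simps)
  qed
  define p where "p x = x - (\<Sum>f\<in>F. (g x f / g f f) *\<^sub>R f)" for x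
  have p: "g (p x) y = 0" if "y \<in> F" for x y
  proof -
    have "(\<Sum>f\<in>F. (g x f / g f f) * g f y) = (\<Sum>f\<in>F. if f = y then g x y else 0)"
      using that orth by (intro sum.cong) auto
    then show ?thesis
      using that F(1) by (simp add: p_def g_simps g.sum_left)
  qed
  have "p x = 0" for x
  proof (rule g_nondegenerate)
    fix y
    have "g (p x) y = g (p x) (p y) + (\<Sum>f\<in>F. (g y f / g f f) * g (p x) f)"
      by (simp add: p_def[of y] g_simps g.sum_right)
    also have "\<dots> = 0"
      by (simp add: p polar)
    finally show "g (p x) y = 0" .
  qed
  then have "x = (\<Sum>f\<in>F. (g x f / g f f) *\<^sub>R f)" for x
    unfolding p_def by (metis eq_iff_diff_eq_0)
  then have "x \<in> span F" for x
    by (metis (no_types, lifting) span_base span_scale span_sum)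
  then have "dim (UNIV :: 'a set) \<le> card F"
    by (intro span_card_ge_dim F) auto
  with F(2) show False
    by simp
qed

lemma orthogonal_expansion:
  fixes f :: "'n::finite \<Rightarrow> 'a"
  assumes "CARD('n) = DIM('a)" and orth: "\<And>i j. i \<noteq> j \<Longrightarrow> g (f i) (f j) = 0" "\<And>i. g (f i) (f i) \<noteq> 0"
  shows "x = (\<Sum>i\<in>UNIV. (g x (f i) / g (f i) (f i)) *\<^sub>R f i)"
proof -
  define U :: "real ^ 'n \<Rightarrow> 'a" where "U a = (\<Sum>i\<in>UNIV. (a $ i) *\<^sub>R f i)" for a
  have lin: "linear U"
    by (rule linearI) (simp_all add: U_def scaleR_add_left sum.distrib scaleR_sum_right)
  have coord: "g (U a) (f j) = a $ j * g (f j) (f j)" for a j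
  proof -
    have "g (U a) (f j) = (\<Sum>i\<in>UNIV. a $ i * g (f i) (f j))"
      by (simp add: U_def g.sum_left g_simps)
    also have "\<dots> = (\<Sum>i\<in>UNIV. if i = j then a $ j * g (f j) (f j) else 0)"
      using orth(1) by (intro sum.cong) auto
    finally show ?thesis by simp
  qed
  have "a = 0" if "U a = 0" for a
    using coord[of a] that orth(2) by (auto simp: vec_eq_iff g_simps)
  then have "inj U"
    using linear_injective_0[OF lin] by blast
  then have "surj U"
    using linear_injective_imp_surjective[OF lin] assms(1) by simp
  then obtain a where "x = U a"
    by (metis surjD)
  moreover from this have "g x (f i) / g (f i) (f i) = a $ i" for i
    using coord[of a i] orth(2)[of i] by simp
  ultimately show ?thesis
    by (simp add: U_def)
qed

end

context abelian_z_standard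
begin

lemma \<phi>_\<phi>_V: "x \<in> V \<Longrightarrow> \<phi> (\<phi> x) = - x"
  by (simp add: \<phi>_\<phi> V_def)

lemma subspace_V: "subspace V"
  by (auto simp: subspace_def V_def g_simps \<eta>_simps)

lemmas V_closed = subspace_add[OF subspace_V] subspace_diff[OF subspace_V]
  subspace_scale[OF subspace_V] subspace_0[OF subspace_V] subspace_neg[OF subspace_V] \<phi>_V

text \<open>An orthonormal basis of \<open>V\<close> as a complex plane; the real and the imaginary part of the Hermitian
  product of \<open>u\<close> and \<open>v\<close> both have to vanish.\<close>

definition hermitian_frame :: "'a \<Rightarrow> 'a \<Rightarrow> real \<Rightarrow> real \<Rightarrow> bool" where
  "hermitian_frame u v c d \<longleftrightarrow> u \<in> V \<and> v \<in> V \<and> g u u = c \<and> g v v = d \<and> g u v = 0 \<and> g u (\<phi> v) = 0 \<and>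
     c \<in> {1, -1} \<and> d \<in> {1, -1}"

lemma hermitian_frame_swap: "hermitian_frame u v c d \<Longrightarrow> hermitian_frame v u d c"
  using g_\<phi>[of v u] by (auto simp: hermitian_frame_def g_sym)

lemma gram:
  assumes "hermitian_frame u v c d"
  shows "u \<in> V" "v \<in> V" "g u u = c" "g v v = d" "g u v = 0" "g v u = 0" "g u (\<phi> v) = 0" "g v (\<phi> u) = 0"
    "g (\<phi> v) u = 0" "g (\<phi> u) v = 0" "g u (\<phi> u) = 0" "g (\<phi> u) u = 0" "g v (\<phi> v) = 0" "g (\<phi> v) v = 0"
    "g (\<phi> u) (\<phi> u) = c" "g (\<phi> v) (\<phi> v) = d" "g (\<phi> u) (\<phi> v) = 0" "g (\<phi> v) (\<phi> u) = 0"
    "\<phi> (\<phi> u) = - u" "\<phi> (\<phi> v) = - v"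
    "c * c = 1" "d * d = 1" "c \<noteq> 0" "d \<noteq> 0"
proof -
  show 1: "u \<in> V" "v \<in> V" "g u u = c" "g v v = d" "g u v = 0" "g u (\<phi> v) = 0"
    "c * c = 1" "d * d = 1" "c \<noteq> 0" "d \<noteq> 0"
    using assms by (auto simp: hermitian_frame_def)
  show 2: "g v u = 0" "g (\<phi> v) u = 0"
    using 1 g_sym by metis+
  show 3: "g v (\<phi> u) = 0"
    using g_\<phi>[of v u] 2 by simp
  show "g (\<phi> u) v = 0"
    using 3 g_sym by metis
  show "g u (\<phi> u) = 0" "g (\<phi> u) u = 0" "g v (\<phi> v) = 0" "g (\<phi> v) v = 0"
    using g_\<phi>_self g_sym by metis+
  show "\<phi> (\<phi> u) = - u" "\<phi> (\<phi> v) = - v"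
    using 1 by (simp_all add: \<phi>_\<phi>_V)
  show "g (\<phi> u) (\<phi> u) = c" "g (\<phi> v) (\<phi> v) = d" "g (\<phi> u) (\<phi> v) = 0" "g (\<phi> v) (\<phi> u) = 0"
    using 1 2 by (simp_all add: g_\<phi>_\<phi> V_def)
qed

lemma normalize:
  assumes "x \<in> V" "g x x \<noteq> 0"
  obtains r c where "r > 0" "c \<in> {1, -1}" "g (r *\<^sub>R x) (r *\<^sub>R x) = c" "r *\<^sub>R x \<in> V"
proof (rule that[of "1 / sqrt \<bar>g x x\<bar>" "sgn (g x x)"])
  show "g ((1 / sqrt \<bar>g x x\<bar>) *\<^sub>R x) ((1 / sqrt \<bar>g x x\<bar>) *\<^sub>R x) = sgn (g x x)"
    using assms(2) by (simp add: g_simps sgn_if flip: power2_eq_square real_sqrt_mult)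
qed (use assms in \<open>auto simp: sgn_if V_closed\<close>)

lemma V_gram: "x \<in> V \<Longrightarrow> g x b = 0" "x \<in> V \<Longrightarrow> g x e0 = 0" "x \<in> V \<Longrightarrow> g x \<xi> = 0"
  "x \<in> V \<Longrightarrow> g b x = 0" "x \<in> V \<Longrightarrow> g e0 x = 0" "x \<in> V \<Longrightarrow> g \<xi> x = 0"
  by (simp_all add: V_def g_\<xi>' g_sym[of _ x])

lemma base_gram: "g b e0 = 0" "g e0 b = 0" "g \<xi> e0 = 0" "g e0 \<xi> = 0" "g b \<xi> = 0" "g \<xi> b = 0"
  "g b b = \<tau>" "g e0 e0 = \<tau>" "g \<xi> \<xi> = 1"
  by (simp_all add: g_b_e0 g_sym[of e0 b] g_\<xi>_e0 g_\<xi>' \<eta>_e0 \<eta>_b g_\<xi> g_b_b g_e0_e0 \<eta>_\<xi>)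

lemma complete_frame:
  assumes "DIM('a) = 7" "u \<in> V" "g u u = c" "c \<in> {1, -1}"
  obtains v d where "hermitian_frame u v c d"
proof -
  have c: "c \<noteq> 0" using assms by auto
  obtain v0 where v0: "\<And>x. x \<in> {u, \<phi> u, b, \<xi>, e0} \<Longrightarrow> g v0 x = 0" "g v0 v0 \<noteq> 0"
  proof (rule orthogonal_complement[of "{u, \<phi> u, b, \<xi>, e0}"])
    have "card {u, \<phi> u, b, \<xi>, e0} \<le> 5"
      using card_length[of "[u, \<phi> u, b, \<xi>, e0]"] by simp
    then show "card {u, \<phi> u, b, \<xi>, e0} < DIM('a)"
      using assms(1) by simp
    have "g (\<phi> u) (\<phi> u) = c"
      using assms by (simp add: g_\<phi>_\<phi> V_def)
    then show "\<And>x. x \<in> {u, \<phi> u, b, \<xi>, e0} \<Longrightarrow> g x x \<noteq> 0"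
      using assms c \<tau> by (auto simp: base_gram)
    show "\<And>x y. x \<in> {u, \<phi> u, b, \<xi>, e0} \<Longrightarrow> y \<in> {u, \<phi> u, b, \<xi>, e0} \<Longrightarrow> x \<noteq> y \<Longrightarrow> g x y = 0"
      using assms(2) \<phi>_V[OF assms(2)] g_\<phi>_self[of u] g_sym[of "\<phi> u" u]
      by (auto simp: base_gram V_gram)
  qed auto
  have "v0 \<in> V"
    using v0(1) by (simp add: V_def flip: g_\<xi>')
  then obtain r d where r: "d \<in> {1, -1}" "g (r *\<^sub>R v0) (r *\<^sub>R v0) = d" "r *\<^sub>R v0 \<in> V"
    using normalize v0(2) by metis
  have "g u (\<phi> v0) = 0"
    using g_\<phi>[of u v0] v0(1)[of "\<phi> u"] g_sym[of v0] by simp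
  then have "hermitian_frame u (r *\<^sub>R v0) c d"
    using assms r v0(1)[of u] g_sym[of u v0] by (simp add: hermitian_frame_def g_simps \<phi>_simps)
  then show thesis
    by (rule that)
qed

lemma exists_frame:
  assumes "DIM('a) = 7"
  obtains u v c d where "hermitian_frame u v c d"
proof -
  obtain u0 where u0: "\<And>x. x \<in> {b, \<xi>, e0} \<Longrightarrow> g u0 x = 0" "g u0 u0 \<noteq> 0"
  proof (rule orthogonal_complement[of "{b, \<xi>, e0}"])
    have "card {b, \<xi>, e0} \<le> 3"
      using card_length[of "[b, \<xi>, e0]"] by simp
    then show "card {b, \<xi>, e0} < DIM('a)"
      using assms(1) by simp
    show "\<And>x. x \<in> {b, \<xi>, e0} \<Longrightarrow> g x x \<noteq> 0"
      using \<tau> by (auto simp: base_gram)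
    show "\<And>x y. x \<in> {b, \<xi>, e0} \<Longrightarrow> y \<in> {b, \<xi>, e0} \<Longrightarrow> x \<noteq> y \<Longrightarrow> g x y = 0"
      by (auto simp: base_gram)
  qed auto
  have "u0 \<in> V"
    using u0(1) by (simp add: V_def flip: g_\<xi>')
  then obtain r d where "d \<in> {1, -1}" "g (r *\<^sub>R u0) (r *\<^sub>R u0) = d" "r *\<^sub>R u0 \<in> V"
    using normalize u0(2) by metis
  then show thesis
    using complete_frame[OF assms] that by metis
qed

lemma frame_expansion:
  assumes "DIM('a) = 7" and fr: "hermitian_frame u v c d"
  shows "x = (c * g x u) *\<^sub>R u + (c * g x (\<phi> u)) *\<^sub>R \<phi> u + (d * g x v) *\<^sub>R v + (d * g x (\<phi> v)) *\<^sub>R \<phi> v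
     + (\<tau> * g x b) *\<^sub>R b + \<eta> x *\<^sub>R \<xi> + \<theta> x *\<^sub>R e0"
proof -
  define f where "f i = (vector [u, \<phi> u, v, \<phi> v, b, \<xi>, e0] :: 'a^7) $ i" for i
  note G = gram[OF fr]
  note G' = \<phi>_V[OF G(1)] \<phi>_V[OF G(2)]
  have "\<forall>i j. i \<noteq> j \<longrightarrow> g (f i) (f j) = 0"
    unfolding forall_7 f_def by (simp add: G G' V_gram base_gram)
  moreover have "\<forall>i. g (f i) (f i) \<noteq> 0"
    unfolding forall_7 f_def using \<tau> by (auto simp: G base_gram)
  moreover have "r / c = c * r" "r / d = d * r" "r / \<tau> = \<tau> * r" for r
    using G(21-24) \<tau>_\<tau> \<tau> by (auto simp: field_simps)
  ultimately show ?thesis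
    using orthogonal_expansion[of f x] assms(1)
    by (simp add: sum_7 f_def G base_gram \<theta>_def g_\<xi>' \<eta>_\<xi> add.assoc)
qed

lemma frame_expansion_V:
  assumes "DIM('a) = 7" and fr: "hermitian_frame u v c d" and "x \<in> V"
  shows "x = (c * g x u) *\<^sub>R u + (c * g x (\<phi> u)) *\<^sub>R \<phi> u + (d * g x v) *\<^sub>R v + (d * g x (\<phi> v)) *\<^sub>R \<phi> v"
  using frame_expansion[OF assms(1,2), of x] assms(3) by (simp add: V_def \<theta>_def)

end

text \<open>The conclusion of \<open>bracket_parts\<close>, in dimension seven.\<close>

locale split_bracket = abelian_z_standard br S \<gg> e0 \<tau>
  for br :: "'a::euclidean_space \<Rightarrow> 'a \<Rightarrow> 'a" and S :: "'a contact_structure"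
    and \<gg> :: "'a set" and e0 :: 'a and \<tau> :: real +
  fixes Q K :: "'a \<Rightarrow> 'a"
  assumes linear_Q: "linear Q" and linear_K: "linear K"
    and Q_V: "Q x \<in> V" and K_V: "K x \<in> V"
    and Q_P: "Q (P x) = Q x" and K_P: "K (P x) = K x"
    and g_Q: "g (Q x) y = g x (Q y)" and g_K: "g (K x) y = - g x (K y)"
    and Q_\<phi>: "Q (\<phi> x) = \<phi> (Q x)" and K_\<phi>: "K (\<phi> x) = \<phi> (K x)"
    and br_e0: "x \<in> V \<Longrightarrow> br e0 x = Q x + K x"
    and Q_K: "2 *\<^sub>R Q (Q x) + Q (K x) - K (Q x) = h *\<^sub>R Q x"
    and br_V_V: "x \<in> V \<Longrightarrow> y \<in> V \<Longrightarrow>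
      br x y = (2 * \<tau> * g (Q x) (\<phi> y)) *\<^sub>R b - (2 * g x (\<phi> y)) *\<^sub>R \<xi>"
    and dim_7: "DIM('a) = 7"
begin

lemmas Q_simps = linear_add[OF linear_Q] linear_scale[OF linear_Q] linear_0[OF linear_Q]
  linear_neg[OF linear_Q] linear_diff[OF linear_Q]
lemmas K_simps = linear_add[OF linear_K] linear_scale[OF linear_K] linear_0[OF linear_K]
  linear_neg[OF linear_K] linear_diff[OF linear_K]

lemma eq_on_frame:
  assumes fr: "hermitian_frame u v c d"
    and F: "linear F" "\<And>x. F (\<phi> x) = \<phi> (F x)" and G: "linear G" "\<And>x. G (\<phi> x) = \<phi> (G x)"
    and "F u = G u" "F v = G v" and x: "x \<in> V"
  shows "F x = G x"
  by (subst (1 2) frame_expansion_V[OF dim_7 fr x])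
    (simp add: linear_add[OF F(1)] linear_scale[OF F(1)] linear_add[OF G(1)] linear_scale[OF G(1)]
      F(2) G(2) assms)

text \<open>In a unitary frame the matrix of a symmetric complex linear map is determined by its first column
  and one real number; the sign of the off-diagonal conjugate depends on the signature. Here
  \<open>q1\<close> and \<open>q2\<close> are the real and the imaginary part of the off-diagonal entry.\<close>

lemma Q_matrix:
  assumes fr: "hermitian_frame u v c d"
  obtains p q1 q2 r where
    "Q u = p *\<^sub>R u + q1 *\<^sub>R v + q2 *\<^sub>R \<phi> v"
    "Q v = r *\<^sub>R v + (c * d * q1) *\<^sub>R u - (c * d * q2) *\<^sub>R \<phi> u"
proof
  have dd: "d * (d * x) = x" for x
    using gram(22)[OF fr] by (simp flip: mult.assoc)
  have 0: "g (Q x) (\<phi> x) = 0" for x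
  proof -
    have "g (Q x) (\<phi> x) = - g (\<phi> x) (Q x)"
      by (simp add: g_Q Q_\<phi> g_\<phi>)
    then show ?thesis
      using g_sym[of "\<phi> x"] by simp
  qed
  have 1: "g (Q v) u = g (Q u) v" "g (Q v) (\<phi> u) = - g (Q u) (\<phi> v)"
    by (metis g_Q g_sym) (metis g_Q g_sym Q_\<phi> g_\<phi>)
  show "Q u = (c * g (Q u) u) *\<^sub>R u + (d * g (Q u) v) *\<^sub>R v + (d * g (Q u) (\<phi> v)) *\<^sub>R \<phi> v"
    using frame_expansion_V[OF dim_7 fr Q_V[of u]] by (simp add: 0)
  show "Q v = (d * g (Q v) v) *\<^sub>R v + (c * d * (d * g (Q u) v)) *\<^sub>R u - (c * d * (d * g (Q u) (\<phi> v))) *\<^sub>R \<phi> u"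
    using frame_expansion_V[OF dim_7 fr Q_V[of v]] by (simp add: 0 1 mult.assoc dd) (simp add: algebra_simps)
qed

lemma K_matrix:
  assumes fr: "hermitian_frame u v c d"
  obtains k m1 m2 l where
    "K u = k *\<^sub>R \<phi> u + m1 *\<^sub>R v + m2 *\<^sub>R \<phi> v"
    "K v = l *\<^sub>R \<phi> v - (c * d * m1) *\<^sub>R u + (c * d * m2) *\<^sub>R \<phi> u"
proof
  have dd: "d * (d * x) = x" for x
    using gram(22)[OF fr] by (simp flip: mult.assoc)
  have 0: "g (K x) x = 0" for x
    using g_K[of x x] g_sym[of x] by simp
  have 1: "g (K v) u = - g (K u) v" "g (K v) (\<phi> u) = g (K u) (\<phi> v)"
    by (metis g_K g_sym) (metis g_K g_sym K_\<phi> g_\<phi> minus_minus)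
  show "K u = (c * g (K u) (\<phi> u)) *\<^sub>R \<phi> u + (d * g (K u) v) *\<^sub>R v + (d * g (K u) (\<phi> v)) *\<^sub>R \<phi> v"
    using frame_expansion_V[OF dim_7 fr K_V[of u]] by (simp add: 0)
  show "K v = (d * g (K v) (\<phi> v)) *\<^sub>R \<phi> v - (c * d * (d * g (K u) v)) *\<^sub>R u + (c * d * (d * g (K u) (\<phi> v))) *\<^sub>R \<phi> u"
    using frame_expansion_V[OF dim_7 fr K_V[of v]] by (simp add: 0 1 mult.assoc dd) (simp add: algebra_simps)
qed

text \<open>Here \<open>t\<close> and \<open>d\<close> are the complex trace and determinant of \<open>Q\<close>, and the first claim is the
  Cayley--Hamilton theorem. The commutator has trace zero, also after multiplication with \<open>Q\<close>, so
  \<open>2 Q\<^sup>2 - h Q\<close> and \<open>2 Q\<^sup>3 - h Q\<^sup>2\<close> have trace zero; expressed by \<open>t\<close> and \<open>d\<close> these are the last two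
  claims.\<close>

lemma quadratic_Q:
  obtains t d where "\<And>x. x \<in> V \<Longrightarrow> Q (Q x) = t *\<^sub>R Q x - d *\<^sub>R x"
    "(2 * t - h) * t = 4 * d" "d * (h - t) = 0"
proof -
  obtain u v c d where fr: "hermitian_frame u v c d"
    using exists_frame[OF dim_7] by blast
  note G = gram[OF fr]
  obtain p q1 q2 r where Quv: "Q u = p *\<^sub>R u + q1 *\<^sub>R v + q2 *\<^sub>R \<phi> v"
    "Q v = r *\<^sub>R v + (c * d * q1) *\<^sub>R u - (c * d * q2) *\<^sub>R \<phi> u"
    using Q_matrix[OF fr] by blast
  obtain k m1 m2 l where Kuv: "K u = k *\<^sub>R \<phi> u + m1 *\<^sub>R v + m2 *\<^sub>R \<phi> v"
    "K v = l *\<^sub>R \<phi> v - (c * d * m1) *\<^sub>R u + (c * d * m2) *\<^sub>R \<phi> u"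
    using K_matrix[OF fr] by blast
  define \<epsilon> where "\<epsilon> = c * d"
  have cd: "c * (c * x) = x" "d * (d * x) = x" for x
    using G(21,22) by (simp_all flip: mult.assoc)
  define n where "n = q1\<^sup>2 + q2\<^sup>2"
  define R where "R = - (q1 * m1 + q2 * m2)"
  note simps = Quv Kuv Q_simps K_simps Q_\<phi> K_\<phi> \<phi>_simps g_simps G
  have "c * (2 * (p\<^sup>2 + \<epsilon> * n) - 2 * \<epsilon> * R) = c * (h * p)"
    using arg_cong[OF Q_K[of u], of "\<lambda>z. g z u"]
    by (simp add: simps n_def R_def \<epsilon>_def power2_eq_square algebra_simps)
  then have E1: "2 * (p\<^sup>2 + \<epsilon> * n) - 2 * \<epsilon> * R = h * p"
    using G by simp
  have "d * (2 * (r\<^sup>2 + \<epsilon> * n) + 2 * \<epsilon> * R) = d * (h * r)"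
    using arg_cong[OF Q_K[of v], of "\<lambda>z. g z v"]
    by (simp add: simps n_def R_def \<epsilon>_def power2_eq_square algebra_simps)
  then have E2: "2 * (r\<^sup>2 + \<epsilon> * n) + 2 * \<epsilon> * R = h * r"
    using G by simp
  have "d * (2 * (p + r) * q1 - ((p - r) * m1 + (k - l) * q2)) = d * (h * q1)"
    using arg_cong[OF Q_K[of u], of "\<lambda>z. g z v"]
    by (simp add: simps algebra_simps)
  then have E3: "2 * (p + r) * q1 - ((p - r) * m1 + (k - l) * q2) = h * q1"
    using G by simp
  have "d * (2 * (p + r) * q2 - ((p - r) * m2 - (k - l) * q1)) = d * (h * q2)"
    using arg_cong[OF Q_K[of u], of "\<lambda>z. g z (\<phi> v)"]
    by (simp add: simps algebra_simps)
  then have E4: "2 * (p + r) * q2 - ((p - r) * m2 - (k - l) * q1) = h * q2"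
    using G by simp
  have E5: "2 * (p + r) * n + (p - r) * R = h * n"
  proof -
    have "2 * (p + r) * n + (p - r) * R = q1 * (2 * (p + r) * q1 - ((p - r) * m1 + (k - l) * q2))
      + q2 * (2 * (p + r) * q2 - ((p - r) * m2 - (k - l) * q1))"
      by (simp add: n_def R_def power2_eq_square algebra_simps)
    then show ?thesis
      unfolding E3 E4 by (simp add: n_def power2_eq_square algebra_simps)
  qed
  define t where "t = p + r"
  define e where "e = p * r - \<epsilon> * n"
  have te: "(2 * t - h) * t = 4 * e"
    using E1 E2 by (simp add: t_def e_def power2_eq_square algebra_simps)
  \<comment> \<open>The trace of the equation multiplied by \<open>Q\<close>, minus a multiple of the trace of the equation.\<close>
  have "2 * (e * (h - t)) = p * (2 * (p\<^sup>2 + \<epsilon> * n) - 2 * \<epsilon> * R - h * p)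
     + r * (2 * (r\<^sup>2 + \<epsilon> * n) + 2 * \<epsilon> * R - h * r)
     + 2 * \<epsilon> * (2 * (p + r) * n + (p - r) * R - h * n) - t * ((2 * t - h) * t - 4 * e)"
    by (simp add: t_def e_def power2_eq_square algebra_simps)
  then have det: "e * (h - t) = 0"
    unfolding E1 E2 E5 te by simp
  have QQ: "Q (Q x) = t *\<^sub>R Q x - e *\<^sub>R x" if "x \<in> V" for x
  proof (rule eq_on_frame[OF fr _ _ _ _ _ _ that])
    show "linear (\<lambda>x. Q (Q x))"
      by (rule linearI) (simp_all add: Q_simps)
    show "linear (\<lambda>x. t *\<^sub>R Q x - e *\<^sub>R x)"
      by (rule linearI) (simp_all add: Q_simps algebra_simps)
    show "Q (Q u) = t *\<^sub>R Q u - e *\<^sub>R u" "Q (Q v) = t *\<^sub>R Q v - e *\<^sub>R v"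
      by (simp_all add: Quv Q_simps Q_\<phi> \<phi>_simps G t_def e_def n_def \<epsilon>_def power2_eq_square
          algebra_simps cd)
  qed (simp_all add: Q_\<phi> \<phi>_simps)
  show thesis
    by (rule that[OF QQ te det])
qed

text \<open>The operators that can be added to \<open>ad e\<^sub>0\<close> without changing the isometry class.\<close>

definition admissible :: "('a \<Rightarrow> 'a) \<Rightarrow> bool" where
  "admissible N \<longleftrightarrow> linear N \<and> (\<forall>x. N x \<in> V) \<and> (\<forall>x. N (P x) = N x) \<and>
     (\<forall>x y. g (N x) y = - g x (N y)) \<and> (\<forall>x. N (\<phi> x) = \<phi> (N x)) \<and>
     (\<forall>x. Q (N x) = N (Q x)) \<and> (\<forall>x. K (N x) = N (K x))"

lemma admissible_minus_K:
  assumes "\<And>x. x \<in> V \<Longrightarrow> Q (K x) = K (Q x)"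
  shows "admissible (\<lambda>x. - K x)"
proof -
  have "Q (K x) = K (Q x)" for x
    using assms[OF P_V[of x]] by (simp add: Q_P K_P)
  then show ?thesis
    by (auto simp: admissible_def linear_K linear_compose_neg K_V V_closed K_P g_simps g_K K_\<phi>
        \<phi>_simps Q_simps K_simps)
qed

text \<open>Multiplication by an imaginary number is skew and central among the complex linear maps.\<close>

lemma admissible_rotation: "admissible (\<lambda>x. \<mu> *\<^sub>R \<phi> (P x))"
proof -
  have P_Q: "P (Q x) = Q (P x)" "P (K x) = K (P x)" for x
    by (simp_all add: P_id Q_V K_V Q_P K_P)
  have skew: "g (\<phi> (P x)) y = - g x (\<phi> (P y))" for x y
  proof -
    have "g (\<phi> (P x)) y = g (\<phi> (P x)) (P y)"
      by (rule g_V) (intro V_closed P_V)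
    also have "\<dots> = - g (\<phi> (P y)) (P x)"
      by (simp add: g_\<phi>) (metis g_\<phi> g_sym)
    also have "\<dots> = - g (\<phi> (P y)) x"
      by (subst (2) g_V) (intro V_closed P_V, simp)
    finally show ?thesis
      using g_sym by metis
  qed
  show ?thesis
    unfolding admissible_def
  proof (intro conjI allI)
    show "linear (\<lambda>x. \<mu> *\<^sub>R \<phi> (P x))"
      by (rule linearI) (simp_all add: linear_add[OF linear_P] linear_scale[OF linear_P] \<phi>_simps algebra_simps)
    show "\<mu> *\<^sub>R \<phi> (P x) \<in> V" for x
      by (intro V_closed P_V)
  qed (simp_all add: skew g_simps P_id P_V Q_simps K_simps Q_\<phi> K_\<phi> P_Q \<phi>_simps flip: \<phi>_P)
qed

text \<open>Only the real part of the matrices on the list appears: \<open>\<lambda>\<close> is taken to be zero.\<close>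

definition has_normal_form :: "nat \<Rightarrow> bool" where
  "has_normal_form n \<longleftrightarrow> (\<exists>u v s N \<alpha> \<beta> \<gamma> \<delta>. n \<in> {1..11} \<and> s \<in> {1, -1} \<and>
     hermitian_frame u v s (s * listed_sign n) \<and> admissible N \<and> listed_matrix n = (\<alpha>, \<beta>, \<gamma>, \<delta>, h) \<and>
     Q u + K u + N u = \<alpha> *\<^sub>R u + \<gamma> *\<^sub>R v \<and> Q v + K v + N v = \<beta> *\<^sub>R u + \<delta> *\<^sub>R v)"

lemma has_normal_formI:
  assumes fr: "hermitian_frame u v c d" and "admissible N"
    and "Q u + K u + N u = \<alpha> *\<^sub>R u + \<gamma> *\<^sub>R v" "Q v + K v + N v = \<beta> *\<^sub>R u + \<delta> *\<^sub>R v"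
    and "n \<in> {1..11}" "listed_sign n = c * d" "listed_matrix n = (\<alpha>, \<beta>, \<gamma>, \<delta>, h)"
  shows "\<exists>n. has_normal_form n"
proof -
  have "c \<in> {1, -1}" "c * (c * d) = d"
    using fr gram(21)[OF fr] by (auto simp: hermitian_frame_def)
  then have "has_normal_form n"
    unfolding has_normal_form_def using assms by metis
  then show ?thesis ..
qed

lemma frame_sign: "hermitian_frame u v c d \<Longrightarrow> c * d = 1 \<or> c * d = -1"
  by (auto simp: hermitian_frame_def)

text \<open>Cases 1, 2, 4 and 5, 6, 8: a scalar \<open>Q\<close> commutes with \<open>K\<close>, and any unitary frame will do.\<close>

lemma normal_form_scalar:
  assumes Q: "\<And>x. x \<in> V \<Longrightarrow> Q x = \<sigma> *\<^sub>R x" and \<sigma>: "\<sigma> = 0 \<and> (h = 0 \<or> h = 2) \<or> \<sigma> = 1 \<and> h = 2"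
  shows "\<exists>n. has_normal_form n"
proof -
  obtain u v c d where fr: "hermitian_frame u v c d"
    using exists_frame[OF dim_7] by blast
  have N: "admissible (\<lambda>x. - K x)"
    by (rule admissible_minus_K) (simp add: Q K_V K_simps)
  have "\<exists>n\<in>{1..11}. listed_sign n = c * d \<and> listed_matrix n = (\<sigma>, 0, 0, \<sigma>, h)"
  proof -
    have "\<exists>n\<in>{1, 2, 4, 5, 6, 8}. listed_sign n = c * d \<and> listed_matrix n = (\<sigma>, 0, 0, \<sigma>, h)"
      using frame_sign[OF fr] \<sigma> by (elim disjE; simp add: listed_sign_def listed_matrix_def)
    then show ?thesis by fastforce
  qed
  then obtain n where "n \<in> {1..11}" "listed_sign n = c * d" "listed_matrix n = (\<sigma>, 0, 0, \<sigma>, h)"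
    by blast
  then show ?thesis
    by (intro has_normal_formI[OF fr N]) (simp_all add: Q gram(1,2)[OF fr])
qed

lemma symmetric_nonzero:
  assumes "\<And>x y. g (F x) y = g x (F y)" "linear F" "\<And>x. F x \<in> V" "x0 \<in> V" "F x0 \<noteq> 0"
  obtains w where "w \<in> V" "g (F w) w \<noteq> 0"
proof (rule ccontr)
  assume "\<not> thesis"
  then have null: "g (F w) w = 0" if "w \<in> V" for w
    using that \<open>\<And>w. \<lbrakk>w \<in> V; g (F w) w \<noteq> 0\<rbrakk> \<Longrightarrow> thesis\<close> by blast
  have "g (F x0) z = 0" if z: "z \<in> V" for z
  proof -
    have "g (F (x0 + z)) (x0 + z) = 0"
      using z assms(4) by (intro null V_closed)
    moreover have "g (F z) x0 = g (F x0) z"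
      by (metis assms(1) g_sym)
    ultimately show ?thesis
      using null[OF z] null[OF assms(4)] by (simp add: linear_add[OF assms(2)] g_simps)
  qed
  then have "F x0 = 0"
    using assms(3) by (intro V_eqI) (auto simp: V_closed g_simps)
  with assms(5) show False by blast
qed

text \<open>Cases 3 and 7, or 4 and 8 if \<open>Q\<close> turns out to be the identity. An image vector \<open>Q w\<close> with
  \<open>g(Q w, w) \<noteq> 0\<close> is not null, because \<open>g(Q w, Q w) = g(Q\<^sup>2 w, w) = g(Q w, w)\<close>. Its unitary complement is an
  eigenline of \<open>Q\<close>, with eigenvalue \<open>p\<close> equal to 0 or 1.\<close>

lemma normal_form_projection:
  assumes Q: "\<And>x. x \<in> V \<Longrightarrow> Q (Q x) = Q x" and h: "h = 2" and ne: "x0 \<in> V" "Q x0 \<noteq> 0"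
  shows "\<exists>n. has_normal_form n"
proof -
  obtain w where w: "w \<in> V" "g (Q w) w \<noteq> 0"
    using symmetric_nonzero[OF g_Q linear_Q Q_V ne] by blast
  then have "g (Q w) (Q w) \<noteq> 0"
    by (metis g_Q Q)
  then obtain r c where r: "c \<in> {1, -1}" "g (r *\<^sub>R Q w) (r *\<^sub>R Q w) = c" "r *\<^sub>R Q w \<in> V"
    using normalize[OF Q_V[of w]] by metis
  define v where "v = r *\<^sub>R Q w"
  have Qv: "Q v = v"
    using w by (simp add: v_def Q_simps Q)
  obtain u d where fr': "hermitian_frame v u c d"
    using complete_frame[OF dim_7, of v c] r v_def by blast
  then have fr: "hermitian_frame u v d c"
    by (rule hermitian_frame_swap)
  note G = gram[OF fr]
  obtain p q1 q2 s where "Q u = p *\<^sub>R u + q1 *\<^sub>R v + q2 *\<^sub>R \<phi> v"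
    "Q v = s *\<^sub>R v + (d * c * q1) *\<^sub>R u - (d * c * q2) *\<^sub>R \<phi> u"
    using Q_matrix[OF fr] by blast
  moreover have "g (Q u) v = 0"
    by (simp add: g_Q Qv G)
  moreover have "g (Q u) (\<phi> v) = 0"
    by (simp add: g_Q Q_\<phi> Qv G)
  ultimately have Qu: "Q u = p *\<^sub>R u"
    using G by (auto simp: g_simps)
  have "p *\<^sub>R (p *\<^sub>R u) = p *\<^sub>R u"
    using Q[OF G(1)] by (simp add: Qu Q_simps)
  moreover have "u \<noteq> 0"
    using G(3,23) by (auto simp: g_simps)
  ultimately have p: "p = 0 \<or> p = 1"
    by auto
  have N: "admissible (\<lambda>x. - K x)"
  proof (rule admissible_minus_K)
    fix x assume "x \<in> V"
    then show "Q (K x) = K (Q x)"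
      using Q_K[of x] by (simp add: Q h)
  qed
  have "\<exists>n\<in>{1..11}. listed_sign n = d * c \<and> listed_matrix n = (p, 0, 0, 1, h)"
  proof -
    have "\<exists>n\<in>{3, 4, 7, 8}. listed_sign n = d * c \<and> listed_matrix n = (p, 0, 0, 1, h)"
      using frame_sign[OF fr] p by (elim disjE; simp add: listed_sign_def listed_matrix_def h)
    then show ?thesis by fastforce
  qed
  then obtain n where "n \<in> {1..11}" "listed_sign n = d * c" "listed_matrix n = (p, 0, 0, 1, h)"
    by blast
  then show ?thesis
    by (intro has_normal_formI[OF fr N]) (simp_all add: Qu Qv)
qed

text \<open>A hyperbolic pair gives a unitary frame of signature \<open>(s, - s)\<close>.\<close>

lemma null_frame:
  assumes "n \<in> V" "w \<in> V" "g n n = 0" "g w w = 0" "g n w = 2 * s" "g n (\<phi> w) = 0" "s \<in> {1, -1}"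
  shows "hermitian_frame ((1/2) *\<^sub>R (w + n)) ((1/2) *\<^sub>R (n - w)) s (- s)"
proof -
  have "g w n = 2 * s" "g (\<phi> w) n = 0" "g w (\<phi> n) = 0"
    using assms g_sym g_\<phi>[of w n] by simp_all
  then show ?thesis
    using assms by (auto simp: hermitian_frame_def V_closed g_simps \<phi>_simps g_\<phi>_self)
qed

text \<open>Cases 9 to 11. Choose \<open>w\<close> with \<open>g(F w, w) \<noteq> 0\<close>; then \<open>n = F w\<close> is null because \<open>F\<close> is symmetric with
  square zero, and \<open>w\<close> can be made null by adding a real multiple of \<open>n\<close>. If \<open>\<kappa> = 0\<close>, then \<open>K\<close> commutes
  with \<open>Q\<close> and is removed. If \<open>\<kappa> \<noteq> 0\<close>, skewness and \<open>[F, K] = \<kappa> F\<close> leave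
  \<open>K w = (\<kappa>/2 + i X2) w + i Y2 n\<close> and \<open>K n = (- \<kappa>/2 + i X2) n\<close>. The two diagonal entries differ by the
  nonzero number \<open>\<kappa>\<close>, so adding an imaginary multiple of \<open>n\<close> to \<open>w\<close> removes \<open>Y2\<close>, and \<open>X2\<close> is removed by
  an admissible rotation.\<close>

lemma normal_form_nilpotent:
  assumes Q: "\<And>x. x \<in> V \<Longrightarrow> Q x = \<sigma> *\<^sub>R x + F x" and F_V: "\<And>x. F x \<in> V"
    and F: "linear F" "\<And>x y. g (F x) y = g x (F y)" "\<And>x. F (\<phi> x) = \<phi> (F x)"
    and FF: "\<And>x. x \<in> V \<Longrightarrow> F (F x) = 0"
    and FK: "\<And>x. x \<in> V \<Longrightarrow> F (K x) - K (F x) = \<kappa> *\<^sub>R F x"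
    and ne: "x0 \<in> V" "F x0 \<noteq> 0"
    and \<sigma>: "\<sigma> = 0 \<and> h = 0 \<and> \<kappa> = 0 \<or> \<sigma> = 0 \<and> h = 2 \<and> \<kappa> = 2 \<or> \<sigma> = 1 \<and> h = 2 \<and> \<kappa> = -2"
  shows "\<exists>n. has_normal_form n"
proof -
  note F_simps = linear_add[OF F(1)] linear_scale[OF F(1)] linear_diff[OF F(1)] linear_neg[OF F(1)]
  obtain w0 where w0: "w0 \<in> V" "g (F w0) w0 \<noteq> 0"
    using symmetric_nonzero[OF F(2,1) F_V ne] by blast
  define s where "s = sgn (g (F w0) w0)"
  have s: "s \<in> {1, -1}"
    using w0(2) by (auto simp: s_def sgn_if)
  \<comment> \<open>The normalisation \<open>g(F w, w) = 2 s\<close> makes the frame built from \<open>w\<close> and \<open>n\<close> unitary.\<close>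
  define w1 where "w1 = sqrt (2 / \<bar>g (F w0) w0\<bar>) *\<^sub>R w0"
  have "g (F w1) w1 = (sqrt (2 / \<bar>g (F w0) w0\<bar>) * sqrt (2 / \<bar>g (F w0) w0\<bar>)) * g (F w0) w0"
    by (simp add: w1_def F_simps g_simps del: real_sqrt_mult_self)
  also have "\<dots> = 2 * s"
    using w0 by (simp add: s_def sgn_if)
  finally have w1: "w1 \<in> V" "g (F w1) w1 = 2 * s"
    using w0 by (simp_all add: w1_def V_closed)
  define n where "n = F w1"
  have n: "n \<in> V" "g n n = 0" "F n = 0" "g n w1 = 2 * s"
    using FF[OF w1(1)] w1 F_V by (simp_all add: n_def F(2) g_simps)
  have n\<phi>: "g n (\<phi> w1) = 0"
  proof -
    have "g n (\<phi> w1) = - g (\<phi> w1) n"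
      by (simp add: n_def F(2,3) flip: g_\<phi>) (simp add: g_\<phi> F(2,3) flip: n_def)
    then show ?thesis using g_sym[of n] by simp
  qed
  define w where "w = w1 - (g w1 w1 / (4 * s)) *\<^sub>R n"
  have w: "w \<in> V" "F w = n" "g n w = 2 * s" "g w w = 0" "g n (\<phi> w) = 0"
    using n w1 s n\<phi> g_sym[of w1 n]
    by (auto simp: w_def V_closed F_simps g_simps \<phi>_simps g_\<phi>_self simp flip: n_def)
  obtain w' N where w': "w' \<in> V" "F w' = n" "g n w' = 2 * s" "g w' w' = 0" "g n (\<phi> w') = 0"
    and N: "admissible N" 
    and KN: "K w' + N w' = (\<kappa> / 2) *\<^sub>R w'" "K n + N n = - (\<kappa> / 2) *\<^sub>R n"
  proof (cases "\<kappa> = 0")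
    case True
    have "admissible (\<lambda>x. - K x)"
    proof (rule admissible_minus_K)
      fix x assume x: "x \<in> V"
      then show "Q (K x) = K (Q x)"
        using FK[OF x] \<sigma> True by (auto simp: Q K_V)
    qed
    then show thesis
      using w True by (intro that[of w "\<lambda>x. - K x"]) simp_all
  next
    case False
    have "g n w = 2 * s" "g w n = 2 * s" "g w (\<phi> n) = 0" "g (\<phi> n) w = 0" "g (\<phi> w) w = 0"
      "g (\<phi> w) n = 0" "g n (\<phi> n) = 0" "g (\<phi> n) n = 0" "g (\<phi> n) (\<phi> n) = 0"
      using w n g_sym g_\<phi>[of w n] g_\<phi>_self[of n] g_\<phi>_self[of w] by (simp_all add: g_\<phi>_\<phi> V_def)
    note gr = this w(4,5) n(2)
    have fr: "hermitian_frame ((1/2) *\<^sub>R (w + n)) ((1/2) *\<^sub>R (n - w)) s (- s)"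
      using n w s by (intro null_frame) auto
    obtain X1 X2 Y1 Y2 where "K w = X1 *\<^sub>R w + X2 *\<^sub>R \<phi> w + Y1 *\<^sub>R n + Y2 *\<^sub>R \<phi> n"
    proof -
      obtain A B C D where "K w = A *\<^sub>R ((1/2) *\<^sub>R (w + n)) + B *\<^sub>R \<phi> ((1/2) *\<^sub>R (w + n))
          + C *\<^sub>R ((1/2) *\<^sub>R (n - w)) + D *\<^sub>R \<phi> ((1/2) *\<^sub>R (n - w))"
        using frame_expansion_V[OF dim_7 fr K_V[of w]] by blast
      then have "K w = ((A - C) / 2) *\<^sub>R w + ((B - D) / 2) *\<^sub>R \<phi> w + ((A + C) / 2) *\<^sub>R n + ((B + D) / 2) *\<^sub>R \<phi> n"
        by (simp add: \<phi>_simps algebra_simps add_divide_distrib diff_divide_distrib)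
      then show thesis by (rule that)
    qed
    moreover have "Y1 = 0"
    proof -
      have "g (K w) w = 0"
        using g_K[of w w] g_sym[of "K w" w] by simp
      then show ?thesis
        using calculation s by (auto simp: g_simps gr)
    qed
    ultimately have Kw: "K w = X1 *\<^sub>R w + X2 *\<^sub>R \<phi> w + Y2 *\<^sub>R \<phi> n"
      by simp
    have "K n = X1 *\<^sub>R n + X2 *\<^sub>R \<phi> n - \<kappa> *\<^sub>R n"
      using FK[OF w(1)] by (simp add: w(2) Kw F_simps F(3) n(3) \<phi>_simps algebra_simps)
    also have "\<dots> = (X1 - \<kappa>) *\<^sub>R n + X2 *\<^sub>R \<phi> n"
      by (simp add: algebra_simps)
    finally have Kn': "K n = (X1 - \<kappa>) *\<^sub>R n + X2 *\<^sub>R \<phi> n" .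
    then have X1: "X1 = \<kappa> / 2"
      using g_K[of n w] s by (auto simp: Kw g_simps gr)
    have Kn: "K n = - (\<kappa> / 2) *\<^sub>R n + X2 *\<^sub>R \<phi> n"
      using Kn' by (simp add: X1)
    \<comment> \<open>The shift that solves \<open>Y2 - r \<kappa> = 0\<close> for the coefficient \<open>r\<close> of \<open>\<phi> n\<close>.\<close>
    define w' where "w' = w + (Y2 / \<kappa>) *\<^sub>R \<phi> n"
    have \<phi>\<phi>: "\<phi> (\<phi> n) = - n"
      using n(1) by (rule \<phi>_\<phi>_V)
    have w'V: "w' \<in> V"
      by (simp add: w'_def V_closed n w)
    show thesis
    proof (rule that[OF w'V])
      show "F w' = n" "g n w' = 2 * s" "g w' w' = 0" "g n (\<phi> w') = 0"
        by (simp_all add: w'_def F_simps F(3) w(2) n(3) \<phi>_simps g_simps gr \<phi>\<phi>)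
      show "admissible (\<lambda>x. (- X2) *\<^sub>R \<phi> (P x))"
        by (rule admissible_rotation)
      show "K n + (- X2) *\<^sub>R \<phi> (P n) = - (\<kappa> / 2) *\<^sub>R n"
        by (simp add: Kn P_id n(1))
      show "K w' + (- X2) *\<^sub>R \<phi> (P w') = (\<kappa> / 2) *\<^sub>R w'"
        using False by (simp add: P_id w'V) 
          (simp add: w'_def K_simps K_\<phi> Kw Kn X1 \<phi>_simps \<phi>\<phi> algebra_simps flip: scaleR_add_left)
    qed
  qed
  define u where "u = (1/2) *\<^sub>R (w' + n)"
  define v where "v = (1/2) *\<^sub>R (n - w')"
  have fr: "hermitian_frame u v s (- s)"
    unfolding u_def v_def using n w' s by (intro null_frame) auto
  have N_lin: "linear N"
    using N by (simp add: admissible_def)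
  have uv: "w' = u - v" "n = u + v"
    by (simp_all add: u_def v_def scaleR_add_right[symmetric] scaleR_diff_right[symmetric] 
        scaleR_half_double flip: scaleR_2)
  have QN: "Q w' = \<sigma> *\<^sub>R w' + n" "Q n = \<sigma> *\<^sub>R n"
    using Q w' n by simp_all
  have "Q u + K u + N u = (1/2) *\<^sub>R ((Q w' + (K w' + N w')) + (Q n + (K n + N n)))"
    by (simp add: u_def Q_simps K_simps linear_add[OF N_lin] linear_scale[OF N_lin] algebra_simps)
  also have "\<dots> = (\<sigma> + 1/2) *\<^sub>R u + (1/2 - \<kappa>/2) *\<^sub>R v"
    unfolding QN KN unfolding uv by (simp add: algebra_simps) (simp flip: scaleR_add_left)
  finally have Mu: "Q u + K u + N u = (\<sigma> + 1/2) *\<^sub>R u + (1/2 - \<kappa>/2) *\<^sub>R v" .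
  have "Q v + K v + N v = (1/2) *\<^sub>R ((Q n + (K n + N n)) - (Q w' + (K w' + N w')))"
    by (simp add: v_def Q_simps K_simps linear_diff[OF N_lin] linear_scale[OF N_lin] algebra_simps)
  also have "\<dots> = (- 1/2 - \<kappa>/2) *\<^sub>R u + (\<sigma> - 1/2) *\<^sub>R v"
    unfolding QN KN unfolding uv by (simp add: algebra_simps) (simp flip: scaleR_add_left)
  finally have Mv: "Q v + K v + N v = (- 1/2 - \<kappa>/2) *\<^sub>R u + (\<sigma> - 1/2) *\<^sub>R v" .
  have "\<exists>m\<in>{1..11}. listed_sign m = s * - s \<and>
      listed_matrix m = (\<sigma> + 1/2, - 1/2 - \<kappa>/2, 1/2 - \<kappa>/2, \<sigma> - 1/2, h)"
  proof -
    have "\<exists>m\<in>{9, 10, 11}. listed_sign m = s * - s \<and>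
        listed_matrix m = (\<sigma> + 1/2, - 1/2 - \<kappa>/2, 1/2 - \<kappa>/2, \<sigma> - 1/2, h)"
      using s \<sigma> by (elim disjE conjE insertE; simp add: listed_sign_def listed_matrix_def)
    then show ?thesis by fastforce
  qed
  then show ?thesis
    using has_normal_formI[OF fr N Mu Mv] by auto
qed

text \<open>For \<open>h\<close> in \<open>{0, 2}\<close> the relations of \<open>quadratic_Q\<close> leave three pairs of trace and determinant: a
  nilpotent \<open>Q\<close>, a projection, and the identity plus a nilpotent map. In the last case \<open>\<kappa> = - h\<close>, because
  \<open>2 Q\<^sup>2 - h Q = 2 F\<close> for \<open>F = Q - 1\<close>, whereas it is \<open>- h F\<close> for \<open>F = Q\<close>.\<close>

theorem normal_form_exists:
  assumes h: "h \<in> {0, 2}"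
  shows "\<exists>n. has_normal_form n"
proof -
  obtain t d where QQ: "\<And>x. x \<in> V \<Longrightarrow> Q (Q x) = t *\<^sub>R Q x - d *\<^sub>R x"
    and td: "(2 * t - h) * t = 4 * d" "d * (h - t) = 0"
    using quadratic_Q by blast
  have commutator: "Q (K x) - K (Q x) = h *\<^sub>R Q x - 2 *\<^sub>R Q (Q x)" for x
    using Q_K[of x] by (simp add: algebra_simps)
  consider "t = 0" "d = 0" | "t = 1" "d = 0" "h = 2" | "t = 2" "d = 1" "h = 2"
    using h td by (auto simp: algebra_simps)
  then show ?thesis
  proof cases
    case 1
    show ?thesis
    proof (cases "\<forall>x\<in>V. Q x = 0")
      case True
      then show ?thesis
        using h by (intro normal_form_scalar[of 0]) auto
    next
      case False
      then obtain x0 where "x0 \<in> V" "Q x0 \<noteq> 0" by blast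
      then show ?thesis
        using 1 h by (intro normal_form_nilpotent[of 0 Q h x0])
          (auto simp: Q_V linear_Q g_Q Q_\<phi> QQ commutator)
    qed
  next
    case 2
    show ?thesis
    proof (cases "\<forall>x\<in>V. Q x = 0")
      case True
      then show ?thesis
        using h by (intro normal_form_scalar[of 0]) auto
    next
      case False
      then show ?thesis
        using 2 QQ by (auto intro: normal_form_projection)
    qed
  next
    case 3
    define F where "F x = Q x - P x" for x
    have F: "linear F"
      by (rule linearI) (simp_all add: F_def Q_simps linear_add[OF linear_P] linear_scale[OF linear_P] algebra_simps)
    show ?thesis
    proof (cases "\<forall>x\<in>V. Q x = x")
      case True
      then show ?thesis
        using 3 by (intro normal_form_scalar[of 1]) auto
    next
      case False
      then obtain x0 where x0: "x0 \<in> V" "F x0 \<noteq> 0"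
        by (auto simp: F_def P_id)
      have P_sym: "g (P x) y = g x (P y)" for x y
        by (metis P_V g_V g_sym)
      show ?thesis
      proof (rule normal_form_nilpotent[OF _ _ F _ _ _ _ x0])
        show "Q x = 1 *\<^sub>R x + F x" if "x \<in> V" for x
          using that by (simp add: F_def P_id)
        show "F x \<in> V" for x
          by (simp add: F_def Q_V V_closed P_V)
        show "g (F x) y = g x (F y)" for x y
          by (simp add: F_def g_simps g_Q P_sym)
        show "F (\<phi> x) = \<phi> (F x)" for x
          by (simp add: F_def \<phi>_simps Q_\<phi> \<phi>_P)
        show "F (F x) = 0" if "x \<in> V" for x
          using that by (simp add: F_def P_id Q_V V_closed QQ 3 Q_simps)
            (simp add: scaleR_2)
        show "F (K x) - K (F x) = (- 2) *\<^sub>R F x" if "x \<in> V" for x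
        proof -
          have "F (K x) - K (F x) = Q (K x) - K (Q x)"
            using that by (simp add: F_def P_id K_V K_simps)
          also have "\<dots> = 2 *\<^sub>R Q x - 2 *\<^sub>R (2 *\<^sub>R Q x - x)"
            using that by (simp add: commutator QQ 3)
          also have "\<dots> = (- 2) *\<^sub>R F x"
            using that by (simp add: F_def P_id scaleR_2 algebra_simps)
          finally show ?thesis .
        qed
      qed (use 3 in simp)
    qed
  qed
qed

end

section \<open>The isometry\<close>

lemma (in abelian_z_standard) semidirect_br:
  "semidirect \<theta> (\<lambda>x y. br (x - \<theta> x *\<^sub>R e0) (y - \<theta> y *\<^sub>R e0)) (br e0)"
proof (rule semidirect.intro)
  note \<theta>_simps = linear_add[OF linear_\<theta>] linear_scale[OF linear_\<theta>]
  let ?B = "\<lambda>x y. br (x - \<theta> x *\<^sub>R e0) (y - \<theta> y *\<^sub>R e0)"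
  show "linear \<theta>"
    by (rule linear_\<theta>)
  show "bilinear ?B"
    unfolding bilinear_def
    by (intro conjI allI linearI;
        simp only: \<theta>_simps scaleR_add_left br.add_left br.add_right br.diff_left br.diff_right;
        simp add: br.scaleR_left br.scaleR_right algebra_simps)
  show "linear (br e0)"
    by (rule linearI) (simp_all add: br_simps)
  fix x y z
  show "?B x x = 0"
    by simp
  show B: "\<theta> (?B x y) = 0" for x y
    unfolding \<theta>_eq_0 by (rule br_gg) (rule g_minus_\<theta>)
  show "?B (?B x y) z = 0"
  proof -
    have "br (p *\<^sub>R b + q *\<^sub>R \<xi>) w = 0" if "g w e0 = 0" for p q w
      by (simp add: br.add_left br.scaleR_left br_b[OF that] br_\<xi>)
    moreover have "?B x y = (\<tau> * g (?B x y) b) *\<^sub>R b + \<eta> (?B x y) *\<^sub>R \<xi>"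
      by (rule br_span) (rule g_minus_\<theta>)+
    ultimately have "br (?B x y) w = 0" if "g w e0 = 0" for w
      using that by metis
    then show ?thesis
      using g_minus_\<theta>[of z] by (simp add: B)
  qed
  have D: "br e0 x = br e0 (x - \<theta> x *\<^sub>R e0)" for x
    by (simp add: br_simps)
  show D\<theta>: "\<theta> (br e0 x) = 0" for x
    unfolding \<theta>_eq_0 by (subst D, rule br_gg) (rule g_minus_\<theta>)
  show "br e0 (?B x y) = ?B (br e0 x) y + ?B x (br e0 y)"
    using jacobi[of e0 "x - \<theta> x *\<^sub>R e0" "y - \<theta> y *\<^sub>R e0"] by (simp add: D\<theta> flip: D)
qed

context split_bracket
begin

lemma P_br_e0: "P (br e0 x) = Q x + K x"
proof -
  have "br e0 x = br e0 (P x) + (\<tau> * g x b) *\<^sub>R br e0 b"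
    by (subst (1) decompose[of x]) (simp add: br_simps br_\<xi>')
  also have "\<dots> = Q x + K x + (\<tau> * g x b) *\<^sub>R (h *\<^sub>R b - (2 * \<tau>) *\<^sub>R \<xi>)"
    by (simp add: br_e0_b br_e0[OF P_V] Q_P K_P)
  finally show ?thesis
    by (simp add: linear_add[OF linear_P] linear_diff[OF linear_P] linear_scale[OF linear_P]
        P_id Q_V K_V P_basis)
qed

text \<open>The coordinates of the normal frame \<open>u, s \<phi> u, v, s \<phi> v, b, \<xi>, e\<^sub>0\<close>. The factors \<open>s\<close> are needed because
  on the list \<open>d e\<^sup>6\<close> does not depend on the sign of the metric, so that \<open>\<phi> e\<^sub>1 = s e\<^sub>2\<close> and
  \<open>\<phi> e\<^sub>3 = s e\<^sub>4\<close>.\<close>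

lemma isometric_to_listed:
  assumes "has_normal_form n"
  shows "\<exists>s\<in>{1, -1}. sasaki_isometric br S (listed_bracket n \<tau> 0) (listed_structure n s \<tau> 0)"
proof -
  define \<epsilon> where "\<epsilon> = listed_sign n"
  obtain u v s N \<alpha> \<beta> \<gamma> \<delta> where n: "n \<in> {1..11}" and s: "s \<in> {1, -1}"
    and fr: "hermitian_frame u v s (s * \<epsilon>)" and adm: "admissible N"
    and M: "listed_matrix n = (\<alpha>, \<beta>, \<gamma>, \<delta>, h)"
    and Mu: "Q u + K u + N u = \<alpha> *\<^sub>R u + \<gamma> *\<^sub>R v" and Mv: "Q v + K v + N v = \<beta> *\<^sub>R u + \<delta> *\<^sub>R v"
    using assms unfolding has_normal_form_def \<epsilon>_def by blast
  note G = gram[OF fr]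
  have N: "linear N" "N x \<in> V" "N (P x) = N x" "g (N x) y = - g x (N y)" "N (\<phi> x) = \<phi> (N x)"
    "Q (N x) = N (Q x)" "K (N x) = N (K x)" for x y
    using adm unfolding admissible_def by blast+
  note N_simps = linear_add[OF N(1)] linear_scale[OF N(1)]
  have \<tau>': "\<tau> \<in> {1, -1}"
    using \<tau> by simp
  have ss: "s * s = 1" "s * (s * r) = r" and \<epsilon>\<epsilon>: "\<epsilon> * \<epsilon> = 1" "\<epsilon> * (\<epsilon> * r) = r" for r
    using s by (auto simp: \<epsilon>_def listed_sign_def)
  have s\<epsilon>: "s * (\<epsilon> * (s * (\<epsilon> * r))) = r" for r
    using s by (auto simp: \<epsilon>_def listed_sign_def)
  let ?D = "model_D \<alpha> \<beta> \<gamma> \<delta> h 0 \<tau>" and ?B = "model_B \<alpha> \<beta> \<gamma> \<delta> \<epsilon> \<tau>"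
  have lb: "listed_bracket n \<tau> 0 = semidirect_bracket (\<lambda>x. x $ 7) ?B ?D"
    using listed_bracket_semidirect[OF n, of \<tau> 0] by (simp add: M \<epsilon>_def)
  have sd: "semidirect (\<lambda>x. x $ 7) ?B ?D"
    using semidirect_model[OF n M \<tau>', of 0] by (simp add: \<epsilon>_def)
  define W :: "real^7 \<Rightarrow> 'a" where
    "W a = a$1 *\<^sub>R u + (s * a$2) *\<^sub>R \<phi> u + a$3 *\<^sub>R v + (s * a$4) *\<^sub>R \<phi> v" for a
  define U :: "real^7 \<Rightarrow> 'a" where "U a = W a + a$5 *\<^sub>R b + a$6 *\<^sub>R \<xi> + a$7 *\<^sub>R e0" for a
  define T :: "'a \<Rightarrow> real^7" where
    "T x = vector [s * g x u, g x (\<phi> u), s * \<epsilon> * g x v, \<epsilon> * g x (\<phi> v), \<tau> * g x b, \<eta> x, \<theta> x]" for x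
  have W_V: "W a \<in> V" for a
    by (simp add: W_def V_closed G(1,2))
  have UT: "U (T x) = x" for x
    using frame_expansion[OF dim_7 fr, of x] by (simp add: U_def W_def T_def mult.assoc)
  have g_W: "g (W a) u = s * a$1" "g (W a) (\<phi> u) = a$2" "g (W a) v = s * \<epsilon> * a$3" "g (W a) (\<phi> v) = \<epsilon> * a$4"
    "g (W a) b = 0" "g (W a) e0 = 0" "\<eta> (W a) = 0" for a
    using W_V[of a] by (simp_all add: W_def g_simps G ss V_def)
  have g_other: "g b x = 0" "g e0 x = 0" "g \<xi> x = 0" if "x \<in> {u, v, \<phi> u, \<phi> v}" for x
    using that G(1,2) by (auto simp: V_gram \<phi>_V)
  have TU: "T (U a) = a" for a
    by (simp add: T_def U_def vec_eq_7 g_simps g_W g_other base_gram \<eta>_simps \<eta>_b \<eta>_\<xi> \<eta>_e0 \<theta>_def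
        ss s\<epsilon> \<epsilon>\<epsilon> mult.assoc)
  have P_U: "P (U a) = W a" for a
    by (simp add: U_def linear_add[OF linear_P] linear_scale[OF linear_P] P_basis P_id W_V)
  have M_W: "Q (W a) + K (W a) + N (W a) = W (?D a)" for a
  proof -
    have "Q (W a) + K (W a) + N (W a) = a$1 *\<^sub>R (Q u + K u + N u) + (s * a$2) *\<^sub>R \<phi> (Q u + K u + N u)
      + a$3 *\<^sub>R (Q v + K v + N v) + (s * a$4) *\<^sub>R \<phi> (Q v + K v + N v)"
      by (simp add: W_def Q_simps K_simps N_simps Q_\<phi> K_\<phi> N(5) \<phi>_simps) (simp add: algebra_simps)
    also have "\<dots> = W (?D a)"
      unfolding Mu Mv by (simp add: W_def model_D_def \<phi>_simps algebra_simps)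
    finally show ?thesis .
  qed
  have \<omega>_W: "g (W a) (\<phi> (W c)) = - (a$1 * c$2 - a$2 * c$1) - \<epsilon> * (a$3 * c$4 - a$4 * c$3)" for a c
    unfolding W_def[of c]
    by (simp add: \<phi>_simps g_simps g_W G(19,20) ss) (simp add: algebra_simps ss)
  \<comment> \<open>The skew parts cancel, so the bracket on \<open>V\<close> can be computed from the modified derivation.\<close>
  have \<omega>_Q: "2 * g (Q x) (\<phi> y) = g (Q x + K x + N x) (\<phi> y) + g x (\<phi> (Q y + K y + N y))" for x y
    by (simp add: g_simps \<phi>_simps g_Q g_K N(4) Q_\<phi> K_\<phi> N(5))
  have lin_T: "linear T"
    by (rule linearI; simp add: T_def vec_eq_7 g_simps \<eta>_simps linear_add[OF linear_\<theta>] linear_scale[OF linear_\<theta>];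
        simp add: algebra_simps)
  have T_b: "T (p *\<^sub>R b - q *\<^sub>R \<xi>) = vector [0, 0, 0, 0, p, - q, 0]" for p q
  proof -
    have "p *\<^sub>R b - q *\<^sub>R \<xi> = U (vector [0, 0, 0, 0, p, - q, 0])"
      by (simp add: U_def W_def)
    then show ?thesis by (simp only: TU)
  qed
  have "sasaki_isometric (semidirect_bracket \<theta> (\<lambda>x y. br (x - \<theta> x *\<^sub>R e0) (y - \<theta> y *\<^sub>R e0)) (br e0)) S
    (semidirect_bracket (\<lambda>x. x $ 7) ?B ?D) (listed_structure n s \<tau> 0)"
  proof (rule sasaki_isometric_semidirect[OF semidirect_br sd lin_T _ N(1)])
    show "bij T"
      by (rule bij_betw_byWitness[of _ U]) (auto simp: UT TU)
    show "linear \<phi>" "linear \<eta>" "bilinear g"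
      by (fact linear_\<phi> linear_\<eta> bilinear_g)+
    show "g (N x) y + g x (N y) = 0" "N (\<phi> x) = \<phi> (N x)" "\<eta> (N x) = 0" for x y
      using N(2)[of x] by (simp_all add: N(4,5) V_def)
    show "N \<xi> = 0"
      using N(3)[of \<xi>] linear_0[OF N(1)] by (simp add: P_basis)
    show "T x $ 7 = \<theta> x" "Eta (listed_structure n s \<tau> 0) (T x) = \<eta> x" for x
      by (simp_all add: T_def)
    show "br e0 (N x) = N (br e0 x)" for x
      using N(3)[of "br e0 x"] by (simp add: br_e0 N(2,6,7) P_br_e0 N_simps)
    show "T \<xi> = Xi (listed_structure n s \<tau> 0)"
      using T_b[of 0 "- 1"] by (simp add: vec_eq_7 axis_def)
    show "T (\<phi> x) = Phi (listed_structure n s \<tau> 0) (T x)" for x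
      by (simp add: Phi_listed[OF n s \<tau>'] model_phi_def T_def vec_eq_7 g_\<phi> g_\<phi>_\<phi> \<eta>_\<phi> g_simps \<phi>_b \<phi>_e0
          \<theta>_def ss mult.assoc g_W) (simp add: G(19,20) g_simps)
    show "Met (listed_structure n s \<tau> 0) (T x) (T y) = g x y" for x y
    proof -
      define a c where "a = T x" and "c = T y"
      have "g (U a) (U c) = listed_metric n s \<tau> a c"
        unfolding U_def[of c] W_def[of c]
        by (simp add: U_def[of a] g_simps g_W g_other base_gram V_gram W_V listed_metric_eq flip: \<epsilon>_def)
          (simp add: algebra_simps ss)
      then show ?thesis
        by (simp add: a_def c_def UT)
    qed
    show "?D (T x) = T (br e0 x + N x)" for x
    proof -
      define a where "a = T x"
      have "br e0 (U a) + N (U a) = Q (W a) + K (W a) + N (W a) + a$5 *\<^sub>R (h *\<^sub>R b - (2 * \<tau>) *\<^sub>R \<xi>)"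
        using N(3)[of "U a"] by (simp add: P_U) (simp add: U_def br_simps br_e0_b br_\<xi>' br_e0 W_V)
      also have "\<dots> = U (?D a)"
        unfolding M_W by (simp add: U_def model_D_def algebra_simps)
      finally have "T (br e0 (U a) + N (U a)) = ?D a"
        by (simp add: TU)
      then show ?thesis
        by (simp add: a_def UT)
    qed
    show "T (br (x - \<theta> x *\<^sub>R e0) (y - \<theta> y *\<^sub>R e0)) = ?B (T x) (T y)" for x y
    proof -
      define a c where "a = T x" and "c = T y"
      have P: "P x = W a" "P y = W c"
        using P_U[of a] P_U[of c] by (simp_all add: a_def c_def UT)
      have "2 * g (Q (W a)) (\<phi> (W c)) = g (W (?D a)) (\<phi> (W c)) + g (W a) (\<phi> (W (?D c)))"
        unfolding \<omega>_Q M_W ..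
      then have f: "2 * \<tau> * g (Q (W a)) (\<phi> (W c))
        = \<tau> * (g (W (?D a)) (\<phi> (W c)) + g (W a) (\<phi> (W (?D c))))"
        by (simp add: mult.left_commute)
      show ?thesis
        unfolding br_horizontal br_V_V[OF P_V P_V]
        unfolding T_b Q_P P f \<omega>_W a_def[symmetric] c_def[symmetric]
        by (simp add: vec_eq_7 model_B_def model_D_def Let_def) (simp add: algebra_simps)
    qed
  qed
  then show ?thesis
    unfolding bracket_semidirect[symmetric] lb[symmetric] using s by blast
qed

end

section \<open>D-homotheties\<close>

lemma D_homothety_simps [simp]:
  "Phi (D_homothety a S) = Phi S" "Xi (D_homothety a S) = inverse a *\<^sub>R Xi S"
  "Eta (D_homothety a S) x = a * Eta S x"
  "Met (D_homothety a S) x y = a * Met S x y + (a\<^sup>2 - a) * (Eta S x * Eta S y)"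
  by (simp_all add: D_homothety_def)

lemma (in contact_metric) contact_metric_D_homothety:
  assumes a: "a > 0"
  shows "contact_metric (D_homothety a S)"
proof
  let ?S = "D_homothety a S"
  have met: "pseudo_metric (Met ?S)"
    unfolding pseudo_metric_def
  proof (intro conjI allI impI)
    show "bilinear (Met ?S)"
      unfolding bilinear_def
      by (intro conjI allI linearI; simp add: g_simps \<eta>_simps; simp add: algebra_simps)
    show "Met ?S x y = Met ?S y x" for x y
      by (simp add: g_sym)
    fix x assume x: "\<forall>y. Met ?S x y = 0"
    have "a\<^sup>2 * \<eta> x = Met ?S x \<xi>"
      by (simp add: g_\<xi>' \<eta>_\<xi> algebra_simps)
    with x a have "\<eta> x = 0" by simp
    with x a have "g x y = 0" for y by simp
    then show "x = 0" by (rule g_nondegenerate)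
  qed
  have lin: "linear (Eta ?S)"
    by (rule linearI) (simp_all add: \<eta>_simps algebra_simps)
  show "almost_contact_metric ?S"
    unfolding almost_contact_metric_def
  proof (intro conjI allI)
    show "Eta ?S (Xi ?S) = 1"
      using a by (simp add: \<eta>_simps \<eta>_\<xi>)
    show "Met ?S (Xi ?S) (Xi ?S) = 1" "Eta ?S x = Met ?S (Xi ?S) x" for x
      using a by (simp_all add: \<eta>_simps \<eta>_\<xi> g_simps g_\<xi> field_simps power2_eq_square)
    show "Phi ?S (Phi ?S x) = - x + Eta ?S x *\<^sub>R Xi ?S" for x
      using a by (simp add: \<phi>_\<phi>)
    show "Met ?S (Phi ?S x) (Phi ?S y) = Met ?S x y - Eta ?S x * Eta ?S y" for x y
      by (simp add: g_\<phi>_\<phi> \<eta>_\<phi> power2_eq_square algebra_simps)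
  qed (simp_all add: met lin linear_\<phi> \<eta>_\<phi>)
qed

text \<open>The metric on the complement of \<open>\<xi>\<close> is multiplied by \<open>1/c\<^sup>2\<close>, so \<open>e\<^sub>0\<close> has to be multiplied by \<open>c\<close> to keep
  its square \<open>\<tau>\<close>. A negative \<open>c\<close> also reverses \<open>e\<^sub>0\<close>, which changes the sign of \<open>h\<close>.\<close>

lemma (in abelian_z_standard) abelian_z_standard_D_homothety:
  assumes c: "c \<noteq> 0"
  shows "abelian_z_standard br (D_homothety (1 / c\<^sup>2) S) \<gg> (c *\<^sub>R e0) \<tau>"
proof -
  let ?S = "D_homothety (1 / c\<^sup>2) S"
  have a: "1 / c\<^sup>2 > 0"
    using c by simp
  interpret S': contact_metric ?S
    by (rule contact_metric_D_homothety[OF a])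
  have "sasaki br ?S"
    using sas unfolding sasaki_def
    by (simp add: S'.acm lie_d_def fundamental_form_def \<eta>_\<phi> c \<eta>_br flip: scaleR_add_left)
  moreover have "z_standard br ?S \<gg> (c *\<^sub>R e0) \<tau>"
    unfolding z_standard_def
  proof (intro conjI allI ballI)
    show "ideal_of br \<gg>" "nilpotent_in br \<gg>" "\<tau> \<in> {1, -1}"
      using zst by (simp_all add: z_standard_def)
    show "c *\<^sub>R e0 \<notin> \<gg>"
      using c \<tau> by (auto simp: mem_gg g_simps g_e0_e0)
    show "\<exists>x\<in>\<gg>. \<exists>d. v = x + d *\<^sub>R (c *\<^sub>R e0)" for v
      using g_minus_\<theta>[of v] c
      by (intro bexI[of _ "v - \<theta> v *\<^sub>R e0"] exI[of _ "\<theta> v / c"]) (simp_all add: mem_gg)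
    show "Met ?S x (c *\<^sub>R e0) = 0" if "x \<in> \<gg>" for x
      using that by (simp add: mem_gg g_simps \<eta>_simps \<eta>_e0)
    show "Met ?S (c *\<^sub>R e0) (c *\<^sub>R e0) = \<tau>"
      using c by (simp add: g_simps \<eta>_simps \<eta>_e0 g_e0_e0 power2_eq_square)
    have "g (c *\<^sub>R b) e0 = 0" "\<And>x. x \<in> \<gg> \<Longrightarrow> br (c *\<^sub>R b) x = 0"
      using br_b by (simp_all add: g_simps g_b_e0 br_simps mem_gg)
    then show "- Phi ?S (c *\<^sub>R e0) \<in> center_of br \<gg>"
      by (simp add: center_of_def mem_gg \<phi>_simps \<phi>_e0)
  qed
  moreover have "span {- Phi ?S (c *\<^sub>R e0), Xi ?S} = span {- \<phi> e0, \<xi>}"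
  proof -
    have sub: "span {x, y} \<subseteq> span {x', y'}" if "x = p *\<^sub>R x'" "y = q *\<^sub>R y'" for x y x' y' :: 'a and p q
      unfolding that by (intro span_minimal) (simp_all add: span_scale span_base)
    show ?thesis
    proof (intro equalityI)
      show "span {- Phi ?S (c *\<^sub>R e0), Xi ?S} \<subseteq> span {- \<phi> e0, \<xi>}"
        by (rule sub[of _ c _ _ "c\<^sup>2"]) (simp_all add: \<phi>_simps)
      show "span {- \<phi> e0, \<xi>} \<subseteq> span {- Phi ?S (c *\<^sub>R e0), Xi ?S}"
        by (rule sub[of _ "1 / c" _ _ "1 / c\<^sup>2"]) (use c in \<open>simp_all add: \<phi>_simps\<close>)
    qed
  qed
  then have "abelian_kahler_reduction br ?S \<gg> (c *\<^sub>R e0)"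
    using abel unfolding abelian_kahler_reduction_def by metis
  ultimately show ?thesis
    using S'.contact_metric_axioms dim2 by (simp add: abelian_z_standard_def abelian_z_standard_axioms_def)
qed

lemma (in abelian_z_standard) h_D_homothety:
  assumes c: "c \<noteq> 0"
  shows "abelian_z_standard.h br (D_homothety (1 / c\<^sup>2) S) (c *\<^sub>R e0) \<tau> = c * h"
proof -
  let ?S = "D_homothety (1 / c\<^sup>2) S"
  interpret S': abelian_z_standard br ?S \<gg> "c *\<^sub>R e0" \<tau>
    by (rule abelian_z_standard_D_homothety[OF c])
  have b: "S'.b = c *\<^sub>R b"
    by (simp add: S'.b_def \<phi>_simps \<phi>_e0)
  show ?thesis
    unfolding S'.h_def h_def b
    using c by (simp add: br_simps g_simps \<eta>_simps \<eta>_b power2_eq_square)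
qed

section \<open>The classification\<close>

lemma (in abelian_z_standard) split_bracket_exists:
  assumes "DIM('a) = 7"
  shows "\<exists>Q K. split_bracket br S \<gg> e0 \<tau> Q K"
  apply (rule bracket_parts)
  subgoal for Q K
    by (rule exI[of _ Q], rule exI[of _ K], rule split_bracket.intro[OF abelian_z_standard_axioms],
        rule split_bracket_axioms.intro; (assumption | rule assms))
  done

theorem theorem5p8:
  fixes br :: "'a::euclidean_space \<Rightarrow> 'a \<Rightarrow> 'a"
    and S :: "'a contact_structure"
    and \<gg> :: "'a set" and e0 :: 'a and \<tau>0 :: real
  assumes "DIM('a) = 7"
    and "sasaki br S"
    and "z_standard br S \<gg> e0 \<tau>0"
    and "abelian_kahler_reduction br S \<gg> e0"
  shows "(\<exists>a>0. \<exists>n\<in>{1..11}. \<exists>s\<in>{1, -1}. \<exists>\<tau>\<in>{1, -1}. \<exists>l.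
            sasaki_isometric br (D_homothety a S)
              (listed_bracket n \<tau> l) (listed_structure n s \<tau> l))
       \<and> (\<forall>n\<in>{1..11}. \<forall>s\<in>{1, -1}. \<forall>\<tau>\<in>{1, -1}. \<forall>l.
            sasaki (listed_bracket n \<tau> l) (listed_structure n s \<tau> l))"
proof
  have "almost_contact_metric S"
    using assms(2) by (simp add: sasaki_def)
  then interpret S: abelian_z_standard br S \<gg> e0 \<tau>0
    using assms
    by (simp add: abelian_z_standard_def contact_metric_def abelian_z_standard_axioms_def)
  define c where "c = (if S.h = 0 then 1 else 2 / S.h)"
  have c: "c \<noteq> 0" "c * S.h \<in> {0, 2}"
    by (auto simp: c_def)
  let ?S = "D_homothety (1 / c\<^sup>2) S"
  interpret S': abelian_z_standard br ?S \<gg> "c *\<^sub>R e0" \<tau>0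
    by (rule S.abelian_z_standard_D_homothety[OF c(1)])
  have h: "S'.h \<in> {0, 2}"
    using c S.h_D_homothety[OF c(1)] by simp
  obtain Q K where "split_bracket br ?S \<gg> (c *\<^sub>R e0) \<tau>0 Q K"
    using S'.split_bracket_exists[OF assms(1)] by blast
  then interpret B: split_bracket br ?S \<gg> "c *\<^sub>R e0" \<tau>0 Q K .
  obtain n where n: "B.has_normal_form n"
    using B.normal_form_exists[OF h] by blast
  then have "n \<in> {1..11}"
    by (auto simp: B.has_normal_form_def)
  moreover obtain s where "s \<in> {1, -1}"
    "sasaki_isometric br ?S (listed_bracket n \<tau>0 0) (listed_structure n s \<tau>0 0)"
    using B.isometric_to_listed[OF n] by blast
  moreover have "1 / c\<^sup>2 > 0" "\<tau>0 \<in> {1, -1}"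
    using c S.\<tau> by auto
  ultimately show "\<exists>a>0. \<exists>n\<in>{1..11}. \<exists>s\<in>{1, -1}. \<exists>\<tau>\<in>{1, -1}. \<exists>l.
      sasaki_isometric br (D_homothety a S) (listed_bracket n \<tau> l) (listed_structure n s \<tau> l)"
    by blast
  show "\<forall>n\<in>{1..11}. \<forall>s\<in>{1, -1}. \<forall>\<tau>\<in>{1, -1}. \<forall>l.
      sasaki (listed_bracket n \<tau> l) (listed_structure n s \<tau> l)"
    using sasaki_listed by blast
qed

end
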